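(* Let $(\mathbf{C},\mathcal{M}_{\mathbf{C}})$ be a locally small $\mathcal{M}$-category. Then $(\mathcal{P}(\mathbf{C}),\mathcal{M}_{\mathcal{P}(\mathbf{C})})$ is a cocomplete $\mathcal{M}$-category.
   Context: A stable system of monics $\mathcal{M}_{\mathbf{C}}$ in a category $\mathbf{C}$ is a collection of monics containing all isomorphisms, closed under composition, and such that the pullback of any $m\in\mathcal{M}_{\mathbf{C}}$ along any map exists and lies in $\mathcal{M}_{\mathbf{C}}$. An $\mathcal{M}$-category is a category $\mathbf{C}$ with a stable system of monics $\mathcal{M}_{\mathbf{C}}$. It is locally small if $\mathbf{C}$ is locally small and, for each object $D$, the isomorphism classes (over $D$) of maps in $\mathcal{M}_{\mathbf{C}}$ with codomain $D$ form a small partially ordered set. $\mathsf{Par}(\mathbf{C})$ is the category with the objects of $\mathbf{C}$, whose morphisms $X\to Y$ are isomorphism classes $(m,f)$ of spans $X\xleftarrow{m}Z\xrightarrow{f}Y$ with $m\in\mathcal{M}_{\mathbf{C}}$; composition is by pullback. The inclusion $\mathbf{C}\hookrightarrow\mathsf{Par}(\mathbf{C})$ is identity on objects and sends $f$ to $(1,f)$. An $\mathcal{M}$-category $(\mathbf{C},\mathcal{M}_{\mathbf{C}})$ is cocomplete if $\mathbf{C}$ has all small colimits and the inclusion $\mathbf{C}\hookrightarrow\mathsf{Par}(\mathbf{C})$ preserves small colimits. A presheaf on $\mathbf{C}$ is small if it is a small colimit of representables; $\mathcal{P}(\mathbf{C})$ is the category of small presheaves on $\mathbf{C}$, and $\mathbf{y}$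 is the Yoneda embedding. A map $\mu\colon P\Rightarrow Q$ of small presheaves is in $\mathcal{M}_{\mathcal{P}(\mathbf{C})}$ iff for every $\gamma\colon\mathbf{y}D\Rightarrow Q$ there is a map $m\colon C\to D$ in $\mathcal{M}_{\mathbf{C}}$ such that $\mathbf{y}m$ is a pullback of $\mu$ along $\gamma$. For $\mathbf{C}$ a locally small $\mathcal{M}$-category, $\mathcal{M}_{\mathcal{P}(\mathbf{C})}$ is a stable system of monics. *)

theory Defs
  imports Main "HOL-Library.Equipollence" "HOL-Library.FuncSet"
begin

text \<open>
  Size is measured against a type \<open>'u\<close> playing the role of the universe of small sets: a set
  (of elements of any type) is small if it has strictly smaller cardinality than \<open>'u\<close>, and the
  cardinality of \<open>'u\<close> is required to be a regular strong limit. If \<open>'u\<close> is uncountable this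
  says that it is strongly inaccessible, i.e. that the small sets are those of a Grothendieck
  universe. Uncountability is not imposed, so that \<open>nat\<close> (small = finite) is a model as well.
\<close>

definition small :: "'u itself \<Rightarrow> 'a set \<Rightarrow> bool" where
  "small _ A \<longleftrightarrow> A \<prec> (UNIV :: 'u set)"

definition universe :: "'u itself \<Rightarrow> bool" where
  "universe u \<longleftrightarrow>
     infinite (UNIV :: 'u set) \<and>
     (\<forall>A :: 'u set. small u A \<longrightarrow> small u (Pow A)) \<and>
     (\<forall>(I :: 'u set) (A :: 'u \<Rightarrow> 'u set).
        small u I \<longrightarrow> (\<forall>i\<in>I. small u (A i)) \<longrightarrow> small u (\<Union>i\<in>I. A i))"


section \<open>Categories, functors, colimits, pullbacks\<close>

text \<open>
  Hom-sets need not be disjoint, so a map is always considered together with its domain and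
  codomain. \<open>Comp C X Y Z g f\<close> is the composite of \<open>f : X \<rightarrow> Y\<close> and \<open>g : Y \<rightarrow> Z\<close>. The values of
  \<open>Hom\<close>, \<open>Id\<close>, \<open>Comp\<close> outside \<open>Ob\<close> are irrelevant.
\<close>

record ('o, 'm) category =
  Ob :: "'o set"
  Hom :: "'o \<Rightarrow> 'o \<Rightarrow> 'm set"
  Id :: "'o \<Rightarrow> 'm"
  Comp :: "'o \<Rightarrow> 'o \<Rightarrow> 'o \<Rightarrow> 'm \<Rightarrow> 'm \<Rightarrow> 'm"

definition is_category :: "('o, 'm) category \<Rightarrow> bool" where
  "is_category C \<longleftrightarrow>
     (\<forall>X\<in>Ob C. Id C X \<in> Hom C X X) \<and>
     (\<forall>X\<in>Ob C. \<forall>Y\<in>Ob C. \<forall>Z\<in>Ob C. \<forall>f\<in>Hom C X Y. \<forall>g\<in>Hom C Y Z.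
        Comp C X Y Z g f \<in> Hom C X Z) \<and>
     (\<forall>X\<in>Ob C. \<forall>Y\<in>Ob C. \<forall>f\<in>Hom C X Y.
        Comp C X X Y f (Id C X) = f \<and> Comp C X Y Y (Id C Y) f = f) \<and>
     (\<forall>W\<in>Ob C. \<forall>X\<in>Ob C. \<forall>Y\<in>Ob C. \<forall>Z\<in>Ob C.
        \<forall>f\<in>Hom C W X. \<forall>g\<in>Hom C X Y. \<forall>h\<in>Hom C Y Z.
          Comp C W Y Z h (Comp C W X Y g f) = Comp C W X Z (Comp C X Y Z h g) f)"

definition locally_small :: "'u itself \<Rightarrow> ('o, 'm) category \<Rightarrow> bool" where
  "locally_small u C \<longleftrightarrow> is_category C \<and> (\<forall>X\<in>Ob C. \<forall>Y\<in>Ob C. small u (Hom C X Y))"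

text \<open>
  Every small category is isomorphic to one whose objects and maps are elements of \<open>'u\<close>, so
  only these are used as shapes of small diagrams.
\<close>

definition small_category :: "('u, 'u) category \<Rightarrow> bool" where
  "small_category J \<longleftrightarrow> locally_small TYPE('u) J \<and> small TYPE('u) (Ob J)"

definition full_subcategory :: "('o, 'm) category \<Rightarrow> 'o set \<Rightarrow> ('o, 'm) category" where
  "full_subcategory C S = C\<lparr>Ob := Ob C \<inter> S\<rparr>"

record ('o1, 'm1, 'o2, 'm2) functor_data =
  OMap :: "'o1 \<Rightarrow> 'o2"
  AMap :: "'o1 \<Rightarrow> 'o1 \<Rightarrow> 'm1 \<Rightarrow> 'm2"

definition is_functor ::
  "('o1, 'm1) category \<Rightarrow> ('o2, 'm2) category \<Rightarrow> ('o1, 'm1, 'o2, 'm2) functor_data \<Rightarrow> bool" where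
  "is_functor A B F \<longleftrightarrow>
     (\<forall>X\<in>Ob A. OMap F X \<in> Ob B) \<and>
     (\<forall>X\<in>Ob A. \<forall>Y\<in>Ob A. \<forall>f\<in>Hom A X Y. AMap F X Y f \<in> Hom B (OMap F X) (OMap F Y)) \<and>
     (\<forall>X\<in>Ob A. AMap F X X (Id A X) = Id B (OMap F X)) \<and>
     (\<forall>X\<in>Ob A. \<forall>Y\<in>Ob A. \<forall>Z\<in>Ob A. \<forall>f\<in>Hom A X Y. \<forall>g\<in>Hom A Y Z.
        AMap F X Z (Comp A X Y Z g f) =
        Comp B (OMap F X) (OMap F Y) (OMap F Z) (AMap F Y Z g) (AMap F X Y f))"

definition functor_comp ::
  "('o2, 'm2, 'o3, 'm3) functor_data \<Rightarrow> ('o1, 'm1, 'o2, 'm2) functor_data \<Rightarrow>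
   ('o1, 'm1, 'o3, 'm3) functor_data" where
  "functor_comp G F =
     \<lparr>OMap = (\<lambda>X. OMap G (OMap F X)),
      AMap = (\<lambda>X Y f. AMap G (OMap F X) (OMap F Y) (AMap F X Y f))\<rparr>"

definition is_cocone ::
  "('o, 'm) category \<Rightarrow> ('j, 'k) category \<Rightarrow> ('j, 'k, 'o, 'm) functor_data \<Rightarrow>
   'o \<Rightarrow> ('j \<Rightarrow> 'm) \<Rightarrow> bool" where
  "is_cocone C J F L \<iota> \<longleftrightarrow>
     L \<in> Ob C \<and>
     (\<forall>j\<in>Ob J. \<iota> j \<in> Hom C (OMap F j) L) \<and>
     (\<forall>j\<in>Ob J. \<forall>k\<in>Ob J. \<forall>u\<in>Hom J j k.
        Comp C (OMap F j) (OMap F k) L (\<iota> k) (AMap F j k u) = \<iota> j)"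

definition is_colimit ::
  "('o, 'm) category \<Rightarrow> ('j, 'k) category \<Rightarrow> ('j, 'k, 'o, 'm) functor_data \<Rightarrow>
   'o \<Rightarrow> ('j \<Rightarrow> 'm) \<Rightarrow> bool" where
  "is_colimit C J F L \<iota> \<longleftrightarrow>
     is_cocone C J F L \<iota> \<and>
     (\<forall>T \<tau>. is_cocone C J F T \<tau> \<longrightarrow>
        (\<exists>!h. h \<in> Hom C L T \<and> (\<forall>j\<in>Ob J. Comp C (OMap F j) L T h (\<iota> j) = \<tau> j)))"

definition has_small_colimits :: "'u itself \<Rightarrow> ('o, 'm) category \<Rightarrow> bool" where
  "has_small_colimits _ C \<longleftrightarrow>
     (\<forall>(J :: ('u, 'u) category) F.
        small_category J \<longrightarrow> is_functor J C F \<longrightarrow> (\<exists>L \<iota>. is_colimit C J F L \<iota>))"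

definition preserves_small_colimits ::
  "'u itself \<Rightarrow> ('o1, 'm1) category \<Rightarrow> ('o2, 'm2) category \<Rightarrow>
   ('o1, 'm1, 'o2, 'm2) functor_data \<Rightarrow> bool" where
  "preserves_small_colimits _ A B G \<longleftrightarrow>
     (\<forall>(J :: ('u, 'u) category) F L \<iota>.
        small_category J \<longrightarrow> is_functor J A F \<longrightarrow> is_colimit A J F L \<iota> \<longrightarrow>
        is_colimit B J (functor_comp G F) (OMap G L) (\<lambda>j. AMap G (OMap F j) L (\<iota> j)))"

definition is_iso :: "('o, 'm) category \<Rightarrow> 'o \<Rightarrow> 'o \<Rightarrow> 'm \<Rightarrow> bool" where
  "is_iso C X Y f \<longleftrightarrow>
     f \<in> Hom C X Y \<and>
     (\<exists>g\<in>Hom C Y X. Comp C X Y X g f = Id C X \<and> Comp C Y X Y f g = Id C Y)"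

definition is_monic :: "('o, 'm) category \<Rightarrow> 'o \<Rightarrow> 'o \<Rightarrow> 'm \<Rightarrow> bool" where
  "is_monic C X Y m \<longleftrightarrow>
     m \<in> Hom C X Y \<and>
     (\<forall>W\<in>Ob C. \<forall>f\<in>Hom C W X. \<forall>g\<in>Hom C W X.
        Comp C W X Y m f = Comp C W X Y m g \<longrightarrow> f = g)"

text \<open>
  \<open>is_pullback C A B D f g P p q\<close>: the cospan \<open>f : A \<rightarrow> D\<close>, \<open>g : B \<rightarrow> D\<close> has \<open>P\<close> with
  \<open>p : P \<rightarrow> A\<close>, \<open>q : P \<rightarrow> B\<close> as a pullback; thus \<open>p\<close> is a pullback of \<open>g\<close> along \<open>f\<close>.
\<close>

definition is_pullback ::
  "('o, 'm) category \<Rightarrow> 'o \<Rightarrow> 'o \<Rightarrow> 'o \<Rightarrow> 'm \<Rightarrow> 'm \<Rightarrow> 'o \<Rightarrow> 'm \<Rightarrow> 'm \<Rightarrow> bool" where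
  "is_pullback C A B D f g P p q \<longleftrightarrow>
     A \<in> Ob C \<and> B \<in> Ob C \<and> D \<in> Ob C \<and> P \<in> Ob C \<and>
     f \<in> Hom C A D \<and> g \<in> Hom C B D \<and> p \<in> Hom C P A \<and> q \<in> Hom C P B \<and>
     Comp C P A D f p = Comp C P B D g q \<and>
     (\<forall>T\<in>Ob C. \<forall>a\<in>Hom C T A. \<forall>b\<in>Hom C T B.
        Comp C T A D f a = Comp C T B D g b \<longrightarrow>
        (\<exists>!h. h \<in> Hom C T P \<and> Comp C T P A p h = a \<and> Comp C T P B q h = b))"


section \<open>\<open>\<M>\<close>-categories and partial maps\<close>

text \<open>A collection of maps is given by its subset \<open>M X Y\<close> of each hom-set \<open>Hom C X Y\<close>.\<close>

definition stable_system_of_monics ::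
  "('o, 'm) category \<Rightarrow> ('o \<Rightarrow> 'o \<Rightarrow> 'm set) \<Rightarrow> bool" where
  "stable_system_of_monics C M \<longleftrightarrow>
     (\<forall>X\<in>Ob C. \<forall>Y\<in>Ob C. \<forall>m\<in>M X Y. is_monic C X Y m) \<and>
     (\<forall>X\<in>Ob C. \<forall>Y\<in>Ob C. \<forall>f. is_iso C X Y f \<longrightarrow> f \<in> M X Y) \<and>
     (\<forall>X\<in>Ob C. \<forall>Y\<in>Ob C. \<forall>Z\<in>Ob C. \<forall>m\<in>M X Y. \<forall>n\<in>M Y Z. Comp C X Y Z n m \<in> M X Z) \<and>
     (\<forall>X\<in>Ob C. \<forall>Y\<in>Ob C. \<forall>W\<in>Ob C. \<forall>m\<in>M X Y. \<forall>f\<in>Hom C W Y.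
        (\<exists>P p q. is_pullback C W X Y f m P p q) \<and>
        (\<forall>P p q. is_pullback C W X Y f m P p q \<longrightarrow> p \<in> M P W))"

definition M_category :: "('o, 'm) category \<Rightarrow> ('o \<Rightarrow> 'o \<Rightarrow> 'm set) \<Rightarrow> bool" where
  "M_category C M \<longleftrightarrow> is_category C \<and> stable_system_of_monics C M"

definition M_maps_into ::
  "('o, 'm) category \<Rightarrow> ('o \<Rightarrow> 'o \<Rightarrow> 'm set) \<Rightarrow> 'o \<Rightarrow> ('o \<times> 'm) set" where
  "M_maps_into C M D = {(X, m). X \<in> Ob C \<and> m \<in> M X D}"

definition iso_over ::
  "('o, 'm) category \<Rightarrow> ('o \<Rightarrow> 'o \<Rightarrow> 'm set) \<Rightarrow> 'o \<Rightarrow> (('o \<times> 'm) \<times> ('o \<times> 'm)) set" where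
  "iso_over C M D =
     {((X, m), (X', m')). (X, m) \<in> M_maps_into C M D \<and> (X', m') \<in> M_maps_into C M D \<and>
        (\<exists>\<phi>. is_iso C X X' \<phi> \<and> Comp C X X' D m' \<phi> = m)}"

text \<open>
  The isomorphism classes of \<open>\<M>\<close>-maps into \<open>D\<close> are ordered by factorisation over \<open>D\<close>. That
  this is a partial order is automatic, \<open>\<M>\<close>-maps being monic; what is being required is that
  there is only a small set of them.
\<close>

definition locally_small_M_category ::
  "'u itself \<Rightarrow> ('o, 'm) category \<Rightarrow> ('o \<Rightarrow> 'o \<Rightarrow> 'm set) \<Rightarrow> bool" where
  "locally_small_M_category u C M \<longleftrightarrow>
     M_category C M \<and> locally_small u C \<and>
     (\<forall>D\<in>Ob C. small u (M_maps_into C M D // iso_over C M D))"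

text \<open>\<open>(Z, m, f)\<close> stands for the span \<open>X \<leftarrow> Z \<rightarrow> Y\<close> with left leg \<open>m\<close> and right leg \<open>f\<close>.\<close>

definition spans ::
  "('o, 'm) category \<Rightarrow> ('o \<Rightarrow> 'o \<Rightarrow> 'm set) \<Rightarrow> 'o \<Rightarrow> 'o \<Rightarrow> ('o \<times> 'm \<times> 'm) set" where
  "spans C M X Y = {(Z, m, f). Z \<in> Ob C \<and> m \<in> M Z X \<and> f \<in> Hom C Z Y}"

definition span_iso ::
  "('o, 'm) category \<Rightarrow> ('o \<Rightarrow> 'o \<Rightarrow> 'm set) \<Rightarrow> 'o \<Rightarrow> 'o \<Rightarrow>
   (('o \<times> 'm \<times> 'm) \<times> ('o \<times> 'm \<times> 'm)) set" where
  "span_iso C M X Y =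
     {((Z, m, f), (Z', m', f')). (Z, m, f) \<in> spans C M X Y \<and> (Z', m', f') \<in> spans C M X Y \<and>
        (\<exists>\<phi>. is_iso C Z Z' \<phi> \<and> Comp C Z Z' X m' \<phi> = m \<and> Comp C Z Z' Y f' \<phi> = f)}"

text \<open>
  The composite of two classes of spans consists of all spans obtained from any choice of
  representatives and any choice of pullback; these form a single isomorphism class.
\<close>

definition Par ::
  "('o, 'm) category \<Rightarrow> ('o \<Rightarrow> 'o \<Rightarrow> 'm set) \<Rightarrow> ('o, ('o \<times> 'm \<times> 'm) set) category" where
  "Par C M =
     \<lparr>Ob = Ob C,
      Hom = (\<lambda>X Y. spans C M X Y // span_iso C M X Y),
      Id = (\<lambda>X. span_iso C M X X `` {(X, Id C X, Id C X)}),
      Comp = (\<lambda>X Y Z t s.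
        {(W, Comp C W A X m p, Comp C W B Z g q) | W A B m f n g p q.
           (A, m, f) \<in> s \<and> (B, n, g) \<in> t \<and> is_pullback C A B Y f n W p q})\<rparr>"

definition Par_inclusion ::
  "('o, 'm) category \<Rightarrow> ('o \<Rightarrow> 'o \<Rightarrow> 'm set) \<Rightarrow>
   ('o, 'm, 'o, ('o \<times> 'm \<times> 'm) set) functor_data" where
  "Par_inclusion C M =
     \<lparr>OMap = (\<lambda>X. X), AMap = (\<lambda>X Y f. span_iso C M X Y `` {(X, Id C X, f)})\<rparr>"

definition cocomplete_M_category ::
  "'u itself \<Rightarrow> ('o, 'm) category \<Rightarrow> ('o \<Rightarrow> 'o \<Rightarrow> 'm set) \<Rightarrow> bool" where
  "cocomplete_M_category u C M \<longleftrightarrow>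
     M_category C M \<and>
     has_small_colimits u C \<and>
     preserves_small_colimits u C (Par C M) (Par_inclusion C M)"


section \<open>Small presheaves\<close>

text \<open>
  Presheaves take values in small subsets of \<open>'u\<close>, and the hom-sets of the base category are
  themselves sets of elements of \<open>'u\<close>, so that representables are presheaves without any
  encoding. For \<open>f : X \<rightarrow> Y\<close>, \<open>Act P X Y f\<close> is the action \<open>P Y \<rightarrow> P X\<close>.
\<close>

record ('o, 'u) presheaf =
  Val :: "'o \<Rightarrow> 'u set"
  Act :: "'o \<Rightarrow> 'o \<Rightarrow> 'u \<Rightarrow> 'u \<Rightarrow> 'u"

definition is_presheaf :: "('o, 'u) category \<Rightarrow> ('o, 'u) presheaf \<Rightarrow> bool" where
  "is_presheaf C P \<longleftrightarrow>
     (\<forall>X\<in>Ob C. small TYPE('u) (Val P X)) \<and>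
     (\<forall>X\<in>Ob C. \<forall>Y\<in>Ob C. \<forall>f\<in>Hom C X Y. Act P X Y f \<in> Val P Y \<rightarrow> Val P X) \<and>
     (\<forall>X\<in>Ob C. \<forall>x\<in>Val P X. Act P X X (Id C X) x = x) \<and>
     (\<forall>X\<in>Ob C. \<forall>Y\<in>Ob C. \<forall>Z\<in>Ob C. \<forall>f\<in>Hom C X Y. \<forall>g\<in>Hom C Y Z. \<forall>z\<in>Val P Z.
        Act P X Z (Comp C X Y Z g f) z = Act P X Y f (Act P Y Z g z))"

definition nat_trans ::
  "('o, 'u) category \<Rightarrow> ('o, 'u) presheaf \<Rightarrow> ('o, 'u) presheaf \<Rightarrow> ('o \<Rightarrow> 'u \<Rightarrow> 'u) set" where
  "nat_trans C P Q =
     {\<mu> \<in> (\<Pi>\<^sub>E X\<in>Ob C. Val P X \<rightarrow>\<^sub>E Val Q X).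
        \<forall>X\<in>Ob C. \<forall>Y\<in>Ob C. \<forall>f\<in>Hom C X Y. \<forall>y\<in>Val P Y.
          \<mu> X (Act P X Y f y) = Act Q X Y f (\<mu> Y y)}"

definition presheaves ::
  "('o, 'u) category \<Rightarrow> (('o, 'u) presheaf, 'o \<Rightarrow> 'u \<Rightarrow> 'u) category" where
  "presheaves C =
     \<lparr>Ob = {P. is_presheaf C P},
      Hom = nat_trans C,
      Id = (\<lambda>P. \<lambda>X\<in>Ob C. \<lambda>x\<in>Val P X. x),
      Comp = (\<lambda>P Q R \<nu> \<mu>. \<lambda>X\<in>Ob C. compose (Val P X) (\<nu> X) (\<mu> X))\<rparr>"

definition yoneda ::
  "('o, 'u) category \<Rightarrow> ('o, 'u, ('o, 'u) presheaf, 'o \<Rightarrow> 'u \<Rightarrow> 'u) functor_data" where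
  "yoneda C =
     \<lparr>OMap = (\<lambda>D. \<lparr>Val = (\<lambda>X. Hom C X D), Act = (\<lambda>X Y f g. Comp C X Y D g f)\<rparr>),
      AMap = (\<lambda>D E h. \<lambda>X\<in>Ob C. \<lambda>g\<in>Hom C X D. Comp C X D E h g)\<rparr>"

definition representable :: "('o, 'u) category \<Rightarrow> ('o, 'u) presheaf \<Rightarrow> bool" where
  "representable C P \<longleftrightarrow>
     is_presheaf C P \<and> (\<exists>D\<in>Ob C. \<exists>\<phi>. is_iso (presheaves C) (OMap (yoneda C) D) P \<phi>)"

definition small_presheaf :: "('o, 'u) category \<Rightarrow> ('o, 'u) presheaf \<Rightarrow> bool" where
  "small_presheaf C P \<longleftrightarrow>
     (\<exists>(J :: ('u, 'u) category) F \<iota>.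
        small_category J \<and> is_functor J (presheaves C) F \<and>
        (\<forall>j\<in>Ob J. representable C (OMap F j)) \<and>
        is_colimit (presheaves C) J F P \<iota>)"

definition small_presheaves ::
  "('o, 'u) category \<Rightarrow> (('o, 'u) presheaf, 'o \<Rightarrow> 'u \<Rightarrow> 'u) category" where
  "small_presheaves C = full_subcategory (presheaves C) {P. small_presheaf C P}"

definition small_presheaves_M ::
  "('o, 'u) category \<Rightarrow> ('o \<Rightarrow> 'o \<Rightarrow> 'u set) \<Rightarrow>
   ('o, 'u) presheaf \<Rightarrow> ('o, 'u) presheaf \<Rightarrow> ('o \<Rightarrow> 'u \<Rightarrow> 'u) set" where
  "small_presheaves_M C M P Q =
     {\<mu> \<in> Hom (small_presheaves C) P Q.
        \<forall>D\<in>Ob C. \<forall>\<gamma>\<in>Hom (small_presheaves C) (OMap (yoneda C) D) Q.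
          \<exists>B\<in>Ob C. \<exists>m\<in>M B D. \<exists>\<delta>.
            is_pullback (small_presheaves C) (OMap (yoneda C) D) P Q \<gamma> \<mu>
              (OMap (yoneda C) B) (AMap (yoneda C) B D m) \<delta>}"

end

theory Submission
  imports Defs
begin

text \<open>
  Colimits of presheaves are computed pointwise: the legs are jointly surjective, and two elements
  become equal in the colimit only if a zigzag in the diagram connects them
  (\<open>pointwise_colimit_exists\<close>, \<open>pointwise_colimit_is_colimit\<close>, \<open>colimit_is_pointwise\<close>). Everything
  below uses this in the following way: a quantity attached to the elements of a diagram that does
  not change along single maps of the diagram is a quantity attached to the elements of its colimit.

  Small colimits of small presheaves are small. Call \<open>P\<close> presented by a set \<open>K\<close> of objects if it
  is the canonical colimit of the representables at objects of \<open>K\<close>. A representable is presented by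
  every \<open>K\<close> containing its representing object, and for fixed \<open>K\<close> the presheaves presented by \<open>K\<close>
  are closed under colimits (\<open>colimit_presented_by\<close>). So a small presheaf is presented by every
  sufficiently large \<open>K\<close>; for a small diagram of small presheaves one small \<open>K\<close> serves all of them,
  hence also the colimit.

  The distinguished maps between small presheaves are the pointwise injective maps with an image
  \<open>S\<close> that is ``open'': for every element \<open>q\<close> of the codomain, the maps along which \<open>q\<close> restricts into
  \<open>S\<close> are those factoring through a single given monic (\<open>small_presheaves_M_iff\<close>). In this form
  closure under composition and under pullback are immediate, except that a pullback has to be
  small. But an open part of a colimit of representables is the colimit of its preimages in these
  representables, and an open part of a representable is representable
  (\<open>M_open_small_presheaf\<close>).

  Finally, an isomorphism class of spans is the same as its graph, a single-valued natural relation
  with open domain, and composition of classes is composition of relations (\<open>Par_Comp\<close>). For a cocone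
  of partial maps under a diagram, the values at an element do not change along the maps of the
  diagram, and neither does membership in the domain. So they are determined by the image of the
  element in the colimit, which gives the one partial map out of the colimit that is asked for
  (\<open>preserves_small_colimits_Par\<close>).
\<close>

section \<open>Small sets\<close>

context
  assumes univ: "universe TYPE('u)"
begin

lemma small_lepoll: "small TYPE('u) B \<Longrightarrow> A \<lesssim> B \<Longrightarrow> small TYPE('u) A"
  unfolding small_def by (rule lesspoll_trans1)

lemma small_image: "small TYPE('u) A \<Longrightarrow> small TYPE('u) (f ` A)"
  by (rule small_lepoll[OF _ image_lepoll])

lemma small_subset: "small TYPE('u) B \<Longrightarrow> A \<subseteq> B \<Longrightarrow> small TYPE('u) A"
  by (rule small_lepoll[OF _ subset_imp_lepoll])

lemma small_finite: "finite A \<Longrightarrow> small TYPE('u) A"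
  using univ unfolding universe_def small_def by (simp add: finite_lesspoll_infinite)

lemma small_inj: "small TYPE('u) (A :: 'a set) \<Longrightarrow> \<exists>e :: 'a \<Rightarrow> 'u. inj_on e A"
  unfolding small_def lesspoll_def lepoll_def by blast

text \<open>
  The universe is infinite, so its elements can code pairs of its elements. This is what lets a
  set of pairs be small, and what lets the elements of a coproduct of presheaves be elements of
  the universe again.
\<close>
lemma pairing: "\<exists>pr :: 'u \<times> 'u \<Rightarrow> 'u. inj pr"
proof -
  have "infinite (UNIV :: 'u set)"
    using univ by (simp add: universe_def)
  then obtain pr :: "'u \<times> 'u \<Rightarrow> 'u" where "bij_betw pr (UNIV \<times> UNIV) UNIV"
    using card_of_Times_same_infinite card_of_ordIso by metis
  then show ?thesis
    by (auto simp: bij_betw_def)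
qed

text \<open>
  The closure axiom of a universe speaks of unions of sets of its own elements only. An arbitrary
  small family is first coded inside the universe, with the index paired to each element so that
  the coded union is disjoint and has at least the size of the disjoint sum.
\<close>
lemma small_Sigma:
  assumes I: "small TYPE('u) I" and A: "\<And>i. i \<in> I \<Longrightarrow> small TYPE('u) (A i)"
  shows "small TYPE('u) (Sigma I A)"
proof -
  obtain e :: "_ \<Rightarrow> 'u" where e: "inj_on e I"
    using small_inj[OF I] by blast
  have "\<forall>i\<in>I. \<exists>h :: _ \<Rightarrow> 'u. inj_on h (A i)"
    using small_inj A by blast
  then obtain h :: "_ \<Rightarrow> _ \<Rightarrow> 'u" where h: "\<And>i. i \<in> I \<Longrightarrow> inj_on (h i) (A i)"
    by metis
  obtain pr :: "'u \<times> 'u \<Rightarrow> 'u" where pr: "inj pr"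
    using pairing by blast
  define e' where "e' = the_inv_into I e"
  have e': "e' (e i) = i" if "i \<in> I" for i
    using the_inv_into_f_f[OF e that] by (simp add: e'_def)
  define U where "U = (\<Union>t \<in> e ` I. (\<lambda>a. pr (t, h (e' t) a)) ` A (e' t))"
  have "small TYPE('u) U"
  proof -
    have "\<forall>t\<in>e ` I. small TYPE('u) ((\<lambda>a. pr (t, h (e' t) a)) ` A (e' t))"
      using A e' by (auto intro: small_image)
    moreover have "\<forall>(K :: 'u set) B. small TYPE('u) K \<longrightarrow> (\<forall>t\<in>K. small TYPE('u) (B t)) \<longrightarrow>
        small TYPE('u) (\<Union>t\<in>K. B t :: 'u set)"
      using univ unfolding universe_def by (elim conjE)
    ultimately show ?thesis
      using small_image[OF I, of e] unfolding U_def by (elim allE impE) assumption+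
  qed
  moreover have "Sigma I A \<lesssim> U"
    unfolding lepoll_def
  proof (intro exI conjI)
    show "inj_on (\<lambda>(i, a). pr (e i, h i a)) (Sigma I A)"
    proof (rule inj_onI, clarify)
      fix i a j b
      assume *: "i \<in> I" "a \<in> A i" "j \<in> I" "b \<in> A j" and "pr (e i, h i a) = pr (e j, h j b)"
      then have "e i = e j" "h i a = h j b"
        using injD[OF pr] by blast+
      with * show "i = j \<and> a = b"
        using inj_onD[OF e] inj_onD[OF h] by metis
    qed
    show "(\<lambda>(i, a). pr (e i, h i a)) ` Sigma I A \<subseteq> U"
    proof clarify
      fix i a assume "i \<in> I" "a \<in> A i"
      then have "pr (e i, h i a) \<in> (\<lambda>a. pr (e i, h (e' (e i)) a)) ` A (e' (e i))"
        by (simp add: e')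
      then show "pr (e i, h i a) \<in> U"
        unfolding U_def using \<open>i \<in> I\<close> by (rule UN_I[OF imageI, rotated])
    qed
  qed
  ultimately show ?thesis
    by (rule small_lepoll)
qed

lemma small_UN:
  assumes "small TYPE('u) I" and "\<And>i. i \<in> I \<Longrightarrow> small TYPE('u) (A i)"
  shows "small TYPE('u) (\<Union>i\<in>I. A i)"
proof -
  have "(\<Union>i\<in>I. A i) = snd ` Sigma I A"
    by force
  then show ?thesis
    using small_image[OF small_Sigma[of I A]] assms by simp
qed

end


section \<open>Presheaves and natural transformations\<close>

abbreviation yo :: "('o, 'u) category \<Rightarrow> 'o \<Rightarrow> ('o, 'u) presheaf" where
  "yo C D \<equiv> OMap (yoneda C) D"

lemma presheaves_simps [simp]:
  "Ob (presheaves C) = {P. is_presheaf C P}"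
  "Hom (presheaves C) = nat_trans C"
  "Hom (small_presheaves C) = nat_trans C"
  "Id (small_presheaves C) = Id (presheaves C)"
  "Comp (small_presheaves C) = Comp (presheaves C)"
  "Ob (small_presheaves C) = {P. is_presheaf C P \<and> small_presheaf C P}"
  by (auto simp: presheaves_def small_presheaves_def full_subcategory_def)

lemma full_subcategory_simps [simp]:
  "Ob (full_subcategory A S) = Ob A \<inter> S"
  "Hom (full_subcategory A S) = Hom A"
  "Id (full_subcategory A S) = Id A"
  "Comp (full_subcategory A S) = Comp A"
  by (simp_all add: full_subcategory_def)

lemma full_subcategory_UNIV: "full_subcategory A UNIV = A"
  by (simp add: full_subcategory_def)

lemma yo_simps [simp]:
  "Val (yo C D) X = Hom C X D"
  "Act (yo C D) X Y f g = Comp C X Y D g f"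
  by (simp_all add: yoneda_def)

lemma nat_transI:
  assumes "\<And>X x. X \<in> Ob C \<Longrightarrow> x \<in> Val P X \<Longrightarrow> h X x \<in> Val Q X"
    and "\<And>X Y f y. X \<in> Ob C \<Longrightarrow> Y \<in> Ob C \<Longrightarrow> f \<in> Hom C X Y \<Longrightarrow> y \<in> Val P Y \<Longrightarrow>
      Act P X Y f y \<in> Val P X \<and> h X (Act P X Y f y) = Act Q X Y f (h Y y)"
  shows "(\<lambda>X\<in>Ob C. \<lambda>x\<in>Val P X. h X x) \<in> nat_trans C P Q"
  using assms by (auto simp: nat_trans_def)

lemma nat_trans_val: "\<mu> \<in> nat_trans C P Q \<Longrightarrow> X \<in> Ob C \<Longrightarrow> x \<in> Val P X \<Longrightarrow> \<mu> X x \<in> Val Q X"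
  unfolding nat_trans_def by (drule CollectD, drule conjunct1, drule PiE_mem, assumption, rule PiE_mem)

lemma nat_trans_PiE: "\<mu> \<in> nat_trans C P Q \<Longrightarrow> X \<in> Ob C \<Longrightarrow> \<mu> X \<in> Val P X \<rightarrow>\<^sub>E Val Q X"
  unfolding nat_trans_def by (drule CollectD, drule conjunct1, erule PiE_mem)

lemma nat_trans_undefined: "\<mu> \<in> nat_trans C P Q \<Longrightarrow> X \<notin> Ob C \<Longrightarrow> \<mu> X = undefined"
  unfolding nat_trans_def by (drule CollectD, drule conjunct1, erule PiE_arb)

lemma nat_trans_natural:
  "\<mu> \<in> nat_trans C P Q \<Longrightarrow> X \<in> Ob C \<Longrightarrow> Y \<in> Ob C \<Longrightarrow> f \<in> Hom C X Y \<Longrightarrow> y \<in> Val P Y \<Longrightarrow>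
   \<mu> X (Act P X Y f y) = Act Q X Y f (\<mu> Y y)"
  by (simp add: nat_trans_def)

text \<open>
  Components are extensional functions, so agreement on elements is equality.
\<close>
lemma nat_trans_eqI:
  assumes "\<mu> \<in> nat_trans C P Q" and "\<nu> \<in> nat_trans C P Q"
    and "\<And>X x. X \<in> Ob C \<Longrightarrow> x \<in> Val P X \<Longrightarrow> \<mu> X x = \<nu> X x"
  shows "\<mu> = \<nu>"
proof
  fix X
  show "\<mu> X = \<nu> X"
  proof (cases "X \<in> Ob C")
    case True
    then have "\<mu> X \<in> Val P X \<rightarrow>\<^sub>E Val Q X" "\<nu> X \<in> Val P X \<rightarrow>\<^sub>E Val Q X"
      by (rule nat_trans_PiE[OF assms(1)], rule nat_trans_PiE[OF assms(2)])
    then show ?thesis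
      using assms(3)[OF True] by (rule PiE_ext)
  next
    case False
    then show ?thesis
      using nat_trans_undefined[OF assms(1)] nat_trans_undefined[OF assms(2)] by simp
  qed
qed

lemma Comp_apply [simp]:
  "X \<in> Ob C \<Longrightarrow> x \<in> Val P X \<Longrightarrow> Comp (presheaves C) P Q R \<nu> \<mu> X x = \<nu> X (\<mu> X x)"
  by (simp add: presheaves_def compose_def)

lemma Id_apply [simp]: "X \<in> Ob C \<Longrightarrow> x \<in> Val P X \<Longrightarrow> Id (presheaves C) P X x = x"
  by (simp add: presheaves_def)

lemma is_presheafD:
  assumes "is_presheaf C P"
  shows presheaf_act: "\<And>X Y f x. X \<in> Ob C \<Longrightarrow> Y \<in> Ob C \<Longrightarrow> f \<in> Hom C X Y \<Longrightarrow> x \<in> Val P Y \<Longrightarrow>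
      Act P X Y f x \<in> Val P X"
    and presheaf_id: "\<And>X x. X \<in> Ob C \<Longrightarrow> x \<in> Val P X \<Longrightarrow> Act P X X (Id C X) x = x"
    and presheaf_comp: "\<And>X Y Z f g z. X \<in> Ob C \<Longrightarrow> Y \<in> Ob C \<Longrightarrow> Z \<in> Ob C \<Longrightarrow>
      f \<in> Hom C X Y \<Longrightarrow> g \<in> Hom C Y Z \<Longrightarrow> z \<in> Val P Z \<Longrightarrow>
      Act P X Z (Comp C X Y Z g f) z = Act P X Y f (Act P Y Z g z)"
  using assms unfolding is_presheaf_def Pi_def by simp_all

lemma Comp_nat_trans:
  assumes "is_presheaf C P" "\<mu> \<in> nat_trans C P Q" "\<nu> \<in> nat_trans C Q R"
  shows "Comp (presheaves C) P Q R \<nu> \<mu> \<in> nat_trans C P R"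
proof -
  have "(\<lambda>X\<in>Ob C. \<lambda>x\<in>Val P X. \<nu> X (\<mu> X x)) \<in> nat_trans C P R"
    using assms by (intro nat_transI)
      (auto simp: nat_trans_val nat_trans_natural presheaf_act)
  then show ?thesis
    by (simp add: presheaves_def compose_def)
qed

lemma Id_nat_trans: "is_presheaf C P \<Longrightarrow> Id (presheaves C) P \<in> nat_trans C P P"
  unfolding presheaves_def by (simp, rule nat_transI) (auto simp: presheaf_act)

text \<open>
  Stated for full subcategories so that it, like the comparison of colimits below, serves both
  for all presheaves and for the small ones.
\<close>
lemma is_category_presheaves: "is_category (full_subcategory (presheaves C) S)"
  unfolding is_category_def full_subcategory_simps presheaves_simps
  by (intro conjI ballI)
    (auto simp: Id_nat_trans Comp_nat_trans nat_trans_val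
      intro!: nat_trans_eqI[OF Comp_nat_trans] nat_trans_eqI[OF Comp_nat_trans Comp_nat_trans])

lemma is_functorD:
  assumes "is_functor J (presheaves C) F"
  shows functor_presheaf: "\<And>j. j \<in> Ob J \<Longrightarrow> is_presheaf C (OMap F j)"
    and functor_nat_trans: "\<And>j k u. j \<in> Ob J \<Longrightarrow> k \<in> Ob J \<Longrightarrow> u \<in> Hom J j k \<Longrightarrow>
      AMap F j k u \<in> nat_trans C (OMap F j) (OMap F k)"
  using assms by (simp_all add: is_functor_def)


text \<open>
  The map out of a representable that corresponds to the element \<open>x\<close> under the Yoneda lemma.
\<close>
definition element_map :: "('o, 'u) category \<Rightarrow> ('o, 'u) presheaf \<Rightarrow> 'o \<Rightarrow> 'u \<Rightarrow> 'o \<Rightarrow> 'u \<Rightarrow> 'u" where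
  "element_map C P D x = (\<lambda>X\<in>Ob C. \<lambda>f\<in>Hom C X D. Act P X D f x)"

lemma element_map_apply [simp]:
  "X \<in> Ob C \<Longrightarrow> f \<in> Hom C X D \<Longrightarrow> element_map C P D x X f = Act P X D f x"
  by (simp add: element_map_def)

lemma yoneda_AMap_apply [simp]:
  "X \<in> Ob C \<Longrightarrow> f \<in> Hom C X D \<Longrightarrow> AMap (yoneda C) D E h X f = Comp C X D E h f"
  by (simp add: yoneda_def)

section \<open>Colimits of presheaves are computed pointwise\<close>

definition colim_step ::
  "('j, 'k) category \<Rightarrow> ('j, 'k, ('o, 'u) presheaf, 'o \<Rightarrow> 'u \<Rightarrow> 'u) functor_data \<Rightarrow> 'o \<Rightarrow>
   (('j \<times> 'u) \<times> ('j \<times> 'u)) set" where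
  "colim_step J F X =
     {((j, x), (k, AMap F j k u X x)) | j k u x.
        j \<in> Ob J \<and> k \<in> Ob J \<and> u \<in> Hom J j k \<and> x \<in> Val (OMap F j) X}"

text \<open>
  The zigzags along which elements become equal in the colimit of the sets \<open>F j X\<close>.
\<close>
definition colim_rel ::
  "('j, 'k) category \<Rightarrow> ('j, 'k, ('o, 'u) presheaf, 'o \<Rightarrow> 'u \<Rightarrow> 'u) functor_data \<Rightarrow> 'o \<Rightarrow>
   (('j \<times> 'u) \<times> ('j \<times> 'u)) set" where
  "colim_rel J F X = (colim_step J F X \<union> (colim_step J F X)\<inverse>)\<^sup>*"

lemma equiv_colim_rel: "equiv UNIV (colim_rel J F X)"
  unfolding colim_rel_def
  by (intro equivI refl_rtrancl trans_rtrancl sym_rtrancl sym_Un_converse) (auto)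

lemma colim_rel_Image_eq: "(p, q) \<in> colim_rel J F X \<longleftrightarrow> colim_rel J F X `` {p} = colim_rel J F X `` {q}"
  using eq_equiv_class_iff[OF equiv_colim_rel UNIV_I UNIV_I, of J F X p q] by (rule sym)

lemma colim_rel_refl [simp]: "(p, p) \<in> colim_rel J F X"
  by (simp add: colim_rel_def)

lemma colim_rel_sym: "(p, q) \<in> colim_rel J F X \<Longrightarrow> (q, p) \<in> colim_rel J F X"
  unfolding colim_rel_def by (rule symD[OF sym_rtrancl[OF sym_Un_converse]])

lemma colim_rel_trans:
  "(p, q) \<in> colim_rel J F X \<Longrightarrow> (q, r) \<in> colim_rel J F X \<Longrightarrow> (p, r) \<in> colim_rel J F X"
  by (auto simp: colim_rel_def)

lemma colim_rel_step:
  "j \<in> Ob J \<Longrightarrow> k \<in> Ob J \<Longrightarrow> u \<in> Hom J j k \<Longrightarrow> x \<in> Val (OMap F j) X \<Longrightarrow>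
   ((j, x), (k, AMap F j k u X x)) \<in> colim_rel J F X"
  unfolding colim_rel_def colim_step_def by (rule r_into_rtrancl) blast

text \<open>
  The only induction over zigzags: a function that does not change along a single step is
  constant along a zigzag. To see that related elements have related images, it is applied to
  functions whose values are equivalence classes.
\<close>
lemma colim_rel_invariant:
  assumes rel: "((j, x), (k, y)) \<in> colim_rel J F X"
    and step: "\<And>j k u x. j \<in> Ob J \<Longrightarrow> k \<in> Ob J \<Longrightarrow> u \<in> Hom J j k \<Longrightarrow> x \<in> Val (OMap F j) X \<Longrightarrow>
      \<Phi> j x = \<Phi> k (AMap F j k u X x)"
  shows "\<Phi> j x = \<Phi> k y"
  using rel unfolding colim_rel_def
proof (induction rule: rtrancl_induct2)
  case refl
  then show ?case ..
next
  case (step j' x' k' y')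
  then show ?case
    unfolding colim_step_def using assms(2) by auto
qed

text \<open>
  At every object the legs are jointly surjective and identify no more than the diagram forces
  them to. Together with the cocone condition this is what it means for the cocone to be a
  colimit of sets at every object.
\<close>
definition pointwise_colimit ::
  "('o, 'u) category \<Rightarrow> ('j, 'k) category \<Rightarrow>
   ('j, 'k, ('o, 'u) presheaf, 'o \<Rightarrow> 'u \<Rightarrow> 'u) functor_data \<Rightarrow>
   ('o, 'u) presheaf \<Rightarrow> ('j \<Rightarrow> 'o \<Rightarrow> 'u \<Rightarrow> 'u) \<Rightarrow> bool" where
  "pointwise_colimit C J F L \<iota> \<longleftrightarrow>
     is_cocone (presheaves C) J F L \<iota> \<and>
     (\<forall>X\<in>Ob C. \<forall>l\<in>Val L X. \<exists>j\<in>Ob J. \<exists>x\<in>Val (OMap F j) X. l = \<iota> j X x) \<and>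
     (\<forall>X\<in>Ob C. \<forall>j\<in>Ob J. \<forall>k\<in>Ob J. \<forall>x\<in>Val (OMap F j) X. \<forall>y\<in>Val (OMap F k) X.
        \<iota> j X x = \<iota> k X y \<longrightarrow> ((j, x), (k, y)) \<in> colim_rel J F X)"

lemma pointwise_colimitD:
  assumes "pointwise_colimit C J F L \<iota>"
  shows pointwise_colimit_cocone: "is_cocone (presheaves C) J F L \<iota>"
    and pointwise_colimit_presheaf: "is_presheaf C L"
    and pointwise_colimit_leg: "\<And>j. j \<in> Ob J \<Longrightarrow> \<iota> j \<in> nat_trans C (OMap F j) L"
    and pointwise_colimit_cover: "\<And>X l. X \<in> Ob C \<Longrightarrow> l \<in> Val L X \<Longrightarrow>
      \<exists>j\<in>Ob J. \<exists>x\<in>Val (OMap F j) X. l = \<iota> j X x"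
    and pointwise_colimit_exact: "\<And>X j k x y. X \<in> Ob C \<Longrightarrow> j \<in> Ob J \<Longrightarrow> k \<in> Ob J \<Longrightarrow>
      x \<in> Val (OMap F j) X \<Longrightarrow> y \<in> Val (OMap F k) X \<Longrightarrow> \<iota> j X x = \<iota> k X y \<Longrightarrow>
      ((j, x), (k, y)) \<in> colim_rel J F X"
  using assms by (auto simp: pointwise_colimit_def is_cocone_def)

lemma cocone_legs_step:
  assumes "is_cocone (full_subcategory (presheaves C) S) J F T \<tau>"
    and "X \<in> Ob C" "j \<in> Ob J" "k \<in> Ob J" "u \<in> Hom J j k" "x \<in> Val (OMap F j) X"
  shows "\<tau> j X x = \<tau> k X (AMap F j k u X x)"
proof -
  have "\<tau> j = Comp (presheaves C) (OMap F j) (OMap F k) T (\<tau> k) (AMap F j k u)"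
    using assms by (auto simp: is_cocone_def)
  then show ?thesis
    using assms by simp
qed

text \<open>
  A cocone \<open>\<tau>\<close> is constant along zigzags, hence \<open>\<iota> j X x \<mapsto> \<tau> j X x\<close> is well defined; by joint
  surjectivity there is no other choice.
\<close>
lemma pointwise_colimit_is_colimit:
  assumes F: "is_functor J (presheaves C) F" and L: "pointwise_colimit C J F L \<iota>" and "L \<in> S"
  shows "is_colimit (full_subcategory (presheaves C) S) J F L \<iota>"
  unfolding is_colimit_def
proof (intro conjI allI impI)
  show "is_cocone (full_subcategory (presheaves C) S) J F L \<iota>"
    using pointwise_colimit_cocone[OF L] \<open>L \<in> S\<close> by (auto simp: is_cocone_def)
next
  fix T \<tau>
  assume T: "is_cocone (full_subcategory (presheaves C) S) J F T \<tau>"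
  then have T': "is_presheaf C T" and \<tau>: "\<And>j. j \<in> Ob J \<Longrightarrow> \<tau> j \<in> nat_trans C (OMap F j) T"
    by (auto simp: is_cocone_def)
  note \<iota> = pointwise_colimit_leg[OF L]
  have well_defined: "\<tau> j X x = \<tau> k X y"
    if "X \<in> Ob C" "j \<in> Ob J" "k \<in> Ob J" "x \<in> Val (OMap F j) X" "y \<in> Val (OMap F k) X"
      "\<iota> j X x = \<iota> k X y" for X j k x y
    using pointwise_colimit_exact[OF L that] cocone_legs_step[OF T]
    by (rule colim_rel_invariant) (use that in auto)
  define h where "h X l = (SOME t. \<exists>j\<in>Ob J. \<exists>x\<in>Val (OMap F j) X. l = \<iota> j X x \<and> t = \<tau> j X x)" for X l
  have h: "h X (\<iota> j X x) = \<tau> j X x" if "X \<in> Ob C" "j \<in> Ob J" "x \<in> Val (OMap F j) X" for X j x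
    unfolding h_def
  proof (rule some_equality)
    fix t assume "\<exists>k\<in>Ob J. \<exists>y\<in>Val (OMap F k) X. \<iota> j X x = \<iota> k X y \<and> t = \<tau> k X y"
    then show "t = \<tau> j X x"
      using that well_defined by metis
  qed (use that in blast)
  have "(\<lambda>X\<in>Ob C. \<lambda>x\<in>Val L X. h X x) \<in> nat_trans C L T"
  proof (rule nat_transI)
    fix X l assume X: "X \<in> Ob C" "l \<in> Val L X"
    then show "h X l \<in> Val T X"
      using pointwise_colimit_cover[OF L X] h nat_trans_val[OF \<tau>] by auto
  next
    fix X Y f y assume *: "X \<in> Ob C" "Y \<in> Ob C" "f \<in> Hom C X Y" "y \<in> Val L Y"
    obtain j x where j: "j \<in> Ob J" "x \<in> Val (OMap F j) Y" "y = \<iota> j Y x"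
      using pointwise_colimit_cover[OF L *(2,4)] by blast
    have "Act (OMap F j) X Y f x \<in> Val (OMap F j) X"
      using * j presheaf_act[OF functor_presheaf[OF F]] by blast
    then have "h X (Act L X Y f y) = Act T X Y f (h Y y)"
      using * j nat_trans_natural[OF \<iota> *(1-3), of j x] nat_trans_natural[OF \<tau> *(1-3), of j x] h
      by (metis (no_types))
    then show "Act L X Y f y \<in> Val L X \<and> h X (Act L X Y f y) = Act T X Y f (h Y y)"
      using * presheaf_act[OF pointwise_colimit_presheaf[OF L]] by blast
  qed
  moreover have "Comp (presheaves C) (OMap F j) L T (\<lambda>X\<in>Ob C. \<lambda>x\<in>Val L X. h X x) (\<iota> j) = \<tau> j"
    if "j \<in> Ob J" for j
    using that calculation
    by (intro nat_trans_eqI[OF Comp_nat_trans \<tau>])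
      (auto simp: \<iota> functor_presheaf[OF F] nat_trans_val[OF \<iota>] h)
  moreover have "h1 = h2"
    if h12: "h1 \<in> nat_trans C L T" "h2 \<in> nat_trans C L T"
      and *: "\<And>j. j \<in> Ob J \<Longrightarrow> Comp (presheaves C) (OMap F j) L T h1 (\<iota> j) = \<tau> j"
        "\<And>j. j \<in> Ob J \<Longrightarrow> Comp (presheaves C) (OMap F j) L T h2 (\<iota> j) = \<tau> j" for h1 h2
  proof (rule nat_trans_eqI[OF h12])
    fix X l assume X: "X \<in> Ob C" "l \<in> Val L X"
    then obtain j x where j: "j \<in> Ob J" "x \<in> Val (OMap F j) X" "l = \<iota> j X x"
      using pointwise_colimit_cover[OF L X] by blast
    then show "h1 X l = h2 X l"
      using *[OF j(1)] X Comp_apply[of X C x "OMap F j" L T _ "\<iota> j"] by metis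
  qed
  ultimately show "\<exists>!h. h \<in> Hom (full_subcategory (presheaves C) S) L T \<and>
      (\<forall>j\<in>Ob J. Comp (full_subcategory (presheaves C) S) (OMap F j) L T h (\<iota> j) = \<tau> j)"
    by (intro ex_ex1I) auto
qed

text \<open>
  Some pointwise colimit \<open>L0\<close> in the subcategory suffices to make every colimit \<open>L\<close> there pointwise.
  Both are colimits, so there are comparison maps, and \<open>L \<rightarrow> L0 \<rightarrow> L\<close> is the identity by uniqueness.
  Covering is carried over along \<open>L0 \<rightarrow> L\<close>, and exactness is reflected along \<open>L \<rightarrow> L0\<close>.
\<close>
lemma colimit_is_pointwise:
  assumes F: "is_functor J (presheaves C) F"
    and L: "is_colimit (full_subcategory (presheaves C) S) J F L \<iota>"
    and L0: "pointwise_colimit C J F L0 \<iota>0" and "L0 \<in> S"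
  shows "pointwise_colimit C J F L \<iota>"
proof -
  let ?A = "full_subcategory (presheaves C) S"
  note L0c = pointwise_colimit_is_colimit[OF F L0 \<open>L0 \<in> S\<close>]
  have coc: "is_cocone ?A J F L \<iota>" "is_cocone ?A J F L0 \<iota>0"
    using L L0c by (auto simp: is_colimit_def)
  then have p: "is_presheaf C L" "is_presheaf C L0"
    and \<iota>: "\<And>j. j \<in> Ob J \<Longrightarrow> \<iota> j \<in> nat_trans C (OMap F j) L"
    and \<iota>0: "\<And>j. j \<in> Ob J \<Longrightarrow> \<iota>0 j \<in> nat_trans C (OMap F j) L0"
    by (auto simp: is_cocone_def)
  obtain h where h: "h \<in> nat_trans C L L0"
    and h\<iota>: "\<And>j. j \<in> Ob J \<Longrightarrow> Comp (presheaves C) (OMap F j) L L0 h (\<iota> j) = \<iota>0 j"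
    using L coc unfolding is_colimit_def full_subcategory_simps presheaves_simps by meson
  obtain k where k: "k \<in> nat_trans C L0 L"
    and k\<iota>: "\<And>j. j \<in> Ob J \<Longrightarrow> Comp (presheaves C) (OMap F j) L0 L k (\<iota>0 j) = \<iota> j"
    using L0c coc unfolding is_colimit_def full_subcategory_simps presheaves_simps by meson
  have hap: "h X (\<iota> j X x) = \<iota>0 j X x" and kap: "k X (\<iota>0 j X x) = \<iota> j X x"
    if "X \<in> Ob C" "j \<in> Ob J" "x \<in> Val (OMap F j) X" for X j x
    using h\<iota>[OF that(2)] k\<iota>[OF that(2)] that Comp_apply by metis+
  have "\<exists>!g. g \<in> nat_trans C L L \<and>
      (\<forall>j\<in>Ob J. Comp (presheaves C) (OMap F j) L L g (\<iota> j) = \<iota> j)"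
    using L coc(1) unfolding is_colimit_def full_subcategory_simps presheaves_simps by blast
  moreover have "Comp (presheaves C) (OMap F j) L L (Id (presheaves C) L) (\<iota> j) = \<iota> j"
    if "j \<in> Ob J" for j
    using that by (intro nat_trans_eqI[OF Comp_nat_trans \<iota>])
      (auto simp: \<iota> p Id_nat_trans functor_presheaf[OF F] nat_trans_val[OF \<iota>])
  moreover have "Comp (presheaves C) (OMap F j) L L (Comp (presheaves C) L L0 L k h) (\<iota> j) = \<iota> j"
    if "j \<in> Ob J" for j
    using that by (intro nat_trans_eqI[OF Comp_nat_trans \<iota>])
      (auto simp: \<iota> p Comp_nat_trans h k functor_presheaf[OF F] nat_trans_val[OF \<iota>] hap kap)
  ultimately have "Comp (presheaves C) L L0 L k h = Id (presheaves C) L"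
    using p h k by (metis Comp_nat_trans Id_nat_trans)
  then have kh: "k X (h X l) = l" if "X \<in> Ob C" "l \<in> Val L X" for X l
    using that Comp_apply Id_apply by metis
  show ?thesis
    unfolding pointwise_colimit_def
  proof (intro conjI ballI impI)
    show "is_cocone (presheaves C) J F L \<iota>"
      using coc(1) by (auto simp: is_cocone_def)
  next
    fix X l assume X: "X \<in> Ob C" "l \<in> Val L X"
    then show "\<exists>j\<in>Ob J. \<exists>x\<in>Val (OMap F j) X. l = \<iota> j X x"
      using pointwise_colimit_cover[OF L0 X(1) nat_trans_val[OF h X]] kh[OF X] kap by metis
  next
    fix X i j x y assume "X \<in> Ob C" "i \<in> Ob J" "j \<in> Ob J"
      "x \<in> Val (OMap F i) X" "y \<in> Val (OMap F j) X" "\<iota> i X x = \<iota> j X y"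
    then show "((i, x), (j, y)) \<in> colim_rel J F X"
      using pointwise_colimit_exact[OF L0, of X i j x y] hap by metis
  qed
qed


section \<open>The Yoneda lemma\<close>

locale locally_small_base =
  fixes C :: "('o, 'u) category"
  assumes univ: "universe TYPE('u)" and loc_small: "locally_small TYPE('u) C"
begin

lemma category_axioms:
  shows id_hom: "\<And>X. X \<in> Ob C \<Longrightarrow> Id C X \<in> Hom C X X"
    and comp_hom: "\<And>X Y Z f g. X \<in> Ob C \<Longrightarrow> Y \<in> Ob C \<Longrightarrow> Z \<in> Ob C \<Longrightarrow> f \<in> Hom C X Y \<Longrightarrow>
      g \<in> Hom C Y Z \<Longrightarrow> Comp C X Y Z g f \<in> Hom C X Z"
    and comp_id_right: "\<And>X Y f. X \<in> Ob C \<Longrightarrow> Y \<in> Ob C \<Longrightarrow> f \<in> Hom C X Y \<Longrightarrow>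
      Comp C X X Y f (Id C X) = f"
    and comp_id_left: "\<And>X Y f. X \<in> Ob C \<Longrightarrow> Y \<in> Ob C \<Longrightarrow> f \<in> Hom C X Y \<Longrightarrow>
      Comp C X Y Y (Id C Y) f = f"
    and comp_assoc: "\<And>W X Y Z f g h. W \<in> Ob C \<Longrightarrow> X \<in> Ob C \<Longrightarrow> Y \<in> Ob C \<Longrightarrow> Z \<in> Ob C \<Longrightarrow>
      f \<in> Hom C W X \<Longrightarrow> g \<in> Hom C X Y \<Longrightarrow> h \<in> Hom C Y Z \<Longrightarrow>
      Comp C W X Z (Comp C X Y Z h g) f = Comp C W Y Z h (Comp C W X Y g f)"
    and small_hom: "\<And>X Y. X \<in> Ob C \<Longrightarrow> Y \<in> Ob C \<Longrightarrow> small TYPE('u) (Hom C X Y)"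
  using loc_small unfolding locally_small_def is_category_def by simp_all

lemma yo_presheaf: "D \<in> Ob C \<Longrightarrow> is_presheaf C (yo C D)"
  by (simp add: is_presheaf_def small_hom comp_hom comp_id_right comp_assoc Pi_def)

lemma element_map_nat_trans:
  "is_presheaf C P \<Longrightarrow> D \<in> Ob C \<Longrightarrow> x \<in> Val P D \<Longrightarrow> element_map C P D x \<in> nat_trans C (yo C D) P"
  unfolding element_map_def
  using nat_transI[of C "yo C D" "\<lambda>X f. Act P X D f x" P]
  by (simp add: presheaf_act presheaf_comp comp_hom)

text \<open>
  Naturality along \<open>f : X \<rightarrow> D\<close>, applied to the identity of \<open>D\<close>.
\<close>
lemma yoneda_lemma:
  assumes "\<gamma> \<in> nat_trans C (yo C D) P" "is_presheaf C P" "D \<in> Ob C"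
  shows "\<gamma> = element_map C P D (\<gamma> D (Id C D))"
proof (rule nat_trans_eqI[OF assms(1) element_map_nat_trans])
  show "\<gamma> D (Id C D) \<in> Val P D"
    using nat_trans_val[OF assms(1)] assms(3) id_hom by simp
  fix X f assume "X \<in> Ob C" "f \<in> Val (yo C D) X"
  then show "\<gamma> X f = element_map C P D (\<gamma> D (Id C D)) X f"
    using nat_trans_natural[OF assms(1), of X D f "Id C D"] assms(3) by (simp add: id_hom comp_id_left)
qed (use assms in auto)

lemma yoneda_AMap_eq: "AMap (yoneda C) D E h = element_map C (yo C E) D h"
  by (simp add: yoneda_def element_map_def)

lemma yoneda_functor: "is_functor C (presheaves C) (yoneda C)"
  unfolding is_functor_def
proof (intro conjI ballI)
  fix X Y f assume *: "X \<in> Ob C" "Y \<in> Ob C" "f \<in> Hom C X Y"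
  then show "AMap (yoneda C) X Y f \<in> Hom (presheaves C) (yo C X) (yo C Y)"
    by (simp add: yoneda_AMap_eq yo_presheaf element_map_nat_trans)
next
  fix X assume X: "X \<in> Ob C"
  then show "AMap (yoneda C) X X (Id C X) = Id (presheaves C) (yo C X)"
    by (intro nat_trans_eqI[OF _ Id_nat_trans])
      (auto simp: yoneda_AMap_eq yo_presheaf element_map_nat_trans id_hom comp_id_left)
next
  fix X Y Z f g assume *: "X \<in> Ob C" "Y \<in> Ob C" "Z \<in> Ob C" "f \<in> Hom C X Y" "g \<in> Hom C Y Z"
  then show "AMap (yoneda C) X Z (Comp C X Y Z g f) =
      Comp (presheaves C) (yo C X) (yo C Y) (yo C Z) (AMap (yoneda C) Y Z g) (AMap (yoneda C) X Y f)"
    by (intro nat_trans_eqI[OF _ Comp_nat_trans])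
      (auto simp: yoneda_AMap_eq yo_presheaf element_map_nat_trans comp_hom comp_assoc)
qed (simp add: yo_presheaf)


section \<open>Pointwise injective and bijective transformations\<close>

text \<open>
  Pointwise there is a unique lift through \<open>m\<close>, and uniqueness makes the lifts natural.
\<close>
lemma factor_through_injective:
  assumes Z: "is_presheaf C Z" and W: "is_presheaf C W"
    and m: "m \<in> nat_trans C Z Q" and inj: "\<And>X. X \<in> Ob C \<Longrightarrow> inj_on (m X) (Val Z X)"
    and a: "a \<in> nat_trans C W Q"
    and im: "\<And>X w. X \<in> Ob C \<Longrightarrow> w \<in> Val W X \<Longrightarrow> a X w \<in> m X ` Val Z X"
  shows "\<exists>h\<in>nat_trans C W Z. \<forall>X\<in>Ob C. \<forall>w\<in>Val W X. m X (h X w) = a X w"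
proof -
  define h where "h X w = the_inv_into (Val Z X) (m X) (a X w)" for X w
  have h: "h X w \<in> Val Z X" "m X (h X w) = a X w" if "X \<in> Ob C" "w \<in> Val W X" for X w
    unfolding h_def using that inj im
    by (auto intro: the_inv_into_into f_the_inv_into_f)
  have "(\<lambda>X\<in>Ob C. \<lambda>w\<in>Val W X. h X w) \<in> nat_trans C W Z"
  proof (rule nat_transI)
    fix X Y f w assume *: "X \<in> Ob C" "Y \<in> Ob C" "f \<in> Hom C X Y" "w \<in> Val W Y"
    then have **: "Act W X Y f w \<in> Val W X" "Act Z X Y f (h Y w) \<in> Val Z X"
      using presheaf_act Z W h by metis+
    have "m X (h X (Act W X Y f w)) = m X (Act Z X Y f (h Y w))"
      using * ** h nat_trans_natural[OF a] nat_trans_natural[OF m] by simp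
    then have "h X (Act W X Y f w) = Act Z X Y f (h Y w)"
      using inj_onD[OF inj] * ** h by blast
    with ** show "Act W X Y f w \<in> Val W X \<and> h X (Act W X Y f w) = Act Z X Y f (h Y w)"
      by blast
  qed (use h in auto)
  then show ?thesis
    using h by (intro bexI) auto
qed

lemma is_iso_iff_bij:
  assumes P: "is_presheaf C P" and Q: "is_presheaf C Q"
  shows "is_iso (presheaves C) P Q \<phi> \<longleftrightarrow>
    \<phi> \<in> nat_trans C P Q \<and> (\<forall>X\<in>Ob C. bij_betw (\<phi> X) (Val P X) (Val Q X))"
proof (intro iffI conjI ballI; (elim conjE)?)
  assume iso: "is_iso (presheaves C) P Q \<phi>"
  then show \<phi>: "\<phi> \<in> nat_trans C P Q"
    by (simp add: is_iso_def)
  obtain \<psi> where \<psi>: "\<psi> \<in> nat_trans C Q P"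
    "Comp (presheaves C) P Q P \<psi> \<phi> = Id (presheaves C) P"
    "Comp (presheaves C) Q P Q \<phi> \<psi> = Id (presheaves C) Q"
    using iso by (auto simp: is_iso_def)
  fix X assume X: "X \<in> Ob C"
  have "\<psi> X (\<phi> X x) = x" if "x \<in> Val P X" for x
    using fun_cong[OF fun_cong[OF \<psi>(2)], of X x] X that by simp
  moreover have "\<phi> X (\<psi> X y) = y" if "y \<in> Val Q X" for y
    using fun_cong[OF fun_cong[OF \<psi>(3)], of X y] X that by simp
  ultimately show "bij_betw (\<phi> X) (Val P X) (Val Q X)"
    using X nat_trans_val[OF \<phi>] nat_trans_val[OF \<psi>(1)]
    by (intro bij_betw_byWitness[where f' = "\<psi> X"]) auto
next
  assume \<phi>: "\<phi> \<in> nat_trans C P Q" and bij: "\<forall>X\<in>Ob C. bij_betw (\<phi> X) (Val P X) (Val Q X)"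
  then obtain \<psi> where \<psi>: "\<psi> \<in> nat_trans C Q P"
    and eq: "\<And>X y. X \<in> Ob C \<Longrightarrow> y \<in> Val Q X \<Longrightarrow> \<phi> X (\<psi> X y) = y"
    using factor_through_injective[OF P Q \<phi> _ Id_nat_trans[OF Q]]
    by (fastforce simp: bij_betw_def)
  have eq': "\<psi> X (\<phi> X x) = x" if "X \<in> Ob C" "x \<in> Val P X" for X x
    using bij that eq nat_trans_val[OF \<phi>] nat_trans_val[OF \<psi>]
    by (metis bij_betw_imp_inj_on inj_onD)
  show "is_iso (presheaves C) P Q \<phi>"
    unfolding is_iso_def presheaves_simps
  proof (intro conjI bexI)
    show "Comp (presheaves C) P Q P \<psi> \<phi> = Id (presheaves C) P"
      by (rule nat_trans_eqI[OF Comp_nat_trans Id_nat_trans]) (use P \<phi> \<psi> eq' in auto)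
    show "Comp (presheaves C) Q P Q \<phi> \<psi> = Id (presheaves C) Q"
      by (rule nat_trans_eqI[OF Comp_nat_trans Id_nat_trans]) (use Q \<phi> \<psi> eq in auto)
  qed (use \<phi> \<psi> in auto)
qed

text \<open>
  By the Yoneda lemma an isomorphism \<open>yo C D \<cong> P\<close> is the same as a universal element \<open>e\<close> of \<open>P\<close>.
\<close>
lemma representable_iff:
  assumes P: "is_presheaf C P"
  shows "representable C P \<longleftrightarrow>
    (\<exists>D\<in>Ob C. \<exists>e\<in>Val P D. \<forall>X\<in>Ob C. bij_betw (\<lambda>f. Act P X D f e) (Hom C X D) (Val P X))"
proof -
  have "(\<exists>\<phi>. is_iso (presheaves C) (yo C D) P \<phi>) \<longleftrightarrow>
      (\<exists>e\<in>Val P D. \<forall>X\<in>Ob C. bij_betw (\<lambda>f. Act P X D f e) (Hom C X D) (Val P X))"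
    if D: "D \<in> Ob C" for D
  proof -
    have *: "bij_betw (element_map C P D e X) (Hom C X D) (Val P X) \<longleftrightarrow>
        bij_betw (\<lambda>f. Act P X D f e) (Hom C X D) (Val P X)" if "X \<in> Ob C" for X e
      using that by (intro bij_betw_cong) simp
    have iso: "is_iso (presheaves C) (yo C D) P \<phi> \<longleftrightarrow> \<phi> \<in> nat_trans C (yo C D) P \<and>
        (\<forall>X\<in>Ob C. bij_betw (\<phi> X) (Hom C X D) (Val P X))" for \<phi>
      by (simp add: is_iso_iff_bij[OF yo_presheaf[OF D] P])
    show ?thesis
    proof
      assume "\<exists>\<phi>. is_iso (presheaves C) (yo C D) P \<phi>"
      then obtain \<phi> where \<phi>: "\<phi> \<in> nat_trans C (yo C D) P"
        "\<forall>X\<in>Ob C. bij_betw (\<phi> X) (Hom C X D) (Val P X)"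
        using iso by blast
      have "\<phi> D (Id C D) \<in> Val P D"
        using nat_trans_val[OF \<phi>(1) D] id_hom[OF D] by simp
      then show "\<exists>e\<in>Val P D. \<forall>X\<in>Ob C. bij_betw (\<lambda>f. Act P X D f e) (Hom C X D) (Val P X)"
        using \<phi>(2) yoneda_lemma[OF \<phi>(1) P D] * by metis
    next
      assume "\<exists>e\<in>Val P D. \<forall>X\<in>Ob C. bij_betw (\<lambda>f. Act P X D f e) (Hom C X D) (Val P X)"
      then show "\<exists>\<phi>. is_iso (presheaves C) (yo C D) P \<phi>"
        using iso element_map_nat_trans[OF P D] * by metis
    qed
  qed
  then show ?thesis
    using P by (auto simp: representable_def)
qed

lemma representable_yo: "D \<in> Ob C \<Longrightarrow> representable C (yo C D)"
  unfolding representable_iff[OF yo_presheaf]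
  by (intro bexI[of _ D] bexI[of _ "Id C D"] ballI)
    (auto simp: id_hom comp_id_left bij_betw_def inj_on_def image_def)


section \<open>Existence of colimits of presheaves\<close>

text \<open>
  The value at \<open>X\<close> is the quotient of the disjoint sum of the sets \<open>F j X\<close> by the zigzag relation.
  It has to consist of elements of the universe, so a class is represented by the code of a chosen
  member of it.
\<close>
lemma pointwise_colimit_exists:
  fixes J :: "('u, 'k) category"
  assumes J: "small TYPE('u) (Ob J)" and F: "is_functor J (presheaves C) F"
  shows "\<exists>L \<iota>. pointwise_colimit C J F L \<iota>"
proof -
  obtain pr :: "'u \<times> 'u \<Rightarrow> 'u" where pr: "inj pr"
    using pairing[OF univ] by blast
  define \<rho> where "\<rho> X j x = pr (SOME q. ((j, x), q) \<in> colim_rel J F X)" for X j x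
  have \<rho>_eq: "\<rho> X j x = \<rho> X k y" if "((j, x), (k, y)) \<in> colim_rel J F X" for X j k x y
    unfolding \<rho>_def using that colim_rel_sym colim_rel_trans by (metis (mono_tags, lifting))
  have \<rho>_rel: "((j, x), (k, y)) \<in> colim_rel J F X" if "\<rho> X j x = \<rho> X k y" for X j k x y
  proof -
    have "((j, x), (SOME q. ((j, x), q) \<in> colim_rel J F X)) \<in> colim_rel J F X"
      "((k, y), (SOME q. ((k, y), q) \<in> colim_rel J F X)) \<in> colim_rel J F X"
      by (rule someI, rule colim_rel_refl)+
    then show ?thesis
      using that injD[OF pr] colim_rel_sym colim_rel_trans unfolding \<rho>_def by metis
  qed
  note Fp = functor_presheaf[OF F] and Fn = functor_nat_trans[OF F]
  \<comment> \<open>The action on a class is defined through any member; the next fact shows independence of it.\<close>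
  define act where "act X Y f l =
    (SOME l'. \<exists>j\<in>Ob J. \<exists>x\<in>Val (OMap F j) Y. l = \<rho> Y j x \<and> l' = \<rho> X j (Act (OMap F j) X Y f x))"
    for X Y f l
  have act: "act X Y f (\<rho> Y j x) = \<rho> X j (Act (OMap F j) X Y f x)"
    if "X \<in> Ob C" "Y \<in> Ob C" "f \<in> Hom C X Y" "j \<in> Ob J" "x \<in> Val (OMap F j) Y" for X Y f j x
    unfolding act_def
  proof (rule some_equality)
    fix l' assume "\<exists>k\<in>Ob J. \<exists>y\<in>Val (OMap F k) Y. \<rho> Y j x = \<rho> Y k y \<and>
      l' = \<rho> X k (Act (OMap F k) X Y f y)"
    then obtain k y where k: "k \<in> Ob J" "y \<in> Val (OMap F k) Y" "\<rho> Y j x = \<rho> Y k y"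
      and l': "l' = \<rho> X k (Act (OMap F k) X Y f y)"
      by blast
    have "\<rho> X j (Act (OMap F j) X Y f x) = \<rho> X k (Act (OMap F k) X Y f y)"
    proof (rule colim_rel_invariant[OF \<rho>_rel[OF k(3)]])
      fix j k u x assume *: "j \<in> Ob J" "k \<in> Ob J" "u \<in> Hom J j k" "x \<in> Val (OMap F j) Y"
      show "\<rho> X j (Act (OMap F j) X Y f x) = \<rho> X k (Act (OMap F k) X Y f (AMap F j k u Y x))"
        using \<rho>_eq[OF colim_rel_step[OF *(1-3)]] presheaf_act[OF Fp[OF *(1)] that(1-3) *(4)]
          nat_trans_natural[OF Fn[OF *(1-3)] that(1-3) *(4)] by metis
    qed
    with l' show "l' = \<rho> X j (Act (OMap F j) X Y f x)"
      by simp
  qed (use that in blast)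
  define L where "L = \<lparr>Val = (\<lambda>X. (\<lambda>(j, x). \<rho> X j x) ` (SIGMA j:Ob J. Val (OMap F j) X)), Act = act\<rparr>"
  have Val_L: "\<And>X. Val L X = (\<lambda>(j, x). \<rho> X j x) ` (SIGMA j:Ob J. Val (OMap F j) X)"
    and Act_L: "Act L = act"
    by (simp_all add: L_def)
  define \<iota> where "\<iota> j = (\<lambda>X\<in>Ob C. \<lambda>x\<in>Val (OMap F j) X. \<rho> X j x)" for j
  have \<iota>: "\<iota> j X x = \<rho> X j x" if "X \<in> Ob C" "x \<in> Val (OMap F j) X" for X j x
    using that by (simp add: \<iota>_def)
  have L: "is_presheaf C L"
    unfolding is_presheaf_def Val_L Act_L
  proof (intro conjI ballI)
    fix X assume "X \<in> Ob C"
    then show "small TYPE('u) ((\<lambda>(j, x). \<rho> X j x) ` (SIGMA j:Ob J. Val (OMap F j) X))"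
      using Fp by (intro small_image[OF univ] small_Sigma[OF univ J]) (simp add: is_presheaf_def)
  next
    fix X Y f assume "X \<in> Ob C" "Y \<in> Ob C" "f \<in> Hom C X Y"
    then show "act X Y f \<in> (\<lambda>(j, x). \<rho> Y j x) ` (SIGMA j:Ob J. Val (OMap F j) Y) \<rightarrow>
        (\<lambda>(j, x). \<rho> X j x) ` (SIGMA j:Ob J. Val (OMap F j) X)"
      by (auto simp: act presheaf_act[OF Fp] intro!: rev_image_eqI[of "(_, Act (OMap F _) X Y f _)"])
  next
    fix X l assume "X \<in> Ob C" "l \<in> (\<lambda>(j, x). \<rho> X j x) ` (SIGMA j:Ob J. Val (OMap F j) X)"
    then show "act X X (Id C X) l = l"
      by (auto simp: act id_hom presheaf_id[OF Fp])
  next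
    fix X Y Z f g l assume "X \<in> Ob C" "Y \<in> Ob C" "Z \<in> Ob C" "f \<in> Hom C X Y" "g \<in> Hom C Y Z"
      "l \<in> (\<lambda>(j, x). \<rho> Z j x) ` (SIGMA j:Ob J. Val (OMap F j) Z)"
    then show "act X Z (Comp C X Y Z g f) l = act X Y f (act Y Z g l)"
      by (auto simp: act comp_hom presheaf_act[OF Fp] presheaf_comp[OF Fp])
  qed
  have \<iota>_nat: "\<iota> j \<in> nat_trans C (OMap F j) L" if "j \<in> Ob J" for j
    unfolding \<iota>_def using that
    by (intro nat_transI) (auto simp: Val_L Act_L act presheaf_act[OF Fp])
  have "is_cocone (presheaves C) J F L \<iota>"
    unfolding is_cocone_def presheaves_simps
  proof (intro conjI ballI)
    fix j k u assume *: "j \<in> Ob J" "k \<in> Ob J" "u \<in> Hom J j k"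
    show "Comp (presheaves C) (OMap F j) (OMap F k) L (\<iota> k) (AMap F j k u) = \<iota> j"
    proof (rule nat_trans_eqI[OF Comp_nat_trans \<iota>_nat])
      fix X x assume X: "X \<in> Ob C" "x \<in> Val (OMap F j) X"
      then show "Comp (presheaves C) (OMap F j) (OMap F k) L (\<iota> k) (AMap F j k u) X x = \<iota> j X x"
        using \<rho>_eq[OF colim_rel_step[OF *]] nat_trans_val[OF Fn[OF *]] by (simp add: \<iota>)
    qed (use * Fp Fn \<iota>_nat in auto)
  qed (use L \<iota>_nat in auto)
  then have "pointwise_colimit C J F L \<iota>"
    unfolding pointwise_colimit_def using \<rho>_rel by (auto simp: Val_L \<iota>)
  then show ?thesis
    by blast
qed

end

section \<open>Presentations by sets of objects\<close>

text \<open>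
  The part of the category of elements of \<open>P\<close> that lies over the objects in \<open>K\<close>.
\<close>
definition elements :: "('o, 'u) category \<Rightarrow> 'o set \<Rightarrow> ('o, 'u) presheaf \<Rightarrow> ('o \<times> 'u, 'u) category" where
  "elements C K P =
     \<lparr>Ob = (SIGMA D:K. Val P D),
      Hom = (\<lambda>(D, y) (E, z). {v \<in> Hom C D E. Act P D E v z = y}),
      Id = (\<lambda>(D, y). Id C D),
      Comp = (\<lambda>(D, y) (D', y') (D'', y'') g f. Comp C D D' D'' g f)\<rparr>"

definition elements_diagram ::
  "('o, 'u) category \<Rightarrow> ('o \<times> 'u, 'u, ('o, 'u) presheaf, 'o \<Rightarrow> 'u \<Rightarrow> 'u) functor_data" where
  "elements_diagram C =
     \<lparr>OMap = (\<lambda>(D, y). yo C D), AMap = (\<lambda>(D, y) (E, z) v. AMap (yoneda C) D E v)\<rparr>"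

text \<open>
  \<open>P\<close> is the left Kan extension of its restriction to \<open>K\<close>: it is the canonical colimit of the
  representables at objects of \<open>K\<close>. In contrast to an arbitrary diagram of representables, the
  canonical one is determined by \<open>P\<close> and \<open>K\<close>, so that presheaves presented by the same \<open>K\<close> can be
  compared without choosing lifts of the maps between them.
\<close>
definition presented_by :: "('o, 'u) category \<Rightarrow> 'o set \<Rightarrow> ('o, 'u) presheaf \<Rightarrow> bool" where
  "presented_by C K P \<longleftrightarrow>
     pointwise_colimit C (elements C K P) (elements_diagram C) P (\<lambda>(D, y). element_map C P D y)"

abbreviation elements_rel where
  "elements_rel C K P \<equiv> colim_rel (elements C K P) (elements_diagram C)"

lemma elements_simps [simp]:
  "Ob (elements C K P) = (SIGMA D:K. Val P D)"
  "Hom (elements C K P) (D, y) (E, z) = {v \<in> Hom C D E. Act P D E v z = y}"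
  "Id (elements C K P) (D, y) = Id C D"
  "Comp (elements C K P) (D, y) (D', y') (D'', y'') g f = Comp C D D' D'' g f"
  "OMap (elements_diagram C) (D, y) = yo C D"
  "AMap (elements_diagram C) (D, y) (E, z) v = AMap (yoneda C) D E v"
  by (simp_all add: elements_def elements_diagram_def)

context locally_small_base
begin

lemma elements_functor:
  "K \<subseteq> Ob C \<Longrightarrow> is_functor (elements C K P) (presheaves C) (elements_diagram C)"
  using yoneda_functor unfolding is_functor_def by (auto simp: subset_iff)

lemma elements_category:
  "K \<subseteq> Ob C \<Longrightarrow> is_presheaf C P \<Longrightarrow> is_category (elements C K P)"
  unfolding is_category_def
  by (auto simp: id_hom comp_hom comp_id_left comp_id_right presheaf_id presheaf_comp subset_iff
      intro!: comp_assoc[symmetric])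

text \<open>
  The elementary identification \<open>(y \<cdot> v, f) \<sim> (y, v \<circ> f)\<close>.
\<close>
lemma elements_step:
  assumes "K \<subseteq> Ob C" "is_presheaf C P" "X \<in> Ob C" "D \<in> K" "E \<in> K"
    and "v \<in> Hom C D E" "z \<in> Val P E" "f \<in> Hom C X D"
  shows "(((D, Act P D E v z), f), ((E, z), Comp C X D E v f)) \<in> elements_rel C K P X"
proof -
  have "Act P D E v z \<in> Val P D"
    using assms by (meson presheaf_act subsetD)
  then show ?thesis
    using colim_rel_step[of "(D, Act P D E v z)" "elements C K P" "(E, z)" v f "elements_diagram C" X]
      assms by simp
qed

lemma presented_byI:
  assumes K: "K \<subseteq> Ob C" and P: "is_presheaf C P"
    and cover: "\<And>X x. X \<in> Ob C \<Longrightarrow> x \<in> Val P X \<Longrightarrow>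
      \<exists>D\<in>K. \<exists>y\<in>Val P D. \<exists>f\<in>Hom C X D. x = Act P X D f y"
    and exact: "\<And>X D E y z f g. X \<in> Ob C \<Longrightarrow> D \<in> K \<Longrightarrow> E \<in> K \<Longrightarrow> y \<in> Val P D \<Longrightarrow> z \<in> Val P E \<Longrightarrow>
      f \<in> Hom C X D \<Longrightarrow> g \<in> Hom C X E \<Longrightarrow> Act P X D f y = Act P X E g z \<Longrightarrow>
      (((D, y), f), ((E, z), g)) \<in> elements_rel C K P X"
  shows "presented_by C K P"
  unfolding presented_by_def pointwise_colimit_def
proof (intro conjI)
  have "Comp (presheaves C) (yo C D) (yo C E) P (element_map C P E z) (AMap (yoneda C) D E v) =
      element_map C P D (Act P D E v z)"
    if "D \<in> Ob C" "E \<in> Ob C" "z \<in> Val P E" "v \<in> Hom C D E" for D E v z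
    using that presheaf_act[OF P that(1,2,4,3)]
    by (intro nat_trans_eqI[OF Comp_nat_trans element_map_nat_trans])
      (auto simp: P yo_presheaf yoneda_AMap_eq element_map_nat_trans comp_hom presheaf_comp)
  moreover have "Act P D E v z \<in> Val P D" if "D \<in> Ob C" "E \<in> Ob C" "z \<in> Val P E" "v \<in> Hom C D E"
    for D E v z
    using presheaf_act[OF P that(1,2,4,3)] .
  ultimately show "is_cocone (presheaves C) (elements C K P) (elements_diagram C) P (\<lambda>(D, y). element_map C P D y)"
    using K unfolding is_cocone_def by (auto simp: P element_map_nat_trans subset_iff)
qed (use assms in \<open>auto, (fastforce+)?\<close>)

lemma presented_byD:
  assumes "presented_by C K P"
  shows presented_by_presheaf: "is_presheaf C P"
    and presented_by_cover: "\<And>X x. X \<in> Ob C \<Longrightarrow> x \<in> Val P X \<Longrightarrow>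
      \<exists>D\<in>K. \<exists>y\<in>Val P D. \<exists>f\<in>Hom C X D. x = Act P X D f y"
    and presented_by_exact: "\<And>X D E y z f g. X \<in> Ob C \<Longrightarrow> D \<in> K \<Longrightarrow> E \<in> K \<Longrightarrow> y \<in> Val P D \<Longrightarrow>
      z \<in> Val P E \<Longrightarrow> f \<in> Hom C X D \<Longrightarrow> g \<in> Hom C X E \<Longrightarrow> Act P X D f y = Act P X E g z \<Longrightarrow>
      (((D, y), f), ((E, z), g)) \<in> elements_rel C K P X"
proof -
  note P = assms[unfolded presented_by_def]
  show "is_presheaf C P"
    by (rule pointwise_colimit_presheaf[OF P])
  show "\<exists>D\<in>K. \<exists>y\<in>Val P D. \<exists>f\<in>Hom C X D. x = Act P X D f y" if "X \<in> Ob C" "x \<in> Val P X" for X x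
    using pointwise_colimit_cover[OF P that] that(1) by fastforce
  show "(((D, y), f), ((E, z), g)) \<in> elements_rel C K P X"
    if "X \<in> Ob C" "D \<in> K" "E \<in> K" "y \<in> Val P D" "z \<in> Val P E" "f \<in> Hom C X D" "g \<in> Hom C X E"
      "Act P X D f y = Act P X E g z" for X D E y z f g
    using pointwise_colimit_exact[OF P that(1), of "(D, y)" "(E, z)" f g] that by simp
qed

text \<open>
  Every pair \<open>(y, f)\<close> is linked in one step to a pair whose first component is the universal element
  \<open>e\<close>, and its second component is then determined by the element \<open>y \<cdot> f\<close>. As \<open>K\<close>
  may be enlarged at will, one \<open>K\<close> can serve many representables.
\<close>
lemma representable_presented_by:
  assumes K: "K \<subseteq> Ob C" and P: "is_presheaf C P" and D: "D \<in> K" "e \<in> Val P D"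
    and bij: "\<And>X. X \<in> Ob C \<Longrightarrow> bij_betw (\<lambda>f. Act P X D f e) (Hom C X D) (Val P X)"
  shows "presented_by C K P"
proof (rule presented_byI[OF K P])
  have D': "D \<in> Ob C"
    using D K by blast
  show "\<exists>D\<in>K. \<exists>y\<in>Val P D. \<exists>f\<in>Hom C X D. x = Act P X D f y" if "X \<in> Ob C" "x \<in> Val P X" for X x
    using bij_betw_imp_surj_on[OF bij[OF that(1)]] that(2) D by blast
  fix X E E' y y' f f'
  assume *: "X \<in> Ob C" "E \<in> K" "E' \<in> K" "y \<in> Val P E" "y' \<in> Val P E'"
    "f \<in> Hom C X E" "f' \<in> Hom C X E'" and eq: "Act P X E f y = Act P X E' f' y'"
  have E: "E \<in> Ob C" "E' \<in> Ob C"
    using * K by auto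
  obtain g where g: "g \<in> Hom C E D" "y = Act P E D g e"
    using bij_betw_imp_surj_on[OF bij[OF E(1)]] *(4) by blast
  obtain g' where g': "g' \<in> Hom C E' D" "y' = Act P E' D g' e"
    using bij_betw_imp_surj_on[OF bij[OF E(2)]] *(5) by blast
  have "Act P X D (Comp C X E D g f) e = Act P X D (Comp C X E' D g' f') e"
    using eq g g' * E D D' P by (simp add: presheaf_comp)
  then have "Comp C X E D g f = Comp C X E' D g' f'"
    using bij_betw_imp_inj_on[OF bij[OF *(1)]] * E D' g g' by (simp add: inj_on_def comp_hom)
  moreover have "(((E, y), f), ((D, e), Comp C X E D g f)) \<in> elements_rel C K P X"
    unfolding g(2) by (rule elements_step) (use K P * D g in auto)
  moreover have "(((E', y'), f'), ((D, e), Comp C X E' D g' f')) \<in> elements_rel C K P X"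
    unfolding g'(2) by (rule elements_step) (use K P * D g' in auto)
  ultimately show "(((E, y), f), ((E', y'), f')) \<in> elements_rel C K P X"
    using colim_rel_sym colim_rel_trans by metis
qed

text \<open>
  Let an element of \<open>F j X\<close> be written as \<open>y \<cdot> f\<close> with \<open>y\<close> over \<open>K\<close>. The class of \<open>(\<iota> j y, f)\<close> in the
  presentation of \<open>L\<close> does not depend on the way of writing it, because \<open>K\<close> presents \<open>F j\<close>; and it
  does not change along a map \<open>u : j \<rightarrow> k\<close> of the diagram, because \<open>u\<close> takes \<open>y \<cdot> f\<close> to \<open>u y \<cdot> f\<close> and
  \<open>\<iota> k (u y) = \<iota> j y\<close>. So elements that become equal in \<open>L\<close> have the same class.
\<close>
lemma colimit_presented_by:
  assumes K: "K \<subseteq> Ob C" and F: "is_functor J (presheaves C) F"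
    and L: "pointwise_colimit C J F L \<iota>"
    and FK: "\<And>j. j \<in> Ob J \<Longrightarrow> presented_by C K (OMap F j)"
  shows "presented_by C K L"
proof (rule presented_byI[OF K])
  note Fp = functor_presheaf[OF F] and Fn = functor_nat_trans[OF F]
    and \<iota> = pointwise_colimit_leg[OF L]
  show Lp: "is_presheaf C L"
    by (rule pointwise_colimit_presheaf[OF L])
  have \<iota>_act: "\<iota> j X (Act (OMap F j) X D f y) = Act L X D f (\<iota> j D y)"
    if "X \<in> Ob C" "D \<in> K" "j \<in> Ob J" "y \<in> Val (OMap F j) D" "f \<in> Hom C X D" for X D j y f
    using nat_trans_natural[OF \<iota>[OF that(3)] that(1)] that K by blast
  have \<iota>_step: "\<iota> j D y = \<iota> k D (AMap F j k u D y)"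
    if "D \<in> K" "j \<in> Ob J" "k \<in> Ob J" "u \<in> Hom J j k" "y \<in> Val (OMap F j) D" for D j k u y
    using cocone_legs_step[of C UNIV J F L \<iota>] pointwise_colimit_cocone[OF L] that K
    by (auto simp: full_subcategory_UNIV)
  show "\<exists>D\<in>K. \<exists>y\<in>Val L D. \<exists>f\<in>Hom C X D. l = Act L X D f y"
    if X: "X \<in> Ob C" "l \<in> Val L X" for X l
  proof -
    obtain j x where j: "j \<in> Ob J" "x \<in> Val (OMap F j) X" "l = \<iota> j X x"
      using pointwise_colimit_cover[OF L X] by blast
    obtain D y f where "D \<in> K" "y \<in> Val (OMap F j) D" "f \<in> Hom C X D" "x = Act (OMap F j) X D f y"
      using presented_by_cover[OF FK[OF j(1)] X(1) j(2)] by blast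
    then show ?thesis
      using \<iota>_act[OF X(1)] j nat_trans_val[OF \<iota>[OF j(1)]] K by blast
  qed
  fix X D E y z f g
  assume X: "X \<in> Ob C" and *: "D \<in> K" "E \<in> K" "y \<in> Val L D" "z \<in> Val L E"
    "f \<in> Hom C X D" "g \<in> Hom C X E" and eq: "Act L X D f y = Act L X E g z"
  let ?R = "elements_rel C K L X"
  \<comment> \<open>The leg \<open>\<iota> j\<close> takes zigzags presenting \<open>F j\<close> to zigzags presenting \<open>L\<close>.\<close>
  have push: "?R `` {((D, \<iota> j D y), f)} = ?R `` {((E, \<iota> j E z), g)}"
    if j: "j \<in> Ob J" and rel: "(((D, y), f), ((E, z), g)) \<in> elements_rel C K (OMap F j) X"
    for j D E y z f g
  proof -
    have "(\<lambda>(D, y) f. ?R `` {((D, \<iota> j D y), f)}) (D, y) f =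
        (\<lambda>(D, y) f. ?R `` {((D, \<iota> j D y), f)}) (E, z) g"
      using rel
    proof (rule colim_rel_invariant)
      fix p q v f
      assume "p \<in> Ob (elements C K (OMap F j))" "q \<in> Ob (elements C K (OMap F j))"
        and v: "v \<in> Hom (elements C K (OMap F j)) p q" "f \<in> Val (OMap (elements_diagram C) p) X"
      then obtain D E y z where pq: "p = (D, y)" "q = (E, z)" "D \<in> K" "E \<in> K"
        "y \<in> Val (OMap F j) D" "z \<in> Val (OMap F j) E"
        by auto
      with v have v': "v \<in> Hom C D E" "y = Act (OMap F j) D E v z" "f \<in> Hom C X D"
        by auto
      have "\<iota> j D y = Act L D E v (\<iota> j E z)"
        using v' \<iota>_act[of D E j z v] pq j K by auto
      then have "(((D, \<iota> j D y), f), ((E, \<iota> j E z), Comp C X D E v f)) \<in> ?R"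
        using elements_step[OF K Lp X pq(3,4) v'(1) _ v'(3)] nat_trans_val[OF \<iota>[OF j]] pq K
        by (metis subsetD)
      then show "(\<lambda>(D, y) f. ?R `` {((D, \<iota> j D y), f)}) p f =
          (\<lambda>(D, y) f. ?R `` {((D, \<iota> j D y), f)}) q (AMap (elements_diagram C) p q v X f)"
        using pq v' X by (simp add: colim_rel_Image_eq)
    qed
    then show ?thesis
      by simp
  qed
  \<comment> \<open>The class in the presentation of \<open>L\<close> attached to \<open>x\<close>, as the union over all ways of writing \<open>x\<close>.\<close>
  define \<Phi> where "\<Phi> j x = (\<Union>{?R `` {((D, \<iota> j D y), f)} | D y f. D \<in> K \<and> y \<in> Val (OMap F j) D \<and>
      f \<in> Hom C X D \<and> x = Act (OMap F j) X D f y})" for j x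
  have \<Phi>: "\<Phi> j (Act (OMap F j) X D f y) = ?R `` {((D, \<iota> j D y), f)}"
    if *: "j \<in> Ob J" "D \<in> K" "y \<in> Val (OMap F j) D" "f \<in> Hom C X D" for j D y f
  proof -
    have "?R `` {((E, \<iota> j E z), g)} = ?R `` {((D, \<iota> j D y), f)}"
      if "E \<in> K" "z \<in> Val (OMap F j) E" "g \<in> Hom C X E"
        "Act (OMap F j) X D f y = Act (OMap F j) X E g z" for E z g
      using push[OF *(1) presented_by_exact[OF FK[OF *(1)] X *(2) that(1) *(3) that(2) *(4) that(3,4)]]
      by simp
    then show ?thesis
      unfolding \<Phi>_def using * by blast
  qed
  obtain j y' where j: "j \<in> Ob J" "y' \<in> Val (OMap F j) D" "y = \<iota> j D y'"
    using pointwise_colimit_cover[OF L _ *(3)] *(1) K by blast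
  obtain k z' where k: "k \<in> Ob J" "z' \<in> Val (OMap F k) E" "z = \<iota> k E z'"
    using pointwise_colimit_cover[OF L _ *(4)] *(2) K by blast
  have "\<iota> j X (Act (OMap F j) X D f y') = \<iota> k X (Act (OMap F k) X E g z')"
    using eq j k * \<iota>_act[OF X] by simp
  moreover have "Act (OMap F j) X D f y' \<in> Val (OMap F j) X" "Act (OMap F k) X E g z' \<in> Val (OMap F k) X"
    using j k * K X presheaf_act[OF Fp] by blast+
  ultimately have "((j, Act (OMap F j) X D f y'), (k, Act (OMap F k) X E g z')) \<in> colim_rel J F X"
    using pointwise_colimit_exact[OF L X j(1) k(1)] by blast
  then have "\<Phi> j (Act (OMap F j) X D f y') = \<Phi> k (Act (OMap F k) X E g z')"
  proof (rule colim_rel_invariant)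
    fix i k u x assume u: "i \<in> Ob J" "k \<in> Ob J" "u \<in> Hom J i k" "x \<in> Val (OMap F i) X"
    obtain D y f where D: "D \<in> K" "y \<in> Val (OMap F i) D" "f \<in> Hom C X D" "x = Act (OMap F i) X D f y"
      using presented_by_cover[OF FK[OF u(1)] X u(4)] by blast
    then have "AMap F i k u X x = Act (OMap F k) X D f (AMap F i k u D y)"
      using nat_trans_natural[OF Fn[OF u(1-3)] X] K by blast
    moreover have "AMap F i k u D y \<in> Val (OMap F k) D"
      using nat_trans_val[OF Fn[OF u(1-3)]] D K by blast
    ultimately show "\<Phi> i x = \<Phi> k (AMap F i k u X x)"
      using \<Phi> D u \<iota>_step by simp
  qed
  then show "(((D, y), f), ((E, z), g)) \<in> ?R"
    using \<Phi> j k * by (simp add: colim_rel_Image_eq)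
qed


section \<open>Small presheaves\<close>

text \<open>
  Any diagram whose index category is small, whatever its type of objects, may be used: its objects
  are replaced by codes \<open>e j\<close> in the universe.
\<close>
lemma small_presheafI:
  fixes J :: "('j, 'u) category"
  assumes J: "is_category J" "small TYPE('u) (Ob J)"
      "\<And>j k. j \<in> Ob J \<Longrightarrow> k \<in> Ob J \<Longrightarrow> small TYPE('u) (Hom J j k)"
    and F: "is_functor J (presheaves C) F" "\<And>j. j \<in> Ob J \<Longrightarrow> representable C (OMap F j)"
    and P: "is_colimit (presheaves C) J F P \<iota>"
  shows "small_presheaf C P"
proof -
  obtain e :: "'j \<Rightarrow> 'u" where e: "inj_on e (Ob J)"
    using small_inj[OF univ J(2)] by blast
  define d where "d = the_inv_into (Ob J) e"
  have de [simp]: "d (e j) = j" if "j \<in> Ob J" for j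
    using the_inv_into_f_f[OF e that] by (simp add: d_def)
  define J' where "J' = \<lparr>Ob = e ` Ob J, Hom = (\<lambda>a b. Hom J (d a) (d b)), Id = (\<lambda>a. Id J (d a)),
    Comp = (\<lambda>a b c. Comp J (d a) (d b) (d c))\<rparr>"
  define F' where "F' = \<lparr>OMap = (\<lambda>a. OMap F (d a)), AMap = (\<lambda>a b. AMap F (d a) (d b))\<rparr>"
  have "is_category J'"
    using J(1) unfolding is_category_def J'_def by simp
  then have "small_category J'"
    using J(2,3) small_image[OF univ] unfolding small_category_def locally_small_def
    by (simp add: J'_def)
  moreover have "is_functor J' (presheaves C) F'"
    using F(1) unfolding is_functor_def J'_def F'_def by simp
  moreover have "\<forall>a\<in>Ob J'. representable C (OMap F' a)"
    using F(2) by (simp add: J'_def F'_def)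
  moreover have "is_colimit (presheaves C) J' F' P (\<lambda>a. \<iota> (d a))"
  proof -
    have *: "is_cocone (presheaves C) J' F' T \<tau> \<longleftrightarrow> is_cocone (presheaves C) J F T (\<lambda>j. \<tau> (e j))" for T \<tau>
      unfolding is_cocone_def J'_def F'_def by simp
    have **: "is_cocone (presheaves C) J F P (\<lambda>j. \<iota> (d (e j))) \<longleftrightarrow> is_cocone (presheaves C) J F P \<iota>"
      unfolding is_cocone_def by simp
    show ?thesis
      using P unfolding is_colimit_def * ** unfolding J'_def F'_def by simp
  qed
  ultimately show ?thesis
    unfolding small_presheaf_def by blast
qed

lemma presented_by_small_presheaf:
  assumes K: "K \<subseteq> Ob C" "small TYPE('u) K" and P: "presented_by C K P"
  shows "small_presheaf C P"
proof (rule small_presheafI)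
  note Pp = presented_by_presheaf[OF P]
  show "is_category (elements C K P)"
    by (rule elements_category[OF K(1) Pp])
  show "small TYPE('u) (Ob (elements C K P))"
    using small_Sigma[OF univ K(2)] Pp K(1) by (auto simp: is_presheaf_def)
  show "small TYPE('u) (Hom (elements C K P) j k)"
    if "j \<in> Ob (elements C K P)" "k \<in> Ob (elements C K P)" for j k
    using that K(1) by (auto intro!: small_subset[OF univ small_hom, rotated 2])
  show "is_functor (elements C K P) (presheaves C) (elements_diagram C)"
    by (rule elements_functor[OF K(1)])
  show "representable C (OMap (elements_diagram C) j)" if "j \<in> Ob (elements C K P)" for j
    using that K(1) by (auto simp: representable_yo)
  show "is_colimit (presheaves C) (elements C K P) (elements_diagram C) P (\<lambda>(D, y). element_map C P D y)"
    using pointwise_colimit_is_colimit[OF elements_functor[OF K(1)] P[unfolded presented_by_def], of UNIV]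
    by (simp add: full_subcategory_UNIV)
qed

lemma colimit_is_pointwise_UNIV:
  fixes J :: "('u, 'u) category"
  assumes "small_category J" "is_functor J (presheaves C) F" "is_colimit (presheaves C) J F P \<iota>"
  shows "pointwise_colimit C J F P \<iota>"
proof -
  have "small TYPE('u) (Ob J)"
    using assms(1) by (simp add: small_category_def)
  then obtain L0 \<iota>0 where "pointwise_colimit C J F L0 \<iota>0"
    using pointwise_colimit_exists assms(2) by blast
  then show ?thesis
    using colimit_is_pointwise[of J C F UNIV P \<iota>] assms by (simp add: full_subcategory_UNIV)
qed

text \<open>
  A diagram of representables whose colimit is \<open>P\<close> only involves a small set of representing
  objects. Every larger set \<open>K\<close> presents all these representables, hence also their colimit. That
  all larger sets work makes it possible to find a common \<open>K\<close> for a small family of presheaves.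
\<close>
lemma small_presheaf_presented_by:
  assumes "small_presheaf C P"
  shows "\<exists>K0\<subseteq>Ob C. small TYPE('u) K0 \<and> (\<forall>K. K0 \<subseteq> K \<longrightarrow> K \<subseteq> Ob C \<longrightarrow> presented_by C K P)"
proof -
  obtain J :: "('u, 'u) category" and F \<iota> where J: "small_category J"
    and F: "is_functor J (presheaves C) F" "\<And>j. j \<in> Ob J \<Longrightarrow> representable C (OMap F j)"
    and P: "is_colimit (presheaves C) J F P \<iota>"
    using assms unfolding small_presheaf_def by blast
  note pw = colimit_is_pointwise_UNIV[OF J F(1) P]
  have "\<forall>j\<in>Ob J. \<exists>D e. D \<in> Ob C \<and> e \<in> Val (OMap F j) D \<and>
      (\<forall>X\<in>Ob C. bij_betw (\<lambda>f. Act (OMap F j) X D f e) (Hom C X D) (Val (OMap F j) X))"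
    using F(2) representable_iff functor_presheaf[OF F(1)] by blast
  then obtain D e where D: "\<And>j. j \<in> Ob J \<Longrightarrow> D j \<in> Ob C" "\<And>j. j \<in> Ob J \<Longrightarrow> e j \<in> Val (OMap F j) (D j)"
    "\<And>j X. j \<in> Ob J \<Longrightarrow> X \<in> Ob C \<Longrightarrow>
      bij_betw (\<lambda>f. Act (OMap F j) X (D j) f (e j)) (Hom C X (D j)) (Val (OMap F j) X)"
    by metis
  have "presented_by C K P" if K: "D ` Ob J \<subseteq> K" "K \<subseteq> Ob C" for K
    using K D functor_presheaf[OF F(1)]
    by (intro colimit_presented_by[OF K(2) F(1) pw] representable_presented_by[OF K(2)]) auto
  moreover have "small TYPE('u) (D ` Ob J)"
    using J by (simp add: small_category_def small_image[OF univ])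
  ultimately show ?thesis
    using D(1) by (intro exI[of _ "D ` Ob J"]) auto
qed

lemma colimit_small_presheaf:
  fixes J :: "('u, 'u) category"
  assumes J: "small_category J" and F: "is_functor J (presheaves C) F"
    and small: "\<And>j. j \<in> Ob J \<Longrightarrow> small_presheaf C (OMap F j)"
    and L: "pointwise_colimit C J F L \<iota>"
  shows "small_presheaf C L"
proof -
  have "\<forall>j\<in>Ob J. \<exists>K0. K0 \<subseteq> Ob C \<and> small TYPE('u) K0 \<and>
      (\<forall>K. K0 \<subseteq> K \<longrightarrow> K \<subseteq> Ob C \<longrightarrow> presented_by C K (OMap F j))"
    using small_presheaf_presented_by small by blast
  then obtain K0 where K0: "\<And>j. j \<in> Ob J \<Longrightarrow> K0 j \<subseteq> Ob C" "\<And>j. j \<in> Ob J \<Longrightarrow> small TYPE('u) (K0 j)"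
    "\<And>j K. j \<in> Ob J \<Longrightarrow> K0 j \<subseteq> K \<Longrightarrow> K \<subseteq> Ob C \<Longrightarrow> presented_by C K (OMap F j)"
    by metis
  define K where "K = (\<Union>j\<in>Ob J. K0 j)"
  have K: "K \<subseteq> Ob C" "small TYPE('u) K"
    using K0(1,2) J unfolding K_def small_category_def by (auto intro: small_UN[OF univ])
  have "presented_by C K (OMap F j)" if "j \<in> Ob J" for j
    using K0(3)[OF that _ K(1)] that by (auto simp: K_def)
  then show ?thesis
    using presented_by_small_presheaf[OF K] colimit_presented_by[OF K(1) F L] by blast
qed

lemma yo_small_presheaf: "D \<in> Ob C \<Longrightarrow> small_presheaf C (yo C D)"
  by (rule presented_by_small_presheaf[of "{D}"], simp, rule small_finite[OF univ], simp,
      rule representable_presented_by[of _ _ D "Id C D"])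
    (auto simp: yo_presheaf id_hom comp_id_left bij_betw_def inj_on_def image_def)

end


section \<open>Subpresheaves classified by the given monics\<close>

text \<open>
  For every element \<open>q\<close> of \<open>Q\<close>, the maps along which \<open>q\<close> restricts into \<open>S\<close> are exactly those that
  factor through one given monic \<open>m\<close>. In terms of representables: \<open>m\<close> is the pullback of the
  inclusion of \<open>S\<close> along the map corresponding to \<open>q\<close>.
\<close>
definition M_open ::
  "('o, 'u) category \<Rightarrow> ('o \<Rightarrow> 'o \<Rightarrow> 'u set) \<Rightarrow> ('o, 'u) presheaf \<Rightarrow> ('o \<Rightarrow> 'u set) \<Rightarrow> bool" where
  "M_open C M Q S \<longleftrightarrow>
     (\<forall>X\<in>Ob C. S X \<subseteq> Val Q X) \<and>
     (\<forall>D\<in>Ob C. \<forall>q\<in>Val Q D. \<exists>B\<in>Ob C. \<exists>m\<in>M B D. \<forall>X\<in>Ob C. \<forall>f\<in>Hom C X D.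
        Act Q X D f q \<in> S X \<longleftrightarrow> (\<exists>g\<in>Hom C X B. f = Comp C X B D m g))"

definition subpresheaf :: "('o, 'u) presheaf \<Rightarrow> ('o \<Rightarrow> 'u set) \<Rightarrow> ('o, 'u) presheaf" where
  "subpresheaf Q S = \<lparr>Val = S, Act = Act Q\<rparr>"

definition inclusion :: "('o, 'u) category \<Rightarrow> ('o \<Rightarrow> 'u set) \<Rightarrow> 'o \<Rightarrow> 'u \<Rightarrow> 'u" where
  "inclusion C S = (\<lambda>X\<in>Ob C. \<lambda>x\<in>S X. x)"

lemma subpresheaf_simps [simp]: "Val (subpresheaf Q S) = S" "Act (subpresheaf Q S) = Act Q"
  by (simp_all add: subpresheaf_def)

lemma inclusion_apply [simp]: "X \<in> Ob C \<Longrightarrow> x \<in> S X \<Longrightarrow> inclusion C S X x = x"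
  by (simp add: inclusion_def)

lemma is_iso_small_presheaves [simp]: "is_iso (small_presheaves C) = is_iso (presheaves C)"
  by (simp add: is_iso_def fun_eq_iff)

locale M_base = locally_small_base C for C :: "('o, 'u) category" +
  fixes M :: "'o \<Rightarrow> 'o \<Rightarrow> 'u set"
  assumes M_cat: "M_category C M"
begin

lemma M_hom: "X \<in> Ob C \<Longrightarrow> Y \<in> Ob C \<Longrightarrow> m \<in> M X Y \<Longrightarrow> m \<in> Hom C X Y"
  and M_cancel: "X \<in> Ob C \<Longrightarrow> Y \<in> Ob C \<Longrightarrow> m \<in> M X Y \<Longrightarrow> W \<in> Ob C \<Longrightarrow> f \<in> Hom C W X \<Longrightarrow>
    g \<in> Hom C W X \<Longrightarrow> Comp C W X Y m f = Comp C W X Y m g \<Longrightarrow> f = g"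
  and M_comp: "X \<in> Ob C \<Longrightarrow> Y \<in> Ob C \<Longrightarrow> Z \<in> Ob C \<Longrightarrow> m \<in> M X Y \<Longrightarrow> n \<in> M Y Z \<Longrightarrow>
    Comp C X Y Z n m \<in> M X Z"
  using M_cat unfolding M_category_def stable_system_of_monics_def is_monic_def by metis+

lemma M_id: "X \<in> Ob C \<Longrightarrow> Id C X \<in> M X X"
proof -
  assume X: "X \<in> Ob C"
  then have "is_iso C X X (Id C X)"
    unfolding is_iso_def using id_hom comp_id_left by blast
  then show ?thesis
    using X M_cat unfolding M_category_def stable_system_of_monics_def by metis
qed

lemma M_openD:
  assumes "M_open C M Q S"
  shows M_open_subset: "\<And>X x. X \<in> Ob C \<Longrightarrow> x \<in> S X \<Longrightarrow> x \<in> Val Q X"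
    and M_open_classifier: "\<And>D q. D \<in> Ob C \<Longrightarrow> q \<in> Val Q D \<Longrightarrow> \<exists>B\<in>Ob C. \<exists>m\<in>M B D. \<forall>X\<in>Ob C.
      \<forall>f\<in>Hom C X D. Act Q X D f q \<in> S X \<longleftrightarrow> (\<exists>g\<in>Hom C X B. f = Comp C X B D m g)"
  using assms by (auto simp: M_open_def)

lemma M_open_classifierE:
  assumes "M_open C M Q S" "D \<in> Ob C" "q \<in> Val Q D"
  obtains B m where "B \<in> Ob C" "m \<in> M B D"
    and "\<And>X f. X \<in> Ob C \<Longrightarrow> f \<in> Hom C X D \<Longrightarrow>
      Act Q X D f q \<in> S X \<longleftrightarrow> (\<exists>g\<in>Hom C X B. f = Comp C X B D m g)"
  using M_open_classifier[OF assms] by blast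

lemma M_open_act:
  assumes Q: "is_presheaf C Q" and S: "M_open C M Q S"
    and *: "X \<in> Ob C" "D \<in> Ob C" "f \<in> Hom C X D" "q \<in> S D"
  shows "Act Q X D f q \<in> S X"
proof -
  have q: "q \<in> Val Q D"
    using M_open_subset[OF S] * by blast
  obtain B m where B: "B \<in> Ob C" "m \<in> M B D"
    and iff: "\<And>X f. X \<in> Ob C \<Longrightarrow> f \<in> Hom C X D \<Longrightarrow>
      Act Q X D f q \<in> S X \<longleftrightarrow> (\<exists>g\<in>Hom C X B. f = Comp C X B D m g)"
    by (rule M_open_classifierE[OF S *(2) q]) (rule that)
  \<comment> \<open>As \<open>q\<close> itself lies in \<open>S\<close>, the identity factors through \<open>m\<close>; hence so does every map.\<close>
  obtain s where s: "s \<in> Hom C D B" "Id C D = Comp C D B D m s"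
    using iff[OF *(2) id_hom[OF *(2)]] presheaf_id[OF Q *(2) q] *(4) by auto
  have "f = Comp C X D D (Comp C D B D m s) f"
    using comp_id_left[OF *(1-3)] s(2) by simp
  also have "\<dots> = Comp C X B D m (Comp C X D B s f)"
    using * s B M_hom by (intro comp_assoc) auto
  finally show ?thesis
    using iff * comp_hom[OF *(1,2) B(1) *(3) s(1)] by blast
qed

lemma subpresheaf_presheaf:
  assumes "is_presheaf C Q" and "M_open C M Q S"
  shows "is_presheaf C (subpresheaf Q S)"
  unfolding is_presheaf_def
proof (intro conjI ballI)
  fix X assume "X \<in> Ob C"
  then show "small TYPE('u) (Val (subpresheaf Q S) X)"
    using assms by (auto simp: is_presheaf_def M_open_def intro: small_subset[OF univ])
qed (use assms in \<open>auto simp: M_open_act M_open_subset presheaf_id presheaf_comp\<close>)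

lemma inclusion_nat_trans:
  assumes "is_presheaf C Q" and "M_open C M Q S"
  shows "inclusion C S \<in> nat_trans C (subpresheaf Q S) Q"
  using nat_transI[of C "subpresheaf Q S" "\<lambda>X x. x" Q] assms
  by (auto simp: inclusion_def M_open_act M_open_subset)

text \<open>
  Write \<open>Q\<close> as a small colimit of representables \<open>F j\<close>. The preimages \<open>R j\<close> of \<open>S\<close> in the \<open>F j\<close> form a
  diagram of the same shape. Steps of a zigzag neither enter nor leave them, so \<open>S\<close> is the colimit
  of the \<open>R j\<close>. If \<open>e\<close> is the universal element of \<open>F j\<close>, then the monic \<open>m\<close> that classifies the
  restrictions of \<open>\<iota> j e\<close> into \<open>S\<close> makes \<open>e \<cdot> m\<close> a universal element of \<open>R j\<close>.
\<close>
lemma M_open_small_presheaf: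
  assumes Q: "is_presheaf C Q" and small: "small_presheaf C Q" and S: "M_open C M Q S"
  shows "small_presheaf C (subpresheaf Q S)"
proof -
  obtain J :: "('u, 'u) category" and F \<iota> where J: "small_category J"
    and F: "is_functor J (presheaves C) F" "\<And>j. j \<in> Ob J \<Longrightarrow> representable C (OMap F j)"
    and P: "is_colimit (presheaves C) J F Q \<iota>"
    using small unfolding small_presheaf_def by blast
  note pw = colimit_is_pointwise_UNIV[OF J F(1) P]
  note Fp = functor_presheaf[OF F(1)] and Fn = functor_nat_trans[OF F(1)]
    and \<iota> = pointwise_colimit_leg[OF pw]
  have \<iota>_step: "\<iota> j X x = \<iota> k X (AMap F j k u X x)"
    if "X \<in> Ob C" "j \<in> Ob J" "k \<in> Ob J" "u \<in> Hom J j k" "x \<in> Val (OMap F j) X" for X j k u x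
    using cocone_legs_step[of C UNIV J F Q \<iota>] pointwise_colimit_cocone[OF pw] that
    by (auto simp: full_subcategory_UNIV)
  define R where "R j X = {x \<in> Val (OMap F j) X. \<iota> j X x \<in> S X}" for j X
  define G where "G = \<lparr>OMap = (\<lambda>j. subpresheaf (OMap F j) (R j)),
    AMap = (\<lambda>j k u. \<lambda>X\<in>Ob C. \<lambda>x\<in>R j X. AMap F j k u X x)\<rparr>"
  have R_act: "Act (OMap F j) X Y f x \<in> R j X"
    if "j \<in> Ob J" "X \<in> Ob C" "Y \<in> Ob C" "f \<in> Hom C X Y" "x \<in> R j Y" for j X Y f x
    using that presheaf_act[OF Fp] M_open_act[OF Q S] nat_trans_natural[OF \<iota>]
    by (simp add: R_def)
  have R_step: "AMap F j k u X x \<in> R k X \<longleftrightarrow> x \<in> R j X"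
    if "X \<in> Ob C" "j \<in> Ob J" "k \<in> Ob J" "u \<in> Hom J j k" "x \<in> Val (OMap F j) X" for X j k u x
    using \<iota>_step[OF that] nat_trans_val[OF Fn[OF that(2-4)] that(1,5)] that(5) by (simp add: R_def)
  have R_sub: "x \<in> Val (OMap F j) X" if "x \<in> R j X" for j X x
    using that by (simp add: R_def)
  have Gp: "is_presheaf C (subpresheaf (OMap F j) (R j))" if "j \<in> Ob J" for j
    unfolding is_presheaf_def
  proof (intro conjI ballI)
    fix X assume "X \<in> Ob C"
    then have "small TYPE('u) (Val (OMap F j) X)"
      using Fp[OF that] by (simp add: is_presheaf_def)
    then show "small TYPE('u) (Val (subpresheaf (OMap F j) (R j)) X)"
      by (rule small_subset[OF univ]) (auto simp: R_def)
  qed (use that in \<open>auto simp: R_act R_sub presheaf_id[OF Fp] presheaf_comp[OF Fp]\<close>)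
  have Gn: "(\<lambda>X\<in>Ob C. \<lambda>x\<in>R j X. AMap F j k u X x) \<in>
      nat_trans C (subpresheaf (OMap F j) (R j)) (subpresheaf (OMap F k) (R k))"
    if "j \<in> Ob J" "k \<in> Ob J" "u \<in> Hom J j k" for j k u
    using nat_transI[of C "subpresheaf (OMap F j) (R j)" "AMap F j k u" "subpresheaf (OMap F k) (R k)"]
      that R_step R_sub R_act nat_trans_natural[OF Fn] by simp
  have G: "is_functor J (presheaves C) G"
    unfolding is_functor_def
  proof (intro conjI ballI)
    fix j assume j: "j \<in> Ob J"
    then have "Id J j \<in> Hom J j j"
      using J by (auto simp: small_category_def locally_small_def is_category_def)
    from Gn[OF j j this] have "(\<lambda>X\<in>Ob C. \<lambda>x\<in>R j X. Id (presheaves C) (OMap F j) X x) \<in>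
        nat_trans C (subpresheaf (OMap F j) (R j)) (subpresheaf (OMap F j) (R j))"
      using F(1) j by (simp add: is_functor_def)
    moreover have "AMap F j j (Id J j) = Id (presheaves C) (OMap F j)"
      using F(1) j by (simp add: is_functor_def)
    ultimately show "AMap G j j (Id J j) = Id (presheaves C) (OMap G j)"
      unfolding G_def using j R_sub
      by (auto intro!: nat_trans_eqI[OF _ Id_nat_trans[OF Gp]])
  next
    fix i j k u v assume *: "i \<in> Ob J" "j \<in> Ob J" "k \<in> Ob J" "u \<in> Hom J i j" "v \<in> Hom J j k"
    then have "Comp J i j k v u \<in> Hom J i k"
      using J unfolding small_category_def locally_small_def is_category_def by blast
    moreover have eq: "AMap F i k (Comp J i j k v u) =
        Comp (presheaves C) (OMap F i) (OMap F j) (OMap F k) (AMap F j k v) (AMap F i j u)"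
      using F(1) * by (simp add: is_functor_def)
    ultimately have "(\<lambda>X\<in>Ob C. \<lambda>x\<in>R i X.
        Comp (presheaves C) (OMap F i) (OMap F j) (OMap F k) (AMap F j k v) (AMap F i j u) X x) \<in>
        nat_trans C (subpresheaf (OMap F i) (R i)) (subpresheaf (OMap F k) (R k))"
      using Gn[OF *(1,3)] by metis
    with eq show "AMap G i k (Comp J i j k v u) =
        Comp (presheaves C) (OMap G i) (OMap G j) (OMap G k) (AMap G j k v) (AMap G i j u)"
      unfolding G_def using * Gn R_sub Gp R_step
      by (auto intro!: nat_trans_eqI[OF _ Comp_nat_trans])
  qed (use Gp Gn in \<open>auto simp: G_def\<close>)
  have G_repr: "representable C (OMap G j)" if j: "j \<in> Ob J" for j
  proof -
    obtain D e where D: "D \<in> Ob C" "e \<in> Val (OMap F j) D"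
      and bij: "\<And>X. X \<in> Ob C \<Longrightarrow> bij_betw (\<lambda>f. Act (OMap F j) X D f e) (Hom C X D) (Val (OMap F j) X)"
      using F(2)[OF j] representable_iff[OF Fp[OF j]] by blast
    have \<iota>_e: "\<iota> j X (Act (OMap F j) X D f e) = Act Q X D f (\<iota> j D e)"
      if "X \<in> Ob C" "f \<in> Hom C X D" for X f
      using nat_trans_natural[OF \<iota>[OF j] that(1) D(1) that(2) D(2)] .
    obtain B m where B: "B \<in> Ob C" "m \<in> M B D"
      and iff: "\<And>X f. X \<in> Ob C \<Longrightarrow> f \<in> Hom C X D \<Longrightarrow>
        Act Q X D f (\<iota> j D e) \<in> S X \<longleftrightarrow> (\<exists>g\<in>Hom C X B. f = Comp C X B D m g)"
      by (rule M_open_classifierE[OF S D(1) nat_trans_val[OF \<iota>[OF j] D]]) (rule that)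
    have m: "m \<in> Hom C B D"
      using M_hom B D by blast
    define e' where "e' = Act (OMap F j) B D m e"
    have e': "e' \<in> R j B"
      using iff[OF B(1) m] \<iota>_e[OF B(1) m] presheaf_act[OF Fp[OF j] B(1) D(1) m D(2)]
        id_hom[OF B(1)] comp_id_right[OF B(1) D(1) m] unfolding R_def e'_def by force
    have act_e': "Act (OMap F j) X B g e' = Act (OMap F j) X D (Comp C X B D m g) e"
      if "X \<in> Ob C" "g \<in> Hom C X B" for X g
      unfolding e'_def using presheaf_comp[OF Fp[OF j]] that B D m by simp
    have "bij_betw (\<lambda>g. Act (OMap F j) X B g e') (Hom C X B) (R j X)" if X: "X \<in> Ob C" for X
      unfolding bij_betw_def
    proof (intro conjI inj_onI equalityI subsetI)
      fix g g' assume g: "g \<in> Hom C X B" "g' \<in> Hom C X B"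
        "Act (OMap F j) X B g e' = Act (OMap F j) X B g' e'"
      then have "Comp C X B D m g = Comp C X B D m g'"
        using act_e' X B D m comp_hom bij_betw_imp_inj_on[OF bij[OF X]] by (simp add: inj_on_def)
      then show "g = g'"
        using M_cancel B D X g by blast
    next
      fix x assume "x \<in> (\<lambda>g. Act (OMap F j) X B g e') ` Hom C X B"
      then show "x \<in> R j X"
        using R_act[OF j X B(1) _ e'] by blast
    next
      fix x assume x: "x \<in> R j X"
      then obtain f where f: "f \<in> Hom C X D" "x = Act (OMap F j) X D f e"
        using bij_betw_imp_surj_on[OF bij[OF X]] by (auto simp: R_def)
      then obtain g where g: "g \<in> Hom C X B" "f = Comp C X B D m g"
        using iff[OF X f(1)] \<iota>_e[OF X f(1)] x by (auto simp: R_def)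
      then have "x = Act (OMap F j) X B g e'"
        using f(2) act_e'[OF X] by simp
      then show "x \<in> (\<lambda>g. Act (OMap F j) X B g e') ` Hom C X B"
        using g(1) by (rule image_eqI)
    qed
    then show ?thesis
      unfolding G_def using representable_iff[OF Gp[OF j]] B e' by auto
  qed
  define \<kappa> where "\<kappa> j = (\<lambda>X\<in>Ob C. \<lambda>x\<in>R j X. \<iota> j X x)" for j
  have \<kappa>: "\<kappa> j X x = \<iota> j X x" if "X \<in> Ob C" "x \<in> R j X" for j X x
    using that by (simp add: \<kappa>_def)
  have \<kappa>n: "\<kappa> j \<in> nat_trans C (subpresheaf (OMap F j) (R j)) (subpresheaf Q S)" if "j \<in> Ob J" for j
    using nat_transI[of C "subpresheaf (OMap F j) (R j)" "\<iota> j" "subpresheaf Q S"]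
      that R_act nat_trans_natural[OF \<iota>] unfolding \<kappa>_def by (simp add: R_def)
  have lift: "((j, x), (k, y)) \<in> colim_rel J G X"
    if "((j, x), (k, y)) \<in> colim_rel J F X" "X \<in> Ob C" "x \<in> R j X" "y \<in> R k X" for j x k y X
  proof -
    \<comment> \<open>Outside of \<open>R\<close> the invariant takes a dummy value, which is never the class of an element of \<open>R\<close>.\<close>
    have "(if x \<in> R j X then colim_rel J G X `` {(j, x)} else {}) =
        (if y \<in> R k X then colim_rel J G X `` {(k, y)} else {})"
      using that(1)
    proof (rule colim_rel_invariant)
      fix j k u x assume *: "j \<in> Ob J" "k \<in> Ob J" "u \<in> Hom J j k" "x \<in> Val (OMap F j) X"
      have "colim_rel J G X `` {(j, x)} = colim_rel J G X `` {(k, AMap F j k u X x)}" if "x \<in> R j X"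
        using colim_rel_step[OF *(1-3), of x G X] that \<open>X \<in> Ob C\<close>
        by (simp add: G_def flip: colim_rel_Image_eq)
      then show "(if x \<in> R j X then colim_rel J G X `` {(j, x)} else {}) =
          (if AMap F j k u X x \<in> R k X then colim_rel J G X `` {(k, AMap F j k u X x)} else {})"
        using R_step[OF that(2) *] by simp
    qed
    then show ?thesis
      using that by (simp add: colim_rel_Image_eq)
  qed
  have "pointwise_colimit C J G (subpresheaf Q S) \<kappa>"
    unfolding pointwise_colimit_def
  proof (intro conjI ballI impI)
    show "is_cocone (presheaves C) J G (subpresheaf Q S) \<kappa>"
      unfolding is_cocone_def
    proof (intro conjI ballI)
      fix j k u assume *: "j \<in> Ob J" "k \<in> Ob J" "u \<in> Hom J j k"
      then show "Comp (presheaves C) (OMap G j) (OMap G k) (subpresheaf Q S) (\<kappa> k) (AMap G j k u) = \<kappa> j"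
        unfolding G_def using Gp Gn \<kappa>n R_sub R_step \<iota>_step
        by (auto intro!: nat_trans_eqI[OF Comp_nat_trans \<kappa>n] simp: \<kappa>)
    qed (use subpresheaf_presheaf[OF Q S] \<kappa>n in \<open>auto simp: G_def\<close>)
  next
    fix X l assume X: "X \<in> Ob C" "l \<in> Val (subpresheaf Q S) X"
    then have "l \<in> Val Q X"
      using M_open_subset[OF S] by simp
    then obtain j x where "j \<in> Ob J" "x \<in> Val (OMap F j) X" "l = \<iota> j X x"
      using pointwise_colimit_cover[OF pw X(1)] by blast
    then show "\<exists>j\<in>Ob J. \<exists>x\<in>Val (OMap G j) X. l = \<kappa> j X x"
      using X by (intro bexI[of _ j] bexI[of _ x]) (auto simp: G_def R_def \<kappa>)
  next
    fix X i j x y assume *: "X \<in> Ob C" "i \<in> Ob J" "j \<in> Ob J" "x \<in> Val (OMap G i) X" "y \<in> Val (OMap G j) X"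
      "\<kappa> i X x = \<kappa> j X y"
    then have "x \<in> R i X" "y \<in> R j X" "\<iota> i X x = \<iota> j X y"
      by (auto simp: G_def \<kappa>)
    then show "((i, x), (j, y)) \<in> colim_rel J G X"
      using lift pointwise_colimit_exact[OF pw *(1-3)] R_sub * by blast
  qed
  then have "is_colimit (presheaves C) J G (subpresheaf Q S) \<kappa>"
    using pointwise_colimit_is_colimit[OF G, of _ _ UNIV] by (simp add: full_subcategory_UNIV)
  then show ?thesis
    unfolding small_presheaf_def using J G G_repr by blast
qed

end


section \<open>Pullbacks of small presheaves\<close>

context locally_small_base
begin

lemma element_map_comp:
  assumes "\<mu> \<in> nat_trans C P Q" "is_presheaf C P" "is_presheaf C Q" "D \<in> Ob C" "x \<in> Val P D"
  shows "Comp (presheaves C) (yo C D) P Q \<mu> (element_map C P D x) = element_map C Q D (\<mu> D x)"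
  using assms
  by (intro nat_trans_eqI[OF Comp_nat_trans element_map_nat_trans])
    (auto simp: yo_presheaf element_map_nat_trans nat_trans_val nat_trans_natural)

lemma element_map_inj:
  assumes "element_map C P D x = element_map C P D y"
    and "is_presheaf C P" "D \<in> Ob C" "x \<in> Val P D" "y \<in> Val P D"
  shows "x = y"
  using fun_cong[OF fun_cong[OF assms(1)], of D "Id C D"] assms(2-) by (simp add: id_hom presheaf_id)

text \<open>
  Elements of a presheaf at \<open>X\<close> are maps out of the representable at \<open>X\<close>, which is small. Thus the
  universal property in the category of small presheaves already speaks about elements.
\<close>
lemma is_pullback_iff_pointwise:
  "is_pullback (small_presheaves C) A B D f g P p q \<longleftrightarrow>
     {A, B, D, P} \<subseteq> Ob (small_presheaves C) \<and>
     f \<in> nat_trans C A D \<and> g \<in> nat_trans C B D \<and> p \<in> nat_trans C P A \<and> q \<in> nat_trans C P B \<and>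
     (\<forall>X\<in>Ob C. \<forall>z\<in>Val P X. f X (p X z) = g X (q X z)) \<and>
     (\<forall>X\<in>Ob C. \<forall>a\<in>Val A X. \<forall>b\<in>Val B X. f X a = g X b \<longrightarrow>
        (\<exists>!z. z \<in> Val P X \<and> p X z = a \<and> q X z = b))"
  (is "?L \<longleftrightarrow> ?obs \<and> ?f \<and> ?g \<and> ?p \<and> ?q \<and> ?comm \<and> ?univ")
proof (cases "?obs \<and> ?f \<and> ?g \<and> ?p \<and> ?q")
  case False
  then show ?thesis
    by (auto simp: is_pullback_def)
next
  case True
  then have pr: "is_presheaf C A" "is_presheaf C B" "is_presheaf C D" "is_presheaf C P"
    and f: ?f and g: ?g and p: ?p and q: ?q
    by auto
  have comm: "Comp (presheaves C) P A D f p = Comp (presheaves C) P B D g q \<longleftrightarrow> ?comm"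
  proof
    assume eq: "Comp (presheaves C) P A D f p = Comp (presheaves C) P B D g q"
    show ?comm
    proof (intro ballI)
      fix X z assume "X \<in> Ob C" "z \<in> Val P X"
      then show "f X (p X z) = g X (q X z)"
        using fun_cong[OF fun_cong[OF eq], of X z] by simp
    qed
  qed (intro nat_trans_eqI[OF Comp_nat_trans Comp_nat_trans], use pr f g p q in auto)
  let ?cat = "\<forall>T\<in>Ob (small_presheaves C). \<forall>a\<in>nat_trans C T A. \<forall>b\<in>nat_trans C T B.
    Comp (presheaves C) T A D f a = Comp (presheaves C) T B D g b \<longrightarrow>
    (\<exists>!h. h \<in> nat_trans C T P \<and> Comp (presheaves C) T P A p h = a \<and> Comp (presheaves C) T P B q h = b)"
  have "?cat \<longleftrightarrow> ?univ"
  proof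
    assume ?cat
    show ?univ
    proof (intro ballI impI)
      fix X a b assume X: "X \<in> Ob C" and a: "a \<in> Val A X" and b: "b \<in> Val B X" and eq: "f X a = g X b"
      let ?a = "element_map C A X a" and ?b = "element_map C B X b"
      have yo: "yo C X \<in> Ob (small_presheaves C)"
        using yo_presheaf[OF X] yo_small_presheaf[OF X] by simp
      have "Comp (presheaves C) (yo C X) A D f ?a = Comp (presheaves C) (yo C X) B D g ?b"
        by (simp add: element_map_comp f g pr X a b eq)
      then have ex1: "\<exists>!h. h \<in> nat_trans C (yo C X) P \<and>
          Comp (presheaves C) (yo C X) P A p h = ?a \<and> Comp (presheaves C) (yo C X) P B q h = ?b"
        using \<open>?cat\<close>[rule_format, OF yo, of ?a ?b] element_map_nat_trans pr X a b by blast
      have tr: "element_map C P X z \<in> nat_trans C (yo C X) P \<and>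
          Comp (presheaves C) (yo C X) P A p (element_map C P X z) = ?a \<and>
          Comp (presheaves C) (yo C X) P B q (element_map C P X z) = ?b \<longleftrightarrow> p X z = a \<and> q X z = b"
        if z: "z \<in> Val P X" for z
        using z element_map_inj[of A X "p X z" a] element_map_inj[of B X "q X z" b]
        by (auto simp: element_map_comp p q pr X a b element_map_nat_trans nat_trans_val[OF p X z]
            nat_trans_val[OF q X z])
      obtain h where h: "h \<in> nat_trans C (yo C X) P \<and>
          Comp (presheaves C) (yo C X) P A p h = ?a \<and> Comp (presheaves C) (yo C X) P B q h = ?b"
        using ex1 by blast
      define z where "z = h X (Id C X)"
      have z: "z \<in> Val P X" "h = element_map C P X z"
        using h yoneda_lemma[of h X P] nat_trans_val[of h C "yo C X" P X "Id C X"] X pr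
        by (auto simp: z_def id_hom)
      show "\<exists>!z. z \<in> Val P X \<and> p X z = a \<and> q X z = b"
      proof (rule ex1I)
        show "z \<in> Val P X \<and> p X z = a \<and> q X z = b"
          using h z tr by blast
        fix z' assume z': "z' \<in> Val P X \<and> p X z' = a \<and> q X z' = b"
        then have "element_map C P X z' = h"
          using ex1 h tr[of z'] by blast
        then show "z' = z"
          using element_map_inj[of P X z' z] z z' pr X by simp
      qed
    qed
  next
    assume univ: ?univ
    show ?cat
    proof (intro ballI impI)
      fix T a b assume T: "T \<in> Ob (small_presheaves C)" and a: "a \<in> nat_trans C T A"
        and b: "b \<in> nat_trans C T B"
        and eq: "Comp (presheaves C) T A D f a = Comp (presheaves C) T B D g b"
      have eq': "f X (a X t) = g X (b X t)" if "X \<in> Ob C" "t \<in> Val T X" for X t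
        using fun_cong[OF fun_cong[OF eq], of X t] that by simp
      define h where "h X t = (THE z. z \<in> Val P X \<and> p X z = a X t \<and> q X z = b X t)" for X t
      have h_ex1: "\<exists>!z. z \<in> Val P X \<and> p X z = a X t \<and> q X z = b X t" if "X \<in> Ob C" "t \<in> Val T X" for X t
        using univ[rule_format, OF that(1) _ _ eq'[OF that]] nat_trans_val a b that by metis
      have h: "h X t \<in> Val P X \<and> p X (h X t) = a X t \<and> q X (h X t) = b X t"
        if "X \<in> Ob C" "t \<in> Val T X" for X t
        unfolding h_def by (rule theI'[OF h_ex1[OF that]])
      have T': "is_presheaf C T"
        using T by simp
      have hn: "(\<lambda>X\<in>Ob C. \<lambda>t\<in>Val T X. h X t) \<in> nat_trans C T P"
      proof (rule nat_transI)
        fix X Y k t assume *: "X \<in> Ob C" "Y \<in> Ob C" "k \<in> Hom C X Y" "t \<in> Val T Y"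
        have kt: "Act T X Y k t \<in> Val T X"
          using presheaf_act[OF T' *] .
        have "Act P X Y k (h Y t) \<in> Val P X \<and> p X (Act P X Y k (h Y t)) = a X (Act T X Y k t) \<and>
            q X (Act P X Y k (h Y t)) = b X (Act T X Y k t)"
          using h[OF *(2,4)] nat_trans_natural[OF p *(1-3)] nat_trans_natural[OF q *(1-3)]
            nat_trans_natural[OF a *] nat_trans_natural[OF b *] presheaf_act[OF pr(4) *(1-3)] by simp
        then show "Act T X Y k t \<in> Val T X \<and> h X (Act T X Y k t) = Act P X Y k (h Y t)"
          using h_ex1[OF *(1) kt] h[OF *(1) kt] kt by blast
      qed (use h in blast)
      show "\<exists>!h. h \<in> nat_trans C T P \<and> Comp (presheaves C) T P A p h = a \<and>
          Comp (presheaves C) T P B q h = b"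
      proof (rule ex1I)
        show "(\<lambda>X\<in>Ob C. \<lambda>t\<in>Val T X. h X t) \<in> nat_trans C T P \<and>
            Comp (presheaves C) T P A p (\<lambda>X\<in>Ob C. \<lambda>t\<in>Val T X. h X t) = a \<and>
            Comp (presheaves C) T P B q (\<lambda>X\<in>Ob C. \<lambda>t\<in>Val T X. h X t) = b"
          using hn T' p q h a b
          by (auto intro!: nat_trans_eqI[OF Comp_nat_trans a] nat_trans_eqI[OF Comp_nat_trans b])
        fix k assume k: "k \<in> nat_trans C T P \<and> Comp (presheaves C) T P A p k = a \<and>
          Comp (presheaves C) T P B q k = b"
        show "k = (\<lambda>X\<in>Ob C. \<lambda>t\<in>Val T X. h X t)"
        proof (rule nat_trans_eqI[OF _ hn])
          fix X t assume X: "X \<in> Ob C" "t \<in> Val T X"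
          have "k X t \<in> Val P X \<and> p X (k X t) = a X t \<and> q X (k X t) = b X t"
            using k X Comp_apply[OF X] nat_trans_val[OF _ X] by metis
          then show "k X t = (\<lambda>X\<in>Ob C. \<lambda>t\<in>Val T X. h X t) X t"
            using h_ex1[OF X] h[OF X] X by auto
        qed (use k in blast)
      qed
    qed
  qed
  then show ?thesis
    using True comm unfolding is_pullback_def by auto
qed

end


section \<open>The monics between small presheaves\<close>

context M_base
begin

abbreviation "PC \<equiv> small_presheaves C"
abbreviation "PM \<equiv> small_presheaves_M C M"

text \<open>
  The pullback of \<open>\<mu>\<close> along the map corresponding to \<open>q\<close> consists of the maps along which \<open>q\<close> restricts
  into the image of \<open>\<mu>\<close>, each paired with a preimage of that restriction. Being given by a monic
  \<open>m\<close> says that these maps are those factoring through \<open>m\<close>, and that the preimage is unique: two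
  preimages of \<open>q\<close> itself would give two factorisations of the identity through \<open>m\<close>.
\<close>
lemma small_presheaves_M_iff:
  assumes P: "P \<in> Ob PC" and Q: "Q \<in> Ob PC"
  shows "\<mu> \<in> PM P Q \<longleftrightarrow> \<mu> \<in> nat_trans C P Q \<and> (\<forall>X\<in>Ob C. inj_on (\<mu> X) (Val P X)) \<and>
    M_open C M Q (\<lambda>X. \<mu> X ` Val P X)"
proof
  assume M: "\<mu> \<in> PM P Q"
  then have \<mu>: "\<mu> \<in> nat_trans C P Q"
    by (simp add: small_presheaves_M_def)
  have Qp: "is_presheaf C Q"
    using Q by simp
  have *: "\<exists>B\<in>Ob C. \<exists>m\<in>M B D. \<exists>\<delta>\<in>nat_trans C (yo C B) P.
      (\<forall>X\<in>Ob C. \<forall>g\<in>Hom C X B. Act Q X D (Comp C X B D m g) q = \<mu> X (\<delta> X g)) \<and>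
      (\<forall>X\<in>Ob C. \<forall>f\<in>Hom C X D. \<forall>x\<in>Val P X. Act Q X D f q = \<mu> X x \<longrightarrow>
        (\<exists>g\<in>Hom C X B. Comp C X B D m g = f \<and> \<delta> X g = x))"
    if D: "D \<in> Ob C" and q: "q \<in> Val Q D" for D q
  proof -
    obtain B m \<delta> where B: "B \<in> Ob C" "m \<in> M B D"
      and pb: "is_pullback PC (yo C D) P Q (element_map C Q D q) \<mu> (yo C B) (AMap (yoneda C) B D m) \<delta>"
      using M D element_map_nat_trans[OF Qp D q]
      unfolding small_presheaves_M_def presheaves_simps mem_Collect_eq by blast
    have m: "m \<in> Hom C B D"
      using M_hom B D by blast
    have \<delta>: "\<delta> \<in> nat_trans C (yo C B) P"
      and comm: "\<And>X g. X \<in> Ob C \<Longrightarrow> g \<in> Hom C X B \<Longrightarrow>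
        Act Q X D (Comp C X B D m g) q = \<mu> X (\<delta> X g)"
      and ex: "\<And>X f x. X \<in> Ob C \<Longrightarrow> f \<in> Hom C X D \<Longrightarrow> x \<in> Val P X \<Longrightarrow> Act Q X D f q = \<mu> X x \<Longrightarrow>
        \<exists>!g. g \<in> Hom C X B \<and> AMap (yoneda C) B D m X g = f \<and> \<delta> X g = x"
      using pb m B D comp_hom unfolding is_pullback_iff_pointwise by auto
    have "\<exists>g\<in>Hom C X B. Comp C X B D m g = f \<and> \<delta> X g = x"
      if "X \<in> Ob C" "f \<in> Hom C X D" "x \<in> Val P X" "Act Q X D f q = \<mu> X x" for X f x
      using ex1_implies_ex[OF ex[OF that]] that(1) by auto
    then show ?thesis
      using B \<delta> comm by blast
  qed
  have "inj_on (\<mu> D) (Val P D)" if D: "D \<in> Ob C" for D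
  proof (rule inj_onI)
    fix x y assume xy: "x \<in> Val P D" "y \<in> Val P D" "\<mu> D x = \<mu> D y"
    have q: "\<mu> D x \<in> Val Q D"
      using nat_trans_val[OF \<mu> D xy(1)] .
    obtain B m \<delta> where B: "B \<in> Ob C" "m \<in> M B D"
      and ex: "\<And>f z. f \<in> Hom C D D \<Longrightarrow> z \<in> Val P D \<Longrightarrow> Act Q D D f (\<mu> D x) = \<mu> D z \<Longrightarrow>
        \<exists>g\<in>Hom C D B. Comp C D B D m g = f \<and> \<delta> D g = z"
      using *[OF D q] D by metis
    obtain g where g: "g \<in> Hom C D B" "Comp C D B D m g = Id C D" "\<delta> D g = x"
      using ex[OF id_hom[OF D] xy(1)] presheaf_id[OF Qp D q] by auto
    obtain g' where g': "g' \<in> Hom C D B" "Comp C D B D m g' = Id C D" "\<delta> D g' = y"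
      using ex[OF id_hom[OF D] xy(2)] presheaf_id[OF Qp D q] xy(3) by auto
    have "g = g'"
      using M_cancel[OF B(1) D B(2) D g(1) g'(1)] g g' by simp
    then show "x = y"
      using g g' by simp
  qed
  moreover have "M_open C M Q (\<lambda>X. \<mu> X ` Val P X)"
    unfolding M_open_def
  proof (intro conjI ballI)
    fix D q assume "D \<in> Ob C" "q \<in> Val Q D"
    from *[OF this] obtain B m \<delta> where B: "B \<in> Ob C" "m \<in> M B D" and \<delta>: "\<delta> \<in> nat_trans C (yo C B) P"
      and 1: "\<And>X g. X \<in> Ob C \<Longrightarrow> g \<in> Hom C X B \<Longrightarrow>
        Act Q X D (Comp C X B D m g) q = \<mu> X (\<delta> X g)"
      and 2: "\<And>X f x. X \<in> Ob C \<Longrightarrow> f \<in> Hom C X D \<Longrightarrow> x \<in> Val P X \<Longrightarrow> Act Q X D f q = \<mu> X x \<Longrightarrow>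
        \<exists>g\<in>Hom C X B. Comp C X B D m g = f \<and> \<delta> X g = x"
      by blast
    have "Act Q X D f q \<in> \<mu> X ` Val P X \<longleftrightarrow> (\<exists>g\<in>Hom C X B. f = Comp C X B D m g)"
      if X: "X \<in> Ob C" "f \<in> Hom C X D" for X f
      using 1[OF X(1)] 2[OF X] nat_trans_val[OF \<delta> X(1)] by (fastforce simp: image_iff)
    with B show "\<exists>B\<in>Ob C. \<exists>m\<in>M B D. \<forall>X\<in>Ob C. \<forall>f\<in>Hom C X D.
        Act Q X D f q \<in> \<mu> X ` Val P X \<longleftrightarrow> (\<exists>g\<in>Hom C X B. f = Comp C X B D m g)"
      by blast
  qed (use nat_trans_val[OF \<mu>] in blast)
  ultimately show "\<mu> \<in> nat_trans C P Q \<and> (\<forall>X\<in>Ob C. inj_on (\<mu> X) (Val P X)) \<and>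
      M_open C M Q (\<lambda>X. \<mu> X ` Val P X)"
    using \<mu> by blast
next
  assume asm: "\<mu> \<in> nat_trans C P Q \<and> (\<forall>X\<in>Ob C. inj_on (\<mu> X) (Val P X)) \<and>
    M_open C M Q (\<lambda>X. \<mu> X ` Val P X)"
  then have \<mu>: "\<mu> \<in> nat_trans C P Q" and inj: "\<And>X. X \<in> Ob C \<Longrightarrow> inj_on (\<mu> X) (Val P X)"
    and op: "M_open C M Q (\<lambda>X. \<mu> X ` Val P X)"
    by auto
  have Qp: "is_presheaf C Q" and Pp: "is_presheaf C P"
    using P Q by auto
  have "\<exists>B\<in>Ob C. \<exists>m\<in>M B D. \<exists>\<delta>. is_pullback PC (yo C D) P Q \<gamma> \<mu> (yo C B) (AMap (yoneda C) B D m) \<delta>"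
    if D: "D \<in> Ob C" and \<gamma>: "\<gamma> \<in> nat_trans C (yo C D) Q" for D \<gamma>
  proof -
    define q where "q = \<gamma> D (Id C D)"
    have q: "q \<in> Val Q D" and \<gamma>_eq: "\<gamma> = element_map C Q D q"
      using nat_trans_val[OF \<gamma> D] id_hom[OF D] yoneda_lemma[OF \<gamma> Qp D] by (auto simp: q_def)
    obtain B m where B: "B \<in> Ob C" "m \<in> M B D"
      and iff: "\<And>X f. X \<in> Ob C \<Longrightarrow> f \<in> Hom C X D \<Longrightarrow>
        Act Q X D f q \<in> \<mu> X ` Val P X \<longleftrightarrow> (\<exists>g\<in>Hom C X B. f = Comp C X B D m g)"
      by (rule M_open_classifierE[OF op D q]) (rule that)
    have m: "m \<in> Hom C B D"
      using M_hom B D by blast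
    have mq: "Act Q B D m q \<in> Val Q B"
      using presheaf_act[OF Qp B(1) D m q] .
    have act: "Act Q X B g (Act Q B D m q) = Act Q X D (Comp C X B D m g) q"
      if "X \<in> Ob C" "g \<in> Hom C X B" for X g
      using presheaf_comp[OF Qp that(1) B(1) D that(2) m q] by simp
    obtain \<delta> where \<delta>: "\<delta> \<in> nat_trans C (yo C B) P"
      and \<mu>\<delta>: "\<And>X g. X \<in> Ob C \<Longrightarrow> g \<in> Hom C X B \<Longrightarrow> \<mu> X (\<delta> X g) = Act Q X D (Comp C X B D m g) q"
    proof -
      have "\<exists>\<delta>\<in>nat_trans C (yo C B) P. \<forall>X\<in>Ob C. \<forall>g\<in>Val (yo C B) X.
          \<mu> X (\<delta> X g) = element_map C Q B (Act Q B D m q) X g"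
      proof (rule factor_through_injective[OF Pp yo_presheaf[OF B(1)] \<mu> inj
            element_map_nat_trans[OF Qp B(1) mq]])
        fix X g assume X: "X \<in> Ob C" "g \<in> Val (yo C B) X"
        then have "Act Q X D (Comp C X B D m g) q \<in> \<mu> X ` Val P X"
          using iff[OF X(1) comp_hom[OF X(1) B(1) D _ m]] by auto
        then show "element_map C Q B (Act Q B D m q) X g \<in> \<mu> X ` Val P X"
          using X act by simp
      qed
      then show ?thesis
        using act that by auto
    qed
    have "is_pullback PC (yo C D) P Q \<gamma> \<mu> (yo C B) (AMap (yoneda C) B D m) \<delta>"
      unfolding is_pullback_iff_pointwise
    proof (intro conjI ballI impI)
      show "{yo C D, P, Q, yo C B} \<subseteq> Ob PC"
        using P Q B D yo_presheaf yo_small_presheaf by simp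
      show "AMap (yoneda C) B D m \<in> nat_trans C (yo C B) (yo C D)"
        using yoneda_functor B D m by (simp add: is_functor_def)
    next
      fix X g assume "X \<in> Ob C" "g \<in> Val (yo C B) X"
      then show "\<gamma> X (AMap (yoneda C) B D m X g) = \<mu> X (\<delta> X g)"
        using \<mu>\<delta> comp_hom[OF _ B(1) D _ m] by (simp add: \<gamma>_eq)
    next
      fix X f x assume X: "X \<in> Ob C" and f: "f \<in> Val (yo C D) X" and x: "x \<in> Val P X"
        and "\<gamma> X f = \<mu> X x"
      then have eq: "Act Q X D f q = \<mu> X x"
        by (simp add: \<gamma>_eq)
      then obtain g where g: "g \<in> Hom C X B" "f = Comp C X B D m g"
        using iff[OF X, of f] f x by auto
      have "\<delta> X g = x"
        using inj_onD[OF inj[OF X]] \<mu>\<delta>[OF X g(1)] eq g x nat_trans_val[OF \<delta> X, of g] by simp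
      then show "\<exists>!z. z \<in> Val (yo C B) X \<and> AMap (yoneda C) B D m X z = f \<and> \<delta> X z = x"
        using g X M_cancel[OF B(1) D B(2) X] by auto
    qed (use \<gamma> \<mu> \<delta> in auto)
    then show ?thesis
      using B by blast
  qed
  then show "\<mu> \<in> PM P Q"
    using \<mu> by (simp add: small_presheaves_M_def)
qed

lemma inclusion_M:
  assumes "Q \<in> Ob PC" and S: "M_open C M Q S"
  shows "subpresheaf Q S \<in> Ob PC" and "inclusion C S \<in> PM (subpresheaf Q S) Q"
proof -
  show sub: "subpresheaf Q S \<in> Ob PC"
    using assms subpresheaf_presheaf M_open_small_presheaf by simp
  have "M_open C M Q (\<lambda>X. inclusion C S X ` S X)"
    using S by (simp add: M_open_def image_def)
  then show "inclusion C S \<in> PM (subpresheaf Q S) Q"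
    using sub assms inclusion_nat_trans by (simp add: small_presheaves_M_iff inj_on_def)
qed

text \<open>
  Restrictions of \<open>a\<close> lie in the preimage of \<open>S\<close> precisely when those of \<open>f a\<close> lie in \<open>S\<close>, so the
  monic classifying the latter serves for the former.
\<close>
lemma M_open_vimage:
  assumes f: "f \<in> nat_trans C A Q" and A: "is_presheaf C A" and S: "M_open C M Q S"
  shows "M_open C M A (\<lambda>X. {a \<in> Val A X. f X a \<in> S X})"
  unfolding M_open_def
proof (intro conjI ballI)
  fix D a assume *: "D \<in> Ob C" "a \<in> Val A D"
  have "Act A X D k a \<in> {a \<in> Val A X. f X a \<in> S X} \<longleftrightarrow> Act Q X D k (f D a) \<in> S X"
    if "X \<in> Ob C" "k \<in> Hom C X D" for X k
    using that * nat_trans_natural[OF f] presheaf_act[OF A] by simp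
  then show "\<exists>B\<in>Ob C. \<exists>m\<in>M B D. \<forall>X\<in>Ob C. \<forall>k\<in>Hom C X D.
      Act A X D k a \<in> {a \<in> Val A X. f X a \<in> S X} \<longleftrightarrow> (\<exists>g\<in>Hom C X B. k = Comp C X B D m g)"
    using M_open_classifier[OF S *(1) nat_trans_val[OF f *]] by simp
qed auto

text \<open>
  For a composite, the monics classifying the two images are composed. A pullback of \<open>m\<close> along \<open>f\<close> is
  the preimage under \<open>f\<close> of the image of \<open>m\<close>; it exists among small presheaves because an
  \<open>M_open\<close> part of a small presheaf is small.
\<close>
lemma stable_system_small_presheaves: "stable_system_of_monics PC PM"
  unfolding stable_system_of_monics_def
proof (intro conjI ballI allI impI)
  fix P Q m assume *: "P \<in> Ob PC" "Q \<in> Ob PC" "m \<in> PM P Q"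
  then have m: "m \<in> nat_trans C P Q" "\<And>X. X \<in> Ob C \<Longrightarrow> inj_on (m X) (Val P X)"
    using small_presheaves_M_iff by blast+
  show "is_monic PC P Q m"
    unfolding is_monic_def presheaves_simps
  proof (intro conjI ballI impI m(1))
    fix W f g assume fg: "f \<in> nat_trans C W P" "g \<in> nat_trans C W P"
      and eq: "Comp (presheaves C) W P Q m f = Comp (presheaves C) W P Q m g"
    show "f = g"
    proof (rule nat_trans_eqI[OF fg])
      fix X w assume X: "X \<in> Ob C" "w \<in> Val W X"
      then have "m X (f X w) = m X (g X w)"
        using fun_cong[OF fun_cong[OF eq], of X w] by simp
      then show "f X w = g X w"
        using inj_onD[OF m(2)[OF X(1)]] nat_trans_val[OF _ X] fg by blast
    qed
  qed
next
  fix P Q f assume *: "P \<in> Ob PC" "Q \<in> Ob PC" "is_iso PC P Q f"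
  then have Q: "is_presheaf C Q"
    and f: "f \<in> nat_trans C P Q" "\<And>X. X \<in> Ob C \<Longrightarrow> inj_on (f X) (Val P X)"
      "\<And>X. X \<in> Ob C \<Longrightarrow> f X ` Val P X = Val Q X"
    using is_iso_iff_bij[of P Q f] by (auto simp: bij_betw_def)
  have "M_open C M Q (\<lambda>X. f X ` Val P X)"
    unfolding M_open_def
  proof (intro conjI ballI)
    fix D q assume D: "D \<in> Ob C" "q \<in> Val Q D"
    have "Act Q X D k q \<in> f X ` Val P X \<longleftrightarrow> (\<exists>g\<in>Hom C X D. k = Comp C X D D (Id C D) g)"
      if "X \<in> Ob C" "k \<in> Hom C X D" for X k
      using that D presheaf_act[OF Q] f(3) comp_id_left by metis
    then show "\<exists>B\<in>Ob C. \<exists>m\<in>M B D. \<forall>X\<in>Ob C. \<forall>k\<in>Hom C X D.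
        Act Q X D k q \<in> f X ` Val P X \<longleftrightarrow> (\<exists>g\<in>Hom C X B. k = Comp C X B D m g)"
      using D(1) M_id[OF D(1)] by blast
  qed (simp add: f(3))
  then show "f \<in> PM P Q"
    using small_presheaves_M_iff[OF *(1,2)] f by blast
next
  fix P Q R m n assume *: "P \<in> Ob PC" "Q \<in> Ob PC" "R \<in> Ob PC" and "m \<in> PM P Q" "n \<in> PM Q R"
  then have m: "m \<in> nat_trans C P Q" "\<And>X. X \<in> Ob C \<Longrightarrow> inj_on (m X) (Val P X)"
      "M_open C M Q (\<lambda>X. m X ` Val P X)"
    and n: "n \<in> nat_trans C Q R" "\<And>X. X \<in> Ob C \<Longrightarrow> inj_on (n X) (Val Q X)"
      "M_open C M R (\<lambda>X. n X ` Val Q X)"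
    using small_presheaves_M_iff by blast+
  have R: "is_presheaf C R" and Q: "is_presheaf C Q" and P: "is_presheaf C P"
    using * by auto
  have im: "Comp (presheaves C) P Q R n m X ` Val P X = n X ` (m X ` Val P X)" if "X \<in> Ob C" for X
    using that by (auto simp: image_image intro!: image_cong)
  have "inj_on (Comp (presheaves C) P Q R n m X) (Val P X)" if X: "X \<in> Ob C" for X
    using m(2)[OF X] n(2)[OF X] nat_trans_val[OF m(1) X] X by (simp add: inj_on_def)
  moreover have "M_open C M R (\<lambda>X. Comp (presheaves C) P Q R n m X ` Val P X)"
    unfolding M_open_def
  proof (intro conjI ballI)
    fix D r assume D: "D \<in> Ob C" "r \<in> Val R D"
    obtain B k where B: "B \<in> Ob C" "k \<in> M B D" and k: "\<And>X f. X \<in> Ob C \<Longrightarrow> f \<in> Hom C X D \<Longrightarrow>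
        Act R X D f r \<in> n X ` Val Q X \<longleftrightarrow> (\<exists>g\<in>Hom C X B. f = Comp C X B D k g)"
      by (rule M_open_classifierE[OF n(3) D]) (rule that)
    have kh: "k \<in> Hom C B D"
      using M_hom B D by blast
    then have "Act R B D k r \<in> n B ` Val Q B"
      using k[OF B(1) kh] comp_id_right[OF B(1) D(1) kh] id_hom[OF B(1)] by metis
    then obtain q where q: "q \<in> Val Q B" "n B q = Act R B D k r"
      by force
    obtain A l where A: "A \<in> Ob C" "l \<in> M A B" and l: "\<And>X f. X \<in> Ob C \<Longrightarrow> f \<in> Hom C X B \<Longrightarrow>
        Act Q X B f q \<in> m X ` Val P X \<longleftrightarrow> (\<exists>g\<in>Hom C X A. f = Comp C X A B l g)"
      by (rule M_open_classifierE[OF m(3) B(1) q(1)]) (rule that)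
    have lh: "l \<in> Hom C A B"
      using M_hom A B by blast
    have factor: "Act R X D (Comp C X B D k g) r \<in> n X ` (m X ` Val P X) \<longleftrightarrow>
        (\<exists>h\<in>Hom C X A. g = Comp C X A B l h)" if X: "X \<in> Ob C" and g: "g \<in> Hom C X B" for X g
    proof -
      have "Act R X D (Comp C X B D k g) r = n X (Act Q X B g q)"
        using presheaf_comp[OF R X B(1) D(1) g kh D(2)] nat_trans_natural[OF n(1) X B(1) g q(1)] q(2)
        by simp
      moreover have "m X ` Val P X \<subseteq> Val Q X" "Act Q X B g q \<in> Val Q X"
        using nat_trans_val[OF m(1) X] presheaf_act[OF Q X B(1) g q(1)] by auto
      ultimately show ?thesis
        using l[OF X g] inj_on_image_mem_iff[OF n(2)[OF X]] by metis
    qed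
    have "Act R X D f r \<in> n X ` (m X ` Val P X) \<longleftrightarrow> (\<exists>h\<in>Hom C X A. f = Comp C X A D (Comp C A B D k l) h)"
      if X: "X \<in> Ob C" and f: "f \<in> Hom C X D" for X f
    proof
      assume L: "Act R X D f r \<in> n X ` (m X ` Val P X)"
      then have "Act R X D f r \<in> n X ` Val Q X"
        using nat_trans_val[OF m(1) X] by blast
      then obtain g where g: "g \<in> Hom C X B" "f = Comp C X B D k g"
        using k[OF X f] by blast
      then obtain h where "h \<in> Hom C X A" "g = Comp C X A B l h"
        using factor[OF X g(1)] L by blast
      then show "\<exists>h\<in>Hom C X A. f = Comp C X A D (Comp C A B D k l) h"
        using g comp_assoc[OF X A(1) B(1) D(1) _ lh kh] by auto
    next
      assume "\<exists>h\<in>Hom C X A. f = Comp C X A D (Comp C A B D k l) h"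
      then obtain h where h: "h \<in> Hom C X A" "f = Comp C X B D k (Comp C X A B l h)"
        using comp_assoc[OF X A(1) B(1) D(1) _ lh kh] by auto
      then show "Act R X D f r \<in> n X ` (m X ` Val P X)"
        using factor[OF X comp_hom[OF X A(1) B(1) h(1) lh]] by blast
    qed
    moreover have "Comp C A B D k l \<in> M A D"
      using M_comp A B D by blast
    ultimately show "\<exists>B\<in>Ob C. \<exists>ma\<in>M B D. \<forall>X\<in>Ob C. \<forall>f\<in>Hom C X D.
        Act R X D f r \<in> Comp (presheaves C) P Q R n m X ` Val P X \<longleftrightarrow>
        (\<exists>g\<in>Hom C X B. f = Comp C X B D ma g)"
      using A(1) im by metis
  next
    fix X assume X: "X \<in> Ob C"
    show "Comp (presheaves C) P Q R n m X ` Val P X \<subseteq> Val R X"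
      unfolding im[OF X] using nat_trans_val[OF m(1) X] nat_trans_val[OF n(1) X] by blast
  qed
  ultimately show "Comp PC P Q R n m \<in> PM P R"
    using small_presheaves_M_iff[OF *(1,3)] Comp_nat_trans[OF P m(1) n(1)] by simp
next
  fix P Q A m f assume *: "P \<in> Ob PC" "Q \<in> Ob PC" "A \<in> Ob PC" and "m \<in> PM P Q" "f \<in> Hom PC A Q"
  then have m: "m \<in> nat_trans C P Q" "\<And>X. X \<in> Ob C \<Longrightarrow> inj_on (m X) (Val P X)"
      "M_open C M Q (\<lambda>X. m X ` Val P X)" and f: "f \<in> nat_trans C A Q"
    using small_presheaves_M_iff by auto
  have A: "is_presheaf C A" and P: "is_presheaf C P"
    using * by auto
  let ?S = "\<lambda>X. {a \<in> Val A X. f X a \<in> m X ` Val P X}"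
  have S: "M_open C M A ?S"
    by (rule M_open_vimage[OF f A m(3)])
  have Sp: "is_presheaf C (subpresheaf A ?S)"
    by (rule subpresheaf_presheaf[OF A S])
  have inc: "inclusion C ?S \<in> nat_trans C (subpresheaf A ?S) A"
    by (rule inclusion_nat_trans[OF A S])
  obtain q where q: "q \<in> nat_trans C (subpresheaf A ?S) P"
    and mq: "\<And>X a. X \<in> Ob C \<Longrightarrow> a \<in> ?S X \<Longrightarrow> m X (q X a) = f X a"
  proof -
    have "\<exists>q\<in>nat_trans C (subpresheaf A ?S) P. \<forall>X\<in>Ob C. \<forall>a\<in>Val (subpresheaf A ?S) X.
        m X (q X a) = Comp (presheaves C) (subpresheaf A ?S) A Q f (inclusion C ?S) X a"
      by (rule factor_through_injective[OF P Sp m(1,2) Comp_nat_trans[OF Sp inc f]]) auto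
    then show ?thesis
      using that by auto
  qed
  have "is_pullback PC A P Q f m (subpresheaf A ?S) (inclusion C ?S) q"
    unfolding is_pullback_iff_pointwise
  proof (intro conjI ballI impI)
    show "{A, P, Q, subpresheaf A ?S} \<subseteq> Ob PC"
      using * inclusion_M(1)[OF *(3) S] by blast
  next
    fix X a assume "X \<in> Ob C" "a \<in> Val (subpresheaf A ?S) X"
    then show "f X (inclusion C ?S X a) = m X (q X a)"
      using mq by simp
  next
    fix X a x assume X: "X \<in> Ob C" and a: "a \<in> Val A X" and x: "x \<in> Val P X" and eq: "f X a = m X x"
    then have aS: "a \<in> ?S X"
      by blast
    have "q X a \<in> Val P X"
      using nat_trans_val[OF q X] aS by simp
    with inj_onD[OF m(2)[OF X]] have qa: "q X a = x"
      using mq[OF X aS] eq x by metis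
    show "\<exists>!z. z \<in> Val (subpresheaf A ?S) X \<and> inclusion C ?S X z = a \<and> q X z = x"
    proof (rule ex1I)
      show "a \<in> Val (subpresheaf A ?S) X \<and> inclusion C ?S X a = a \<and> q X a = x"
        using aS X qa by simp
      fix z assume "z \<in> Val (subpresheaf A ?S) X \<and> inclusion C ?S X z = a \<and> q X z = x"
      then show "z = a"
        using inclusion_apply[OF X, of z ?S] by simp
    qed
  qed (use f m inc q in auto)
  then show "\<exists>R p q. is_pullback PC A P Q f m R p q"
    by blast
  fix R p q assume "is_pullback PC A P Q f m R p q"
  then have R: "R \<in> Ob PC" and p: "p \<in> nat_trans C R A" and q: "q \<in> nat_trans C R P"
    and comm: "\<And>X z. X \<in> Ob C \<Longrightarrow> z \<in> Val R X \<Longrightarrow> f X (p X z) = m X (q X z)"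
    and ex: "\<And>X a x. X \<in> Ob C \<Longrightarrow> a \<in> Val A X \<Longrightarrow> x \<in> Val P X \<Longrightarrow> f X a = m X x \<Longrightarrow>
      \<exists>!z. z \<in> Val R X \<and> p X z = a \<and> q X z = x"
    unfolding is_pullback_iff_pointwise by auto
  have "p X ` Val R X = ?S X" if X: "X \<in> Ob C" for X
  proof (intro equalityI subsetI)
    fix a assume "a \<in> p X ` Val R X"
    then show "a \<in> ?S X"
      using comm[OF X] nat_trans_val[OF p X] nat_trans_val[OF q X] by auto
  next
    fix a assume "a \<in> ?S X"
    then obtain x where "a \<in> Val A X" "x \<in> Val P X" "f X a = m X x"
      by blast
    then show "a \<in> p X ` Val R X"
      using ex[OF X] by blast
  qed
  then have "M_open C M A (\<lambda>X. p X ` Val R X)"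
    using S unfolding M_open_def by simp
  moreover have "inj_on (p X) (Val R X)" if X: "X \<in> Ob C" for X
  proof (rule inj_onI)
    fix z z' assume z: "z \<in> Val R X" "z' \<in> Val R X" "p X z = p X z'"
    then have "q X z = q X z'"
      using comm[OF X] inj_onD[OF m(2)[OF X]] nat_trans_val[OF q X] by metis
    then show "z = z'"
      using ex[OF X nat_trans_val[OF p X z(1)] nat_trans_val[OF q X z(1)] comm[OF X z(1)]] z by metis
  qed
  ultimately show "p \<in> PM R A"
    using small_presheaves_M_iff[OF R *(3)] p by blast
qed

lemma M_category_small_presheaves: "M_category PC PM"
  using stable_system_small_presheaves is_category_presheaves
  by (simp add: M_category_def small_presheaves_def)

end


section \<open>Partial maps as graphs\<close>

text \<open>
  The relation from \<open>P\<close> to \<open>T\<close> given by a span. It depends on the isomorphism class of the span only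
  and, the left leg being injective, determines that class.
\<close>
definition span_graph ::
  "('o, 'u) category \<Rightarrow> ('o, 'u) presheaf \<times> ('o \<Rightarrow> 'u \<Rightarrow> 'u) \<times> ('o \<Rightarrow> 'u \<Rightarrow> 'u) \<Rightarrow> ('o \<times> 'u \<times> 'u) set" where
  "span_graph C = (\<lambda>(Z, m, f). {(X, m X z, f X z) | X z. X \<in> Ob C \<and> z \<in> Val Z X})"

text \<open>
  The graphs of partial maps: single-valued natural relations defined on an \<open>M_open\<close> part of \<open>P\<close>.
\<close>
definition partial_map ::
  "('o, 'u) category \<Rightarrow> ('o \<Rightarrow> 'o \<Rightarrow> 'u set) \<Rightarrow> ('o, 'u) presheaf \<Rightarrow> ('o, 'u) presheaf \<Rightarrow>
   ('o \<times> 'u \<times> 'u) set \<Rightarrow> bool" where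
  "partial_map C M P T R \<longleftrightarrow>
     (\<forall>X p t. (X, p, t) \<in> R \<longrightarrow> X \<in> Ob C \<and> p \<in> Val P X \<and> t \<in> Val T X) \<and>
     (\<forall>X p t t'. (X, p, t) \<in> R \<longrightarrow> (X, p, t') \<in> R \<longrightarrow> t = t') \<and>
     (\<forall>X Y f p t. X \<in> Ob C \<longrightarrow> Y \<in> Ob C \<longrightarrow> f \<in> Hom C X Y \<longrightarrow> (Y, p, t) \<in> R \<longrightarrow>
        (X, Act P X Y f p, Act T X Y f t) \<in> R) \<and>
     M_open C M P (\<lambda>X. {p. \<exists>t. (X, p, t) \<in> R})"

definition graph_comp :: "('o \<times> 'u \<times> 'u) set \<Rightarrow> ('o \<times> 'u \<times> 'u) set \<Rightarrow> ('o \<times> 'u \<times> 'u) set" where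
  "graph_comp R' R = {(X, p, r) | X p q r. (X, p, q) \<in> R \<and> (X, q, r) \<in> R'}"

definition graph_of :: "('o, 'u) category \<Rightarrow> ('o, 'u) presheaf \<Rightarrow> ('o \<Rightarrow> 'u \<Rightarrow> 'u) \<Rightarrow> ('o \<times> 'u \<times> 'u) set" where
  "graph_of C P f = {(X, p, f X p) | X p. X \<in> Ob C \<and> p \<in> Val P X}"

lemma partial_mapD:
  assumes "partial_map C M P T R"
  shows partial_map_dom: "\<And>X p t. (X, p, t) \<in> R \<Longrightarrow> X \<in> Ob C \<and> p \<in> Val P X \<and> t \<in> Val T X"
    and partial_map_unique: "\<And>X p t t'. (X, p, t) \<in> R \<Longrightarrow> (X, p, t') \<in> R \<Longrightarrow> t = t'"
    and partial_map_act: "\<And>X Y f p t. X \<in> Ob C \<Longrightarrow> Y \<in> Ob C \<Longrightarrow> f \<in> Hom C X Y \<Longrightarrow> (Y, p, t) \<in> R \<Longrightarrow>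
      (X, Act P X Y f p, Act T X Y f t) \<in> R"
    and partial_map_open: "M_open C M P (\<lambda>X. {p. \<exists>t. (X, p, t) \<in> R})"
  using assms unfolding partial_map_def by blast+

lemma mem_span_graph [simp]:
  "(X, p, t) \<in> span_graph C (Z, m, f) \<longleftrightarrow> X \<in> Ob C \<and> (\<exists>z\<in>Val Z X. p = m X z \<and> t = f X z)"
  by (auto simp: span_graph_def)

lemma mem_graph_comp [simp]:
  "(X, p, r) \<in> graph_comp R' R \<longleftrightarrow> (\<exists>q. (X, p, q) \<in> R \<and> (X, q, r) \<in> R')"
  by (auto simp: graph_comp_def)

lemma mem_graph_of [simp]: "(X, p, t) \<in> graph_of C P f \<longleftrightarrow> X \<in> Ob C \<and> p \<in> Val P X \<and> t = f X p"
  by (auto simp: graph_of_def)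

context M_base
begin

definition span_class where
  "span_class P T R = {s \<in> spans PC PM P T. span_graph C s = R}"

lemma spans_iff [simp]:
  "(Z, m, f) \<in> spans PC PM P T \<longleftrightarrow> Z \<in> Ob PC \<and> m \<in> PM Z P \<and> f \<in> nat_trans C Z T"
  by (simp add: spans_def)

lemma PM_D:
  assumes "P \<in> Ob PC" "Q \<in> Ob PC" "m \<in> PM P Q"
  shows PM_nat_trans: "m \<in> nat_trans C P Q"
    and PM_inj: "\<And>X x y. X \<in> Ob C \<Longrightarrow> x \<in> Val P X \<Longrightarrow> y \<in> Val P X \<Longrightarrow> m X x = m X y \<Longrightarrow> x = y"
    and PM_inj_on: "\<And>X. X \<in> Ob C \<Longrightarrow> inj_on (m X) (Val P X)"
    and PM_open: "M_open C M Q (\<lambda>X. m X ` Val P X)"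
  using assms small_presheaves_M_iff[OF assms(1,2)] by (auto simp: inj_on_def)

lemma PM_pullback:
  assumes "is_pullback PC A P Q f m R p q" and "m \<in> PM P Q"
  shows "p \<in> PM R A"
proof -
  have "P \<in> Ob PC" "Q \<in> Ob PC" "A \<in> Ob PC" "f \<in> Hom PC A Q"
    using assms(1) unfolding is_pullback_def by blast+
  with assms show ?thesis
    using stable_system_small_presheaves[unfolded stable_system_of_monics_def, THEN conjunct2,
        THEN conjunct2, THEN conjunct2, rule_format, THEN conjunct2, rule_format] by blast
qed

lemma span_graph_partial_map:
  assumes P: "P \<in> Ob PC" and s: "(Z, m, f) \<in> spans PC PM P T"
  shows "partial_map C M P T (span_graph C (Z, m, f))"
proof -
  have Z: "Z \<in> Ob PC" "is_presheaf C Z" and m: "m \<in> PM Z P" and f: "f \<in> nat_trans C Z T"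
    using s by auto
  note mn = PM_nat_trans[OF Z(1) P m]
  have im: "m X ` Val Z X = {p. \<exists>t. (X, p, t) \<in> span_graph C (Z, m, f)}" if "X \<in> Ob C" for X
    using that by auto
  have "M_open C M P (\<lambda>X. {p. \<exists>t. (X, p, t) \<in> span_graph C (Z, m, f)})"
    using PM_open[OF Z(1) P m] unfolding M_open_def by (simp add: im)
  moreover have "t = t'"
    if "(X, p, t) \<in> span_graph C (Z, m, f)" "(X, p, t') \<in> span_graph C (Z, m, f)" for X p t t'
    using that PM_inj[OF Z(1) P m] by auto
  moreover have "(X, Act P X Y k p, Act T X Y k t) \<in> span_graph C (Z, m, f)"
    if k: "X \<in> Ob C" "Y \<in> Ob C" "k \<in> Hom C X Y" and pt: "(Y, p, t) \<in> span_graph C (Z, m, f)" for X Y k p t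
  proof -
    obtain z where z: "z \<in> Val Z Y" "p = m Y z" "t = f Y z"
      using pt by auto
    then show ?thesis
      using k presheaf_act[OF Z(2) k z(1)] nat_trans_natural[OF mn k z(1)] nat_trans_natural[OF f k z(1)]
      by (auto intro!: bexI[of _ "Act Z X Y k z"])
  qed
  moreover have "X \<in> Ob C \<and> p \<in> Val P X \<and> t \<in> Val T X"
    if "(X, p, t) \<in> span_graph C (Z, m, f)" for X p t
    using that nat_trans_val[OF mn] nat_trans_val[OF f] by auto
  ultimately show ?thesis
    unfolding partial_map_def by blast
qed

text \<open>
  The span is the domain of definition of \<open>R\<close>, included in \<open>P\<close>; its apex is small as the domain is
  \<open>M_open\<close>.
\<close>
lemma partial_map_span:
  assumes P: "P \<in> Ob PC" and R: "partial_map C M P T R"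
  shows "\<exists>Z m f. (Z, m, f) \<in> spans PC PM P T \<and> span_graph C (Z, m, f) = R"
proof -
  let ?S = "\<lambda>X. {p. \<exists>t. (X, p, t) \<in> R}"
  note S = partial_map_open[OF R]
  define f where "f X p = (THE t. (X, p, t) \<in> R)" for X p
  have f: "f X p = t" if "(X, p, t) \<in> R" for X p t
    unfolding f_def using that partial_map_unique[OF R] by blast
  have fn: "(\<lambda>X\<in>Ob C. \<lambda>p\<in>Val (subpresheaf P ?S) X. f X p) \<in> nat_trans C (subpresheaf P ?S) T"
  proof (rule nat_transI)
    fix X p assume "p \<in> Val (subpresheaf P ?S) X"
    then show "f X p \<in> Val T X"
      using f partial_map_dom[OF R] by auto
  next
    fix X Y k p assume k: "X \<in> Ob C" "Y \<in> Ob C" "k \<in> Hom C X Y" and "p \<in> Val (subpresheaf P ?S) Y"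
    then obtain t where t: "(Y, p, t) \<in> R"
      by auto
    then show "Act (subpresheaf P ?S) X Y k p \<in> Val (subpresheaf P ?S) X \<and>
        f X (Act (subpresheaf P ?S) X Y k p) = Act T X Y k (f Y p)"
      using partial_map_act[OF R k t] f by auto
  qed
  have "span_graph C (subpresheaf P ?S, inclusion C ?S, \<lambda>X\<in>Ob C. \<lambda>p\<in>Val (subpresheaf P ?S) X. f X p) = R"
    (is "?G = R")
  proof -
    have "(X, p, t) \<in> ?G \<longleftrightarrow> (X, p, t) \<in> R" for X p t
      using partial_map_dom[OF R] f by (fastforce simp: inclusion_def)
    then show ?thesis
      by auto
  qed
  then show ?thesis
    using inclusion_M[OF P S] fn by (intro exI conjI) auto
qed

text \<open>
  Over each point \<open>(p, t)\<close> of the graph there is exactly one element of either apex, by injectivity of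
  the left legs. Matching these elements is the isomorphism.
\<close>
lemma span_iso_iff:
  assumes P: "P \<in> Ob PC"
  shows "(s, s') \<in> span_iso PC PM P T \<longleftrightarrow>
    s \<in> spans PC PM P T \<and> s' \<in> spans PC PM P T \<and> span_graph C s = span_graph C s'"
proof -
  obtain Z m f Z' m' f' where s: "s = (Z, m, f)" "s' = (Z', m', f')"
    by (cases s, cases s') auto
  have "(\<exists>\<phi>. is_iso PC Z Z' \<phi> \<and> Comp PC Z Z' P m' \<phi> = m \<and> Comp PC Z Z' T f' \<phi> = f) \<longleftrightarrow>
      span_graph C (Z, m, f) = span_graph C (Z', m', f')"
    if sp: "(Z, m, f) \<in> spans PC PM P T" "(Z', m', f') \<in> spans PC PM P T"
  proof -
    have Z: "Z \<in> Ob PC" "is_presheaf C Z" "m \<in> PM Z P" "f \<in> nat_trans C Z T"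
      and Z': "Z' \<in> Ob PC" "is_presheaf C Z'" "m' \<in> PM Z' P" "f' \<in> nat_trans C Z' T"
      using sp by auto
    note m = PM_nat_trans[OF Z(1) P Z(3)] and m' = PM_nat_trans[OF Z'(1) P Z'(3)]
    show ?thesis
    proof
      assume "\<exists>\<phi>. is_iso PC Z Z' \<phi> \<and> Comp PC Z Z' P m' \<phi> = m \<and> Comp PC Z Z' T f' \<phi> = f"
      then obtain \<phi> where iso: "is_iso (presheaves C) Z Z' \<phi>"
        and eq: "Comp (presheaves C) Z Z' P m' \<phi> = m" "Comp (presheaves C) Z Z' T f' \<phi> = f"
        unfolding presheaves_simps is_iso_small_presheaves by blast
      have bij: "\<phi> X ` Val Z X = Val Z' X" if "X \<in> Ob C" for X
        using that iso is_iso_iff_bij[OF Z(2) Z'(2)] by (simp add: bij_betw_def)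
      have m\<phi>: "m' X (\<phi> X z) = m X z" "f' X (\<phi> X z) = f X z" if "X \<in> Ob C" "z \<in> Val Z X" for X z
        using that eq Comp_apply by metis+
      have "(X, p, t) \<in> span_graph C (Z, m, f) \<longleftrightarrow> (X, p, t) \<in> span_graph C (Z', m', f')" for X p t
        by (cases "X \<in> Ob C") (simp_all add: m\<phi> cong: bex_cong_simp flip: bij)
      then show "span_graph C (Z, m, f) = span_graph C (Z', m', f')"
        by (auto simp del: mem_span_graph)
    next
      assume graph: "span_graph C (Z, m, f) = span_graph C (Z', m', f')"
      have to: "\<exists>z'\<in>Val Z' X. m X z = m' X z' \<and> f X z = f' X z'" if "X \<in> Ob C" "z \<in> Val Z X" for X z
        using mem_span_graph[of X "m X z" "f X z" C Z' m' f'] that by (auto simp flip: graph)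
      have fro: "\<exists>z\<in>Val Z X. m' X z' = m X z" if "X \<in> Ob C" "z' \<in> Val Z' X" for X z'
        using mem_span_graph[of X "m' X z'" "f' X z'" C Z m f] that by (auto simp: graph)
      obtain \<phi> where \<phi>: "\<phi> \<in> nat_trans C Z Z'"
        and m\<phi>: "\<And>X z. X \<in> Ob C \<Longrightarrow> z \<in> Val Z X \<Longrightarrow> m' X (\<phi> X z) = m X z"
        using factor_through_injective[OF Z'(2) Z(2) m' PM_inj_on[OF Z'(1) P Z'(3)] m] to by fastforce
      have f\<phi>: "f' X (\<phi> X z) = f X z" if X: "X \<in> Ob C" "z \<in> Val Z X" for X z
      proof -
        obtain z' where z': "z' \<in> Val Z' X" "m X z = m' X z'" "f X z = f' X z'"
          using to[OF X] by blast
        have "\<phi> X z = z'"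
          using PM_inj[OF Z'(1) P Z'(3) X(1) nat_trans_val[OF \<phi> X] z'(1)] m\<phi>[OF X] z'(2) by simp
        then show ?thesis
          using z' by simp
      qed
      have "bij_betw (\<phi> X) (Val Z X) (Val Z' X)" if X: "X \<in> Ob C" for X
        unfolding bij_betw_def
      proof (intro conjI inj_onI equalityI subsetI)
        fix z w assume "z \<in> Val Z X" "w \<in> Val Z X" "\<phi> X z = \<phi> X w"
        then show "z = w"
          using PM_inj[OF Z(1) P Z(3) X] m\<phi>[OF X] by metis
      next
        fix z' assume z': "z' \<in> Val Z' X"
        then obtain z where z: "z \<in> Val Z X" "m' X z' = m X z"
          using fro[OF X] by blast
        then have "\<phi> X z = z'"
          using PM_inj[OF Z'(1) P Z'(3) X nat_trans_val[OF \<phi> X z(1)] z'] m\<phi>[OF X] by simp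
        then show "z' \<in> \<phi> X ` Val Z X"
          using z by blast
      qed (use nat_trans_val[OF \<phi> X] in blast)
      then have "is_iso PC Z Z' \<phi>"
        using is_iso_iff_bij[OF Z(2) Z'(2)] \<phi> by simp
      moreover have "Comp PC Z Z' P m' \<phi> = m"
        unfolding presheaves_simps
        by (rule nat_trans_eqI[OF Comp_nat_trans[OF Z(2) \<phi> m'] m]) (simp add: m\<phi>)
      moreover have "Comp PC Z Z' T f' \<phi> = f"
        unfolding presheaves_simps
        by (rule nat_trans_eqI[OF Comp_nat_trans[OF Z(2) \<phi> Z'(4)] Z(4)]) (simp add: f\<phi>)
      ultimately show "\<exists>\<phi>. is_iso PC Z Z' \<phi> \<and> Comp PC Z Z' P m' \<phi> = m \<and> Comp PC Z Z' T f' \<phi> = f"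
        by blast
    qed
  qed
  then show ?thesis
    unfolding span_iso_def s by blast
qed

lemma span_iso_class:
  assumes "P \<in> Ob PC" and "s \<in> spans PC PM P T"
  shows "span_iso PC PM P T `` {s} = span_class P T (span_graph C s)"
  using assms by (auto simp: span_iso_iff span_class_def)

lemma Par_simps [simp]:
  "Ob (Par PC PM) = Ob PC"
  "Hom (Par PC PM) P T = spans PC PM P T // span_iso PC PM P T"
  by (simp_all add: Par_def)

lemma Par_Hom_iff:
  assumes P: "P \<in> Ob PC"
  shows "h \<in> Hom (Par PC PM) P T \<longleftrightarrow> (\<exists>R. partial_map C M P T R \<and> h = span_class P T R)"
proof
  assume "h \<in> Hom (Par PC PM) P T"
  then obtain s where s: "s \<in> spans PC PM P T" "h = span_iso PC PM P T `` {s}"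
    by (auto elim: quotientE)
  then show "\<exists>R. partial_map C M P T R \<and> h = span_class P T R"
    using span_graph_partial_map[OF P] span_iso_class[OF P s(1)] by (cases s) blast
next
  assume "\<exists>R. partial_map C M P T R \<and> h = span_class P T R"
  then obtain R where R: "partial_map C M P T R" "h = span_class P T R"
    by blast
  then obtain s where s: "s \<in> spans PC PM P T" "span_graph C s = R"
    using partial_map_span[OF P] by blast
  then have "h = span_iso PC PM P T `` {s}"
    using span_iso_class[OF P s(1)] R by simp
  then show "h \<in> Hom (Par PC PM) P T"
    using s by (auto intro: quotientI)
qed

lemma span_class_eqD:
  assumes "P \<in> Ob PC" "partial_map C M P T R" "span_class P T R' = span_class P T R"
  shows "R' = R"
  using partial_map_span[OF assms(1,2)] assms(3) unfolding span_class_def by blast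

lemma graph_of_partial_map:
  assumes P: "P \<in> Ob PC" and f: "f \<in> nat_trans C P T"
  shows "partial_map C M P T (graph_of C P f)"
    and "span_iso PC PM P T `` {(P, Id PC P, f)} = span_class P T (graph_of C P f)"
proof -
  have "is_iso PC P P (Id (presheaves C) P)"
    using P Id_nat_trans[of C P] is_iso_iff_bij[of P P "Id (presheaves C) P"]
    by (simp add: bij_betw_def inj_on_def image_def)
  then have "Id (presheaves C) P \<in> PM P P"
    using stable_system_small_presheaves P unfolding stable_system_of_monics_def by blast
  then have s: "(P, Id PC P, f) \<in> spans PC PM P T"
    using P f by simp
  have "(X, p, t) \<in> span_graph C (P, Id PC P, f) \<longleftrightarrow> (X, p, t) \<in> graph_of C P f" for X p t
    by auto
  then have "span_graph C (P, Id PC P, f) = graph_of C P f"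
    by auto
  then show "partial_map C M P T (graph_of C P f)"
    "span_iso PC PM P T `` {(P, Id PC P, f)} = span_class P T (graph_of C P f)"
    using span_graph_partial_map[OF P s] span_iso_class[OF P s] by simp_all
qed

lemma Par_inclusion_AMap:
  "P \<in> Ob PC \<Longrightarrow> f \<in> nat_trans C P T \<Longrightarrow>
   AMap (Par_inclusion PC PM) P T f = span_class P T (graph_of C P f)"
  using graph_of_partial_map(2) by (simp add: Par_inclusion_def)

text \<open>
  A pullback of \<open>f\<close> and \<open>n\<close> consists of the pairs \<open>(z, b)\<close> with \<open>f z = n b\<close>, so spans composed by
  pullback have the composite graph. Conversely, the apex \<open>W\<close> of any span with the composite graph
  is itself such a pullback: its two projections exist because \<open>m\<close> and \<open>n\<close> are injective. That is
  why the composite of two classes is a full class.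
\<close>
lemma Par_Comp:
  assumes ob: "P \<in> Ob PC" "T \<in> Ob PC" "U \<in> Ob PC"
    and R: "partial_map C M P T R" and R': "partial_map C M T U R'"
  shows "Comp (Par PC PM) P T U (span_class T U R') (span_class P T R) =
    span_class P U (graph_comp R' R)"
proof (intro equalityI subsetI)
  fix s assume "s \<in> Comp (Par PC PM) P T U (span_class T U R') (span_class P T R)"
  then obtain W Z B m f n g p q where s: "s = (W, Comp PC W Z P m p, Comp PC W B U g q)"
    and 1: "(Z, m, f) \<in> span_class P T R" and 2: "(B, n, g) \<in> span_class T U R'"
    and pb: "is_pullback PC Z B T f n W p q"
    unfolding Par_def by auto
  have Z: "Z \<in> Ob PC" "m \<in> PM Z P" "f \<in> nat_trans C Z T" "span_graph C (Z, m, f) = R"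
    and B: "B \<in> Ob PC" "n \<in> PM B T" "g \<in> nat_trans C B U" "span_graph C (B, n, g) = R'"
    using 1 2 unfolding span_class_def by auto
  have W: "W \<in> Ob PC" and p: "p \<in> nat_trans C W Z" and q: "q \<in> nat_trans C W B"
    and comm: "\<And>X w. X \<in> Ob C \<Longrightarrow> w \<in> Val W X \<Longrightarrow> f X (p X w) = n X (q X w)"
    and ex: "\<And>X z b. X \<in> Ob C \<Longrightarrow> z \<in> Val Z X \<Longrightarrow> b \<in> Val B X \<Longrightarrow> f X z = n X b \<Longrightarrow>
      \<exists>!w. w \<in> Val W X \<and> p X w = z \<and> q X w = b"
    using pb unfolding is_pullback_iff_pointwise by auto
  have "p \<in> PM W Z"
    by (rule PM_pullback[OF pb B(2)])
  then have "Comp PC W Z P m p \<in> PM W P"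
    using stable_system_small_presheaves W Z ob unfolding stable_system_of_monics_def by blast
  moreover have "Comp PC W B U g q \<in> nat_trans C W U"
    using Comp_nat_trans[OF _ q B(3)] W by simp
  ultimately have sp: "s \<in> spans PC PM P U"
    using W s by simp
  have "(X, a, c) \<in> span_graph C s \<longleftrightarrow> (X, a, c) \<in> graph_comp R' R" for X a c
  proof
    assume "(X, a, c) \<in> span_graph C s"
    then obtain w where w: "X \<in> Ob C" "w \<in> Val W X" "a = m X (p X w)" "c = g X (q X w)"
      unfolding s by auto
    have "(X, a, f X (p X w)) \<in> R" "(X, f X (p X w), c) \<in> R'"
      unfolding Z(4)[symmetric] B(4)[symmetric]
      using w comm nat_trans_val[OF p w(1,2)] nat_trans_val[OF q w(1,2)] by auto
    then show "(X, a, c) \<in> graph_comp R' R"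
      by auto
  next
    assume "(X, a, c) \<in> graph_comp R' R"
    then obtain z b where z: "X \<in> Ob C" "z \<in> Val Z X" "b \<in> Val B X" "f X z = n X b"
      "a = m X z" "c = g X b"
      unfolding Z(4)[symmetric] B(4)[symmetric] by auto
    then obtain w where "w \<in> Val W X" "p X w = z" "q X w = b"
      using ex by blast
    then show "(X, a, c) \<in> span_graph C s"
      unfolding s using z by (auto intro!: bexI[of _ w])
  qed
  then have "span_graph C s = graph_comp R' R"
    by auto
  then show "s \<in> span_class P U (graph_comp R' R)"
    using sp by (simp add: span_class_def)
next
  fix s assume "s \<in> span_class P U (graph_comp R' R)"
  moreover obtain W a c where s: "s = (W, a, c)"
    by (cases s) auto
  ultimately have W: "W \<in> Ob PC" "is_presheaf C W" "a \<in> PM W P" "c \<in> nat_trans C W U"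
    and graph: "span_graph C (W, a, c) = graph_comp R' R"
    unfolding span_class_def by auto
  obtain Z m f where Z: "Z \<in> Ob PC" "is_presheaf C Z" "m \<in> PM Z P" "f \<in> nat_trans C Z T"
    and R_eq: "span_graph C (Z, m, f) = R"
    using partial_map_span[OF ob(1) R] by auto
  obtain B n g where B: "B \<in> Ob PC" "is_presheaf C B" "n \<in> PM B T" "g \<in> nat_trans C B U"
    and R'_eq: "span_graph C (B, n, g) = R'"
    using partial_map_span[OF ob(2) R'] by auto
  note a = PM_nat_trans[OF W(1) ob(1) W(3)] and m = PM_nat_trans[OF Z(1) ob(1) Z(3)]
    and n = PM_nat_trans[OF B(1) ob(2) B(3)]
  have fill: "\<exists>z\<in>Val Z X. \<exists>b\<in>Val B X. a X w = m X z \<and> f X z = n X b \<and> c X w = g X b"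
    if "X \<in> Ob C" "w \<in> Val W X" for X w
  proof -
    have "(X, a X w, c X w) \<in> graph_comp R' R"
      unfolding graph[symmetric] using that by auto
    then show ?thesis
      unfolding R_eq[symmetric] R'_eq[symmetric] by auto
  qed
  have a_im: "a X w \<in> m X ` Val Z X" if "X \<in> Ob C" "w \<in> Val W X" for X w
    using fill[OF that] by blast
  obtain p where p: "p \<in> nat_trans C W Z"
    and mp: "\<And>X w. X \<in> Ob C \<Longrightarrow> w \<in> Val W X \<Longrightarrow> m X (p X w) = a X w"
    using factor_through_injective[OF Z(2) W(2) m PM_inj_on[OF Z(1) ob(1) Z(3)] a a_im] by blast
  have fp_im: "Comp (presheaves C) W Z T f p X w \<in> n X ` Val B X" if X: "X \<in> Ob C" "w \<in> Val W X" for X w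
  proof -
    obtain z b where z: "z \<in> Val Z X" "b \<in> Val B X" "a X w = m X z" "f X z = n X b"
      using fill[OF X] by blast
    have "p X w = z"
      using PM_inj[OF Z(1) ob(1) Z(3) X(1) nat_trans_val[OF p X] z(1)] mp[OF X] z(3) by simp
    then show ?thesis
      using X z by auto
  qed
  obtain q where q: "q \<in> nat_trans C W B"
    and nq': "\<And>X w. X \<in> Ob C \<Longrightarrow> w \<in> Val W X \<Longrightarrow> n X (q X w) = Comp (presheaves C) W Z T f p X w"
    using factor_through_injective[OF B(2) W(2) n PM_inj_on[OF B(1) ob(2) B(3)]
        Comp_nat_trans[OF W(2) p Z(4)] fp_im] by blast
  have nq: "n X (q X w) = f X (p X w)" if "X \<in> Ob C" "w \<in> Val W X" for X w
    using nq'[OF that] that by simp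
  have gq: "g X (q X w) = c X w" if X: "X \<in> Ob C" "w \<in> Val W X" for X w
  proof -
    obtain z b where z: "z \<in> Val Z X" "b \<in> Val B X" "a X w = m X z" "f X z = n X b" "c X w = g X b"
      using fill[OF X] by blast
    have "p X w = z"
      using PM_inj[OF Z(1) ob(1) Z(3) X(1) nat_trans_val[OF p X] z(1)] mp[OF X] z(3) by simp
    then have "q X w = b"
      using PM_inj[OF B(1) ob(2) B(3) X(1) nat_trans_val[OF q X] z(2)] nq[OF X] z(4) by simp
    then show ?thesis
      using z by simp
  qed
  have "is_pullback PC Z B T f n W p q"
    unfolding is_pullback_iff_pointwise
  proof (intro conjI ballI impI)
    show "{Z, B, T, W} \<subseteq> Ob PC"
      using Z B ob W by blast
  next
    fix X z b assume X: "X \<in> Ob C" and z: "z \<in> Val Z X" "b \<in> Val B X" "f X z = n X b"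
    then have "(X, m X z, g X b) \<in> graph_comp R' R"
      unfolding R_eq[symmetric] R'_eq[symmetric] by auto
    then obtain w where w: "w \<in> Val W X" "a X w = m X z"
      unfolding graph[symmetric] by auto
    have pw: "p X w = z"
      using PM_inj[OF Z(1) ob(1) Z(3) X nat_trans_val[OF p X w(1)] z(1)] mp[OF X w(1)] w(2) by simp
    have qw: "q X w = b"
      using PM_inj[OF B(1) ob(2) B(3) X nat_trans_val[OF q X w(1)] z(2)] nq[OF X w(1)] z(3) pw by simp
    have "w' = w" if "w' \<in> Val W X" "p X w' = z" for w'
      using PM_inj[OF W(1) ob(1) W(3) X that(1) w(1)] mp[OF X] that pw w(1) by metis
    then show "\<exists>!w. w \<in> Val W X \<and> p X w = z \<and> q X w = b"
      using w(1) pw qw by blast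
  qed (use Z B n p q nq in auto)
  moreover have "Comp PC W Z P m p = a"
    unfolding presheaves_simps
    by (rule nat_trans_eqI[OF Comp_nat_trans[OF W(2) p m] a]) (simp add: mp)
  moreover have "Comp PC W B U g q = c"
    unfolding presheaves_simps
    by (rule nat_trans_eqI[OF Comp_nat_trans[OF W(2) q B(4)] W(4)]) (simp add: gq)
  moreover have "(Z, m, f) \<in> span_class P T R" "(B, n, g) \<in> span_class T U R'"
    using Z B R_eq R'_eq by (simp_all add: span_class_def)
  ultimately show "s \<in> Comp (Par PC PM) P T U (span_class T U R') (span_class P T R)"
    unfolding s Par_def by (auto simp del: presheaves_simps) blast
qed


section \<open>Colimits of small presheaves and of partial maps\<close>

lemma functor_to_presheaves:
  "is_functor J PC F \<Longrightarrow> is_functor J (presheaves C) F"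
  unfolding is_functor_def by simp

lemma small_colimit_exists:
  fixes J :: "('u, 'u) category"
  assumes J: "small_category J" and F: "is_functor J PC F"
  shows "\<exists>L \<iota>. pointwise_colimit C J F L \<iota> \<and> small_presheaf C L"
proof -
  have "small TYPE('u) (Ob J)"
    using J by (simp add: small_category_def)
  then obtain L \<iota> where "pointwise_colimit C J F L \<iota>"
    using pointwise_colimit_exists functor_to_presheaves[OF F] by blast
  then show ?thesis
    using colimit_small_presheaf[OF J functor_to_presheaves[OF F]] F by (auto simp: is_functor_def)
qed

lemma has_small_colimits_small_presheaves: "has_small_colimits TYPE('u) PC"
  unfolding has_small_colimits_def
proof (intro allI impI)
  fix J :: "('u, 'u) category" and F
  assume J: "small_category J" and F: "is_functor J PC F"
  obtain L \<iota> where L: "pointwise_colimit C J F L \<iota>" "small_presheaf C L"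
    using small_colimit_exists[OF J F] by blast
  then show "\<exists>L \<iota>. is_colimit PC J F L \<iota>"
    using pointwise_colimit_is_colimit[OF functor_to_presheaves[OF F] L(1), of "{P. small_presheaf C P}"]
    by (auto simp: small_presheaves_def)
qed

lemma small_presheaves_colimit_is_pointwise:
  fixes J :: "('u, 'u) category"
  assumes J: "small_category J" and F: "is_functor J PC F" and L: "is_colimit PC J F L \<iota>"
  shows "pointwise_colimit C J F L \<iota>"
proof -
  obtain L0 \<iota>0 where L0: "pointwise_colimit C J F L0 \<iota>0" "small_presheaf C L0"
    using small_colimit_exists[OF J F] by blast
  show ?thesis
    by (rule colimit_is_pointwise[OF functor_to_presheaves[OF F] _ L0(1), of "{P. small_presheaf C P}"])
      (use L L0(2) in \<open>simp_all add: small_presheaves_def\<close>)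
qed

text \<open>
  A cocone of partial maps consists of graphs \<open>R j\<close> such that \<open>R j\<close> is the preimage of \<open>R k\<close> under
  each \<open>u : j \<rightarrow> k\<close>. So the set of all \<open>t\<close> with \<open>(X, x, t) \<in> R j\<close> is unchanged when \<open>x\<close> moves along a
  zigzag, and depends only on the element \<open>\<iota> j X x\<close> of the colimit \<open>L\<close>. Hence the \<open>R j\<close> are the
  preimages of a single relation \<open>R0\<close> on \<open>L\<close>, which is unique by joint surjectivity of the legs. Its
  domain is \<open>M_open\<close>, since the restrictions of \<open>\<iota> j X x\<close> that lie in it correspond to those of \<open>x\<close>
  that lie in the domain of \<open>R j\<close>.
\<close>
lemma preserves_small_colimits_Par:
  "preserves_small_colimits TYPE('u) PC (Par PC PM) (Par_inclusion PC PM)"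
  unfolding preserves_small_colimits_def
proof (intro allI impI)
  fix J :: "('u, 'u) category" and F L \<iota>
  assume J: "small_category J" and F: "is_functor J PC F" and L: "is_colimit PC J F L \<iota>"
  note pw = small_presheaves_colimit_is_pointwise[OF J F L]
  have Lob: "L \<in> Ob PC" and Lp: "is_presheaf C L"
    using L by (auto simp: is_colimit_def is_cocone_def)
  have Fob: "\<And>j. j \<in> Ob J \<Longrightarrow> OMap F j \<in> Ob PC" and Fp: "\<And>j. j \<in> Ob J \<Longrightarrow> is_presheaf C (OMap F j)"
    and Fn: "\<And>j k u. j \<in> Ob J \<Longrightarrow> k \<in> Ob J \<Longrightarrow> u \<in> Hom J j k \<Longrightarrow>
      AMap F j k u \<in> nat_trans C (OMap F j) (OMap F k)"
    using F by (auto simp: is_functor_def)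
  note \<iota> = pointwise_colimit_leg[OF pw]
  have \<iota>_step: "\<iota> j X x = \<iota> k X (AMap F j k u X x)"
    if "X \<in> Ob C" "j \<in> Ob J" "k \<in> Ob J" "u \<in> Hom J j k" "x \<in> Val (OMap F j) X" for X j k u x
    using cocone_legs_step[of C UNIV J F L \<iota>] pointwise_colimit_cocone[OF pw] that
    by (auto simp: full_subcategory_UNIV)
  let ?G = "functor_comp (Par_inclusion PC PM) F"
  let ?\<iota> = "\<lambda>j. AMap (Par_inclusion PC PM) (OMap F j) L (\<iota> j)"
  have G_ob [simp]: "OMap ?G j = OMap F j" "OMap (Par_inclusion PC PM) L = L" for j
    by (simp_all add: functor_comp_def Par_inclusion_def)
  have G_map: "AMap ?G j k u = span_class (OMap F j) (OMap F k) (graph_of C (OMap F j) (AMap F j k u))"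
    if "j \<in> Ob J" "k \<in> Ob J" "u \<in> Hom J j k" for j k u
    using Par_inclusion_AMap[OF Fob Fn] that by (simp add: functor_comp_def Par_inclusion_def)
  have \<iota>_class: "?\<iota> j = span_class (OMap F j) L (graph_of C (OMap F j) (\<iota> j))" if "j \<in> Ob J" for j
    using Par_inclusion_AMap[OF Fob \<iota>] that by blast
  note gF = graph_of_partial_map(1)[OF Fob Fn] and g\<iota> = graph_of_partial_map(1)[OF Fob \<iota>]
  have "is_cocone (Par PC PM) J ?G L ?\<iota>"
    unfolding is_cocone_def G_ob
  proof (intro conjI ballI)
    show "L \<in> Ob (Par PC PM)"
      using Lob by simp
    show "?\<iota> j \<in> Hom (Par PC PM) (OMap F j) L" if j: "j \<in> Ob J" for j
      unfolding \<iota>_class[OF j] Par_Hom_iff[OF Fob[OF j]] using g\<iota>[OF j j] by blast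
    fix j k u assume u: "j \<in> Ob J" "k \<in> Ob J" "u \<in> Hom J j k"
    have "graph_comp (graph_of C (OMap F k) (\<iota> k)) (graph_of C (OMap F j) (AMap F j k u)) =
        graph_of C (OMap F j) (\<iota> j)"
      using \<iota>_step[OF _ u] nat_trans_val[OF Fn[OF u]] by (auto simp: graph_comp_def)
    then show "Comp (Par PC PM) (OMap F j) (OMap F k) L (?\<iota> k) (AMap ?G j k u) = ?\<iota> j"
      unfolding \<iota>_class[OF u(1)] \<iota>_class[OF u(2)] G_map[OF u]
        Par_Comp[OF Fob[OF u(1)] Fob[OF u(2)] Lob gF[OF u(1) u] g\<iota>[OF u(2) u(2)]]
      by simp
  qed
  moreover have "\<exists>!h. h \<in> Hom (Par PC PM) L T \<and> (\<forall>j\<in>Ob J. Comp (Par PC PM) (OMap F j) L T h (?\<iota> j) = \<tau> j)"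
    if \<tau>: "is_cocone (Par PC PM) J ?G T \<tau>" for T \<tau>
  proof -
    have T: "T \<in> Ob PC"
      using \<tau> by (simp add: is_cocone_def)
    have "\<forall>j\<in>Ob J. \<exists>R. partial_map C M (OMap F j) T R \<and> \<tau> j = span_class (OMap F j) T R"
      using \<tau> Par_Hom_iff[OF Fob] unfolding is_cocone_def G_ob by blast
    then obtain R where R: "\<And>j. j \<in> Ob J \<Longrightarrow> partial_map C M (OMap F j) T (R j)"
      and \<tau>_class: "\<And>j. j \<in> Ob J \<Longrightarrow> \<tau> j = span_class (OMap F j) T (R j)"
      by metis
    have R_step: "(X, x, t) \<in> R j \<longleftrightarrow> (X, AMap F j k u X x, t) \<in> R k"
      if u: "j \<in> Ob J" "k \<in> Ob J" "u \<in> Hom J j k" and x: "X \<in> Ob C" "x \<in> Val (OMap F j) X" for X j k u x t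
    proof -
      have "Comp (Par PC PM) (OMap F j) (OMap F k) T (\<tau> k) (AMap ?G j k u) = \<tau> j"
        using \<tau> u unfolding is_cocone_def G_ob by blast
      then have "span_class (OMap F j) T (graph_comp (R k) (graph_of C (OMap F j) (AMap F j k u))) =
          span_class (OMap F j) T (R j)"
        unfolding \<tau>_class[OF u(1)] \<tau>_class[OF u(2)] G_map[OF u]
          Par_Comp[OF Fob[OF u(1)] Fob[OF u(2)] T gF[OF u(1) u] R[OF u(2)]] .
      then have "graph_comp (R k) (graph_of C (OMap F j) (AMap F j k u)) = R j"
        by (rule span_class_eqD[OF Fob[OF u(1)] R[OF u(1)]])
      from this[symmetric] show ?thesis
        using x by simp
    qed
    have R_eq: "(X, x, t) \<in> R j \<longleftrightarrow> (X, y, t) \<in> R k"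
      if "X \<in> Ob C" "j \<in> Ob J" "k \<in> Ob J" "x \<in> Val (OMap F j) X" "y \<in> Val (OMap F k) X"
        "\<iota> j X x = \<iota> k X y" for X j k x y t
      using pointwise_colimit_exact[OF pw that]
      by (rule colim_rel_invariant) (use R_step that(1) in blast)
    define R0 where "R0 = {(X, \<iota> j X x, t) | X j x t. j \<in> Ob J \<and> (X, x, t) \<in> R j}"
    have R0: "(X, \<iota> j X x, t) \<in> R0 \<longleftrightarrow> (X, x, t) \<in> R j"
      if "X \<in> Ob C" "j \<in> Ob J" "x \<in> Val (OMap F j) X" for X j x t
    proof
      assume "(X, \<iota> j X x, t) \<in> R0"
      then obtain k y where k: "k \<in> Ob J" "(X, y, t) \<in> R k" "\<iota> j X x = \<iota> k X y"
        by (auto simp: R0_def)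
      then show "(X, x, t) \<in> R j"
        using R_eq[OF that(1,2) k(1) that(3) _ k(3)] partial_map_dom[OF R[OF k(1)] k(2)] by blast
    qed (use that in \<open>auto simp: R0_def\<close>)
    have R0_cases: "\<exists>j\<in>Ob J. \<exists>x. X \<in> Ob C \<and> x \<in> Val (OMap F j) X \<and> l = \<iota> j X x \<and> (X, x, t) \<in> R j \<and>
        t \<in> Val T X" if "(X, l, t) \<in> R0" for X l t
      using that partial_map_dom[OF R] by (fastforce simp: R0_def)
    have "partial_map C M L T R0"
      unfolding partial_map_def
    proof (intro conjI allI impI)
      fix X l t t' assume "(X, l, t) \<in> R0" "(X, l, t') \<in> R0"
      then show "t = t'"
        using R0_cases[of X l t] R0 partial_map_unique[OF R] by blast
    next
      fix X Y f l t assume f: "X \<in> Ob C" "Y \<in> Ob C" "f \<in> Hom C X Y" and "(Y, l, t) \<in> R0"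
      then obtain j x where j: "j \<in> Ob J" "x \<in> Val (OMap F j) Y" "l = \<iota> j Y x" "(Y, x, t) \<in> R j"
        using R0_cases by blast
      have "(X, Act (OMap F j) X Y f x, Act T X Y f t) \<in> R j"
        using partial_map_act[OF R[OF j(1)] f j(4)] .
      then have "(X, \<iota> j X (Act (OMap F j) X Y f x), Act T X Y f t) \<in> R0"
        using R0[OF f(1) j(1) presheaf_act[OF Fp[OF j(1)] f j(2)]] by blast
      then show "(X, Act L X Y f l, Act T X Y f t) \<in> R0"
        using nat_trans_natural[OF \<iota>[OF j(1)] f j(2)] j(3) by simp
    next
      show "M_open C M L (\<lambda>X. {l. \<exists>t. (X, l, t) \<in> R0})"
        unfolding M_open_def
      proof (intro conjI ballI)
        fix X show "{l. \<exists>t. (X, l, t) \<in> R0} \<subseteq> Val L X"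
          using R0_cases nat_trans_val[OF \<iota>] by blast
      next
        fix D l assume D: "D \<in> Ob C" "l \<in> Val L D"
        obtain j x where j: "j \<in> Ob J" "x \<in> Val (OMap F j) D" "l = \<iota> j D x"
          using pointwise_colimit_cover[OF pw D] by blast
        have "Act L X D f l \<in> {l. \<exists>t. (X, l, t) \<in> R0} \<longleftrightarrow>
            Act (OMap F j) X D f x \<in> {x. \<exists>t. (X, x, t) \<in> R j}" if f: "X \<in> Ob C" "f \<in> Hom C X D" for X f
          using R0[OF f(1) j(1) presheaf_act[OF Fp[OF j(1)] f(1) D(1) f(2) j(2)]]
            nat_trans_natural[OF \<iota>[OF j(1)] f(1) D(1) f(2) j(2)] j(3) by simp
        then show "\<exists>B\<in>Ob C. \<exists>m\<in>M B D. \<forall>X\<in>Ob C. \<forall>f\<in>Hom C X D.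
            Act L X D f l \<in> {l. \<exists>t. (X, l, t) \<in> R0} \<longleftrightarrow> (\<exists>g\<in>Hom C X B. f = Comp C X B D m g)"
          using M_open_classifier[OF partial_map_open[OF R[OF j(1)]] D(1) j(2)] by simp
      qed
    qed (use R0_cases nat_trans_val[OF \<iota>] in blast)+
    note R0_map = this
    have comp_class: "Comp (Par PC PM) (OMap F j) L T (span_class L T R') (?\<iota> j) =
        span_class (OMap F j) T (graph_comp R' (graph_of C (OMap F j) (\<iota> j)))"
      if "j \<in> Ob J" "partial_map C M L T R'" for j R'
      unfolding \<iota>_class[OF that(1)] using Par_Comp[OF Fob Lob T g\<iota>] that by blast
    have "graph_comp R0 (graph_of C (OMap F j) (\<iota> j)) = R j" if j: "j \<in> Ob J" for j
    proof -
      have "(X, x, t) \<in> graph_comp R0 (graph_of C (OMap F j) (\<iota> j)) \<longleftrightarrow> (X, x, t) \<in> R j" for X x t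
        using R0[OF _ j] partial_map_dom[OF R[OF j]] by auto
      then show ?thesis
        by auto
    qed
    then have "span_class L T R0 \<in> Hom (Par PC PM) L T \<and>
        (\<forall>j\<in>Ob J. Comp (Par PC PM) (OMap F j) L T (span_class L T R0) (?\<iota> j) = \<tau> j)"
      using Par_Hom_iff[OF Lob] R0_map comp_class[OF _ R0_map] \<tau>_class by auto
    moreover have "h = span_class L T R0"
      if h: "h \<in> Hom (Par PC PM) L T" "\<forall>j\<in>Ob J. Comp (Par PC PM) (OMap F j) L T h (?\<iota> j) = \<tau> j" for h
    proof -
      obtain R' where R': "partial_map C M L T R'" "h = span_class L T R'"
        using h(1) Par_Hom_iff[OF Lob] by blast
      have "graph_comp R' (graph_of C (OMap F j) (\<iota> j)) = R j" if j: "j \<in> Ob J" for j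
      proof (rule span_class_eqD[OF Fob[OF j] R[OF j]])
        show "span_class (OMap F j) T (graph_comp R' (graph_of C (OMap F j) (\<iota> j))) =
            span_class (OMap F j) T (R j)"
          using h(2) j comp_class[OF j R'(1)] R'(2) \<tau>_class[OF j] by simp
      qed
      then have R'_iff: "(X, \<iota> j X x, t) \<in> R' \<longleftrightarrow> (X, x, t) \<in> R j"
        if "X \<in> Ob C" "j \<in> Ob J" "x \<in> Val (OMap F j) X" for X j x t
        using that mem_graph_comp[of X x t R' "graph_of C (OMap F j) (\<iota> j)"] by auto
      have "(X, l, t) \<in> R' \<longleftrightarrow> (X, l, t) \<in> R0" if X: "X \<in> Ob C" "l \<in> Val L X" for X l t
        using pointwise_colimit_cover[OF pw X] R0[OF X(1)] R'_iff[OF X(1)] by metis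
      then have "(X, l, t) \<in> R' \<longleftrightarrow> (X, l, t) \<in> R0" for X l t
        using partial_map_dom[OF R'(1), of X l t] partial_map_dom[OF R0_map, of X l t] by blast
      then have "R' = R0"
        by auto
      then show ?thesis
        using R' by simp
    qed
    ultimately show ?thesis
      by blast
  qed
  ultimately show "is_colimit (Par PC PM) J ?G (OMap (Par_inclusion PC PM) L) ?\<iota>"
    unfolding is_colimit_def G_ob by blast
qed

end

theorem lemma43:
  fixes C :: "('o, 'u) category"
    and M :: "'o \<Rightarrow> 'o \<Rightarrow> 'u set"
  assumes "universe TYPE('u)"
    and "locally_small_M_category TYPE('u) C M"
  shows "cocomplete_M_category TYPE('u) (small_presheaves C) (small_presheaves_M C M)"
proof -
  interpret M_base C M
    using assms by unfold_locales (simp_all add: locally_small_M_category_def)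
  show ?thesis
    unfolding cocomplete_M_category_def
    using M_category_small_presheaves has_small_colimits_small_presheaves preserves_small_colimits_Par
    by blast
qed

end
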